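(* For every $r\in(2,3)$ there exists a constant $c_r>0$, depending only on $r$, such that the following holds with the determining wavenumber $\Lambda_{u,r}(t)$ defined using this $c_r$. Let $L>0$, $\nu>0$, let $f$ be a zero-mean force, and let $u(t)$ and $v(t)$, $t\ge 0$, be weak solutions on $[0,\infty)$ of the 3D Navier-Stokes equations on $\mathbb{T}^3=[0,L]^3$ with the same viscosity $\nu$ and the same force $f$. Let $\Lambda(t):=\max\{\Lambda_{u,r}(t),\Lambda_{v,r}(t)\}$ and let $Q(t)$ be such that $\Lambda(t)=\lambda_{Q(t)}$. If $$u(t)_{\le Q(t)}=v(t)_{\le Q(t)}\qquad \text{for all } t>0,$$ then $$\lim_{t\to\infty}\|u(t)-v(t)\|_{L^2}=0 .$$
   Context: Equations: on the torus $\mathbb{T}^3=[0,L]^3$ (periodic), $u_t+(u\cdot\nabla)u-\nu\Delta u+\nabla p=f$, $\nabla\cdot u=0$, with $\nu>0$, $f\in H^{-1}(\mathbb{T}^3)$ a time-independent force of zero mean; all solutions are of zero mean. Weak solution on $[0,T]$: a function $u\in C_{\mathrm w}([0,T];L^2(\mathbb{T}^3))\cap L^2_{\rm loc}([0,T];H^1(\mathbb{T}^3))$ (weakly continuous in time with values in $L^2$), with $\nabla\cdot u=0$ in the sense of distributions, such that $$(u(t),\varphi(t))+\int_0^t\big[-(u,\partial_t\varphi)+\nu(\nabla u,\nabla\varphi)+(u\cdot\nabla u,\varphi)-(f,\varphi)\big]\,ds=(u(0),\varphi(0))$$ for all $t\in[0,T]$ and all $\varphi\in C^\infty([0,T]\times\mathbb{T}^3)$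 with $\nabla\cdot\varphi=0$; $(\cdot,\cdot)$ is the $L^2$ inner product (or $H^{-1}$-$H^1$ duality). A weak solution on $[0,\infty)$ is one whose restriction to $[0,T]$ is a weak solution for every $T>0$. Littlewood-Paley projections: $\lambda_q:=2^q/L$ for integers $q$. Fix once and for all a nonnegative radial $\chi\in C_0^\infty(\mathbb{R}^3)$ with $\chi(\xi)=1$ for $|\xi|\le 3/4$ and $\chi(\xi)=0$ for $|\xi|\ge1$ (constants may depend on this fixed $\chi$). Let $\varphi(\xi)=\chi(\xi/2)-\chi(\xi)$, $\varphi_q(\xi)=\varphi(2^{-q}\xi)$ for $q\ge0$, $\varphi_{-1}=\chi$. For $q\ge-1$, $u_q:=\Delta_q u:=\sum_{k\in\mathbb{Z}^3}\widehat u(k)\varphi_q(k)e^{i\frac{2\pi}{L}k\cdot x}$, where $\widehat u(k)$ is the $k$th Fourier coefficient, and $u_{\le q}:=\sum_{p=-1}^q u_p$. Determining wavenumber: for $r\in(2,3)$ and a constant $c_r>0$, $$\Lambda_{u,r}(t):=\min\{\lambda_q:\ q\in\mathbb{N},\ \lambda_p^{-1+\frac3r}\|u_p(t)\|_{L^r}<c_r\nu\ \ \forall p>q,\ \text{ and }\ \lambda_q^{-1}\|u_{\le q}(t)\|_{L^\infty}<c_r\nu\},$$ where $\mathbb{N}=\{0,1,2,\dots\}$ and $\min\emptyset=\infty$. If $\Lambda(t)=\infty$ then $Q(t)=\infty$ and $u_{\le\infty}:=u$. *)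

theory Defs
  imports "HOL-Analysis.Analysis" "HOL-Probability.Essential_Supremum" "HOL-Library.Extended_Nat"
begin

section \<open>Smooth functions\<close>

text \<open>
  \<open>Ck_on k S f\<close>: all derivatives of order at most \<open>k\<close> exist and are continuous on \<open>S\<close>.
  Derivatives are taken within \<open>S\<close>, hence one-sided in time at the ends of
  \<open>S = {0..T} \<times> UNIV\<close>.
\<close>

primrec Ck_on ::
  "nat \<Rightarrow> 'a::real_normed_vector set \<Rightarrow> ('a \<Rightarrow> 'b::real_normed_vector) \<Rightarrow> bool" where
  "Ck_on 0 S f \<longleftrightarrow> continuous_on S f"
| "Ck_on (Suc k) S f \<longleftrightarrow>
     (\<exists>f'. (\<forall>x\<in>S. (f has_derivative f' x) (at x within S)) \<and> (\<forall>v. Ck_on k S (\<lambda>x. f' x v)))"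

definition smooth_on ::
  "'a::real_normed_vector set \<Rightarrow> ('a \<Rightarrow> 'b::real_normed_vector) \<Rightarrow> bool" where
  "smooth_on S f \<longleftrightarrow> (\<forall>k. Ck_on k S f)"


section \<open>Function spaces on the torus\<close>

text \<open>
  A field on the torus is a function on \<open>real^3\<close> of which only the values on the cube
  \<open>[0,L]^3\<close> matter, up to null sets. Smooth test functions are \<open>L\<close>-periodic on all of
  \<open>real^3\<close>. The measure is not normalized: the torus has volume \<open>L^3\<close>.
\<close>

definition torus :: "real \<Rightarrow> (real^3) measure" where
  "torus L = lebesgue_on (cbox 0 (vec L))"

definition periodic :: "real \<Rightarrow> (real^3 \<Rightarrow> 'b) \<Rightarrow> bool" where
  "periodic L g \<longleftrightarrow> (\<forall>x i. g (x + L *\<^sub>R axis i 1) = g x)"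

definition Lp_norm :: "real \<Rightarrow> real \<Rightarrow> (real^3 \<Rightarrow> 'b::real_normed_vector) \<Rightarrow> real" where
  "Lp_norm L p g = (LINT x|torus L. norm (g x) powr p) powr (1 / p)"

definition Linf_norm :: "real \<Rightarrow> (real^3 \<Rightarrow> 'b::real_normed_vector) \<Rightarrow> ereal" where
  "Linf_norm L g = esssup (torus L) (\<lambda>x. ereal (norm (g x)))"

definition in_L2 :: "real \<Rightarrow> (real^3 \<Rightarrow> 'b::euclidean_space) \<Rightarrow> bool" where
  "in_L2 L g \<longleftrightarrow> g \<in> borel_measurable (torus L) \<and> integrable (torus L) (\<lambda>x. (norm (g x))\<^sup>2)"

definition L2_inner ::
  "real \<Rightarrow> (real^3 \<Rightarrow> 'b::euclidean_space) \<Rightarrow> (real^3 \<Rightarrow> 'b) \<Rightarrow> real" where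
  "L2_inner L g h = (LINT x|torus L. g x \<bullet> h x)"

definition zero_mean :: "real \<Rightarrow> (real^3 \<Rightarrow> real^3) \<Rightarrow> bool" where
  "zero_mean L g \<longleftrightarrow> (LINT x|torus L. g x) = 0"

definition grad :: "(real^3 \<Rightarrow> real) \<Rightarrow> real^3 \<Rightarrow> real^3" where
  "grad \<psi> x = (\<chi> j. frechet_derivative \<psi> (at x) (axis j 1))"

definition divergence :: "(real^3 \<Rightarrow> real^3) \<Rightarrow> real^3 \<Rightarrow> real" where
  "divergence g x = trace (jacobian g (at x))"

text \<open>Matrix convention as for \<open>jacobian\<close>: \<open>G x $ i $ j\<close> is the \<open>j\<close>-th derivative of \<open>g x $ i\<close>.\<close>

definition has_weak_grad :: "real \<Rightarrow> (real^3 \<Rightarrow> real^3) \<Rightarrow> (real^3 \<Rightarrow> real^3^3) \<Rightarrow> bool" where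
  "has_weak_grad L g G \<longleftrightarrow> in_L2 L G \<and>
     (\<forall>\<psi>. smooth_on UNIV \<psi> \<and> periodic L \<psi> \<longrightarrow>
       (\<forall>i j. (LINT x|torus L. g x $ i * grad \<psi> x $ j) = - (LINT x|torus L. G x $ i $ j * \<psi> x)))"

definition in_H1 :: "real \<Rightarrow> (real^3 \<Rightarrow> real^3) \<Rightarrow> bool" where
  "in_H1 L g \<longleftrightarrow> in_L2 L g \<and> (\<exists>G. has_weak_grad L g G)"

text \<open>The weak gradient is unique only up to null sets; it is used only inside integrals.\<close>

definition weak_grad :: "real \<Rightarrow> (real^3 \<Rightarrow> real^3) \<Rightarrow> real^3 \<Rightarrow> real^3^3" where
  "weak_grad L g = (SOME G. has_weak_grad L g G)"

definition H1_norm :: "real \<Rightarrow> (real^3 \<Rightarrow> real^3) \<Rightarrow> real" where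
  "H1_norm L g = sqrt ((Lp_norm L 2 g)\<^sup>2 + (Lp_norm L 2 (weak_grad L g))\<^sup>2)"

definition weakly_div_free :: "real \<Rightarrow> (real^3 \<Rightarrow> real^3) \<Rightarrow> bool" where
  "weakly_div_free L g \<longleftrightarrow>
     (\<forall>\<psi>. smooth_on UNIV \<psi> \<and> periodic L \<psi> \<longrightarrow> L2_inner L g (grad \<psi>) = 0)"

text \<open>
  \<open>H^{-1}\<close> is the dual of \<open>H^1\<close>: its elements are the bounded linear functionals on \<open>H^1\<close>
  (values at arguments outside \<open>H^1\<close> are irrelevant), and the duality pairing of \<open>f\<close> and
  \<open>\<phi>\<close> is \<open>f \<phi>\<close>. The mean of \<open>f\<close> is given by its action on constant fields.
\<close>

definition in_Hminus1 :: "real \<Rightarrow> ((real^3 \<Rightarrow> real^3) \<Rightarrow> real) \<Rightarrow> bool" where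
  "in_Hminus1 L f \<longleftrightarrow>
     (\<forall>g h. in_H1 L g \<and> in_H1 L h \<longrightarrow> f (\<lambda>x. g x + h x) = f g + f h) \<and>
     (\<forall>a g. in_H1 L g \<longrightarrow> f (\<lambda>x. a *\<^sub>R g x) = a * f g) \<and>
     (\<exists>C. \<forall>g. in_H1 L g \<longrightarrow> \<bar>f g\<bar> \<le> C * H1_norm L g)"

definition zero_mean_force :: "((real^3 \<Rightarrow> real^3) \<Rightarrow> real) \<Rightarrow> bool" where
  "zero_mean_force f \<longleftrightarrow> (\<forall>e. f (\<lambda>x. e) = 0)"


section \<open>Weak solutions of the Navier--Stokes equations\<close>

definition test_field :: "real \<Rightarrow> real \<Rightarrow> (real \<Rightarrow> real^3 \<Rightarrow> real^3) \<Rightarrow> bool" where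
  "test_field L T \<phi> \<longleftrightarrow>
     smooth_on ({0..T} \<times> UNIV) (\<lambda>(s, x). \<phi> s x) \<and>
     (\<forall>s\<in>{0..T}. periodic L (\<phi> s) \<and> (\<forall>x. divergence (\<phi> s) x = 0))"

definition weakly_continuous_L2 :: "real \<Rightarrow> real \<Rightarrow> (real \<Rightarrow> real^3 \<Rightarrow> real^3) \<Rightarrow> bool" where
  "weakly_continuous_L2 L T u \<longleftrightarrow>
     (\<forall>t\<in>{0..T}. in_L2 L (u t)) \<and>
     (\<forall>g. in_L2 L g \<longrightarrow> continuous_on {0..T} (\<lambda>t. L2_inner L (u t) g))"

text \<open>
  Only integrability of the squared \<open>H^1\<close> norm is required. For weakly \<open>L^2\<close>-continuous \<open>u\<close>,
  strong measurability of \<open>u\<close> as an \<open>H^1\<close>-valued map is automatic (Pettis).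
\<close>

definition L2_H1 :: "real \<Rightarrow> real \<Rightarrow> (real \<Rightarrow> real^3 \<Rightarrow> real^3) \<Rightarrow> bool" where
  "L2_H1 L T u \<longleftrightarrow>
     (AE t in lebesgue_on {0..T}. in_H1 L (u t)) \<and>
     integrable (lebesgue_on {0..T}) (\<lambda>t. (H1_norm L (u t))\<^sup>2)"

definition weak_solution_upto ::
  "real \<Rightarrow> real \<Rightarrow> ((real^3 \<Rightarrow> real^3) \<Rightarrow> real) \<Rightarrow> real \<Rightarrow> (real \<Rightarrow> real^3 \<Rightarrow> real^3) \<Rightarrow> bool" where
  "weak_solution_upto L \<nu> f T u \<longleftrightarrow>
     weakly_continuous_L2 L T u \<and> L2_H1 L T u \<and>
     (\<forall>t\<in>{0..T}. weakly_div_free L (u t)) \<and>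
     (\<forall>t\<in>{0..T}. \<forall>\<phi>. test_field L T \<phi> \<longrightarrow>
        L2_inner L (u t) (\<phi> t) +
        (LINT s|lebesgue_on {0..t}.
           - L2_inner L (u s) (\<lambda>x. vector_derivative (\<lambda>\<tau>. \<phi> \<tau> x) (at s within {0..T}))
           + \<nu> * L2_inner L (weak_grad L (u s)) (\<lambda>x. jacobian (\<phi> s) (at x))
           + L2_inner L (\<lambda>x. weak_grad L (u s) x *v u s x) (\<phi> s)
           - f (\<phi> s))
        = L2_inner L (u 0) (\<phi> 0))"

definition weak_solution ::
  "real \<Rightarrow> real \<Rightarrow> ((real^3 \<Rightarrow> real^3) \<Rightarrow> real) \<Rightarrow> (real \<Rightarrow> real^3 \<Rightarrow> real^3) \<Rightarrow> bool" where
  "weak_solution L \<nu> f u \<longleftrightarrow> (\<forall>T>0. weak_solution_upto L \<nu> f T u)"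


section \<open>Littlewood--Paley projections\<close>

definition LP_cutoff :: "(real^3 \<Rightarrow> real) \<Rightarrow> bool" where
  "LP_cutoff chi \<longleftrightarrow>
     smooth_on UNIV chi \<and>
     (\<forall>\<xi>. chi \<xi> \<ge> 0) \<and>
     (\<forall>\<xi> \<eta>. norm \<xi> = norm \<eta> \<longrightarrow> chi \<xi> = chi \<eta>) \<and>
     (\<forall>\<xi>. norm \<xi> \<le> 3/4 \<longrightarrow> chi \<xi> = 1) \<and>
     (\<forall>\<xi>. norm \<xi> \<ge> 1 \<longrightarrow> chi \<xi> = 0)"

definition LP_mult :: "(real^3 \<Rightarrow> real) \<Rightarrow> int \<Rightarrow> real^3 \<Rightarrow> real" where
  "LP_mult chi q \<xi> =
     (let \<phi> = (\<lambda>\<zeta>. chi (\<zeta> /\<^sub>R 2) - chi \<zeta>)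
      in if q = -1 then chi \<xi> else \<phi> ((2 powi (- q)) *\<^sub>R \<xi>))"

definition freq :: "int^3 \<Rightarrow> real^3" where
  "freq k = (\<chi> i. real_of_int (k $ i))"

definition fourier_coeff :: "real \<Rightarrow> (real^3 \<Rightarrow> real^3) \<Rightarrow> int^3 \<Rightarrow> complex^3" where
  "fourier_coeff L g k =
     (\<chi> i. (LINT x|torus L. complex_of_real (g x $ i) * cis (- (2 * pi / L * (freq k \<bullet> x))))
           / complex_of_real (L ^ 3))"

text \<open>
  The projections of a real field are regarded as \<open>complex^3\<close>-valued. The sum over \<open>k\<close> has
  only finitely many nonzero terms when \<open>chi\<close> is a cutoff.
\<close>

definition LP_proj ::
  "(real^3 \<Rightarrow> real) \<Rightarrow> real \<Rightarrow> int \<Rightarrow> (real^3 \<Rightarrow> real^3) \<Rightarrow> real^3 \<Rightarrow> complex^3" where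
  "LP_proj chi L q g x =
     (\<Sum>\<^sub>\<infinity>k. (complex_of_real (LP_mult chi q (freq k)) * cis (2 * pi / L * (freq k \<bullet> x)))
            *s fourier_coeff L g k)"

definition LP_low ::
  "(real^3 \<Rightarrow> real) \<Rightarrow> real \<Rightarrow> enat \<Rightarrow> (real^3 \<Rightarrow> real^3) \<Rightarrow> real^3 \<Rightarrow> complex^3" where
  "LP_low chi L Q g x =
     (case Q of enat q \<Rightarrow> (\<Sum>p = -1..int q. LP_proj chi L p g x)
              | \<infinity> \<Rightarrow> (\<chi> i. complex_of_real (g x $ i)))"


section \<open>The determining wavenumber\<close>

definition lam :: "real \<Rightarrow> int \<Rightarrow> real" where
  "lam L q = 2 powi q / L"

definition lam_ext :: "real \<Rightarrow> enat \<Rightarrow> ereal" where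
  "lam_ext L Q = (case Q of enat q \<Rightarrow> ereal (lam L (int q)) | \<infinity> \<Rightarrow> \<infinity>)"

text \<open>
  For \<open>L > 0\<close> every nonempty set of values \<open>lam L (int q)\<close>, \<open>q :: nat\<close>, has a least element,
  so the infimum is a minimum if the set is nonempty, and it is \<open>\<infinity>\<close> if the set is empty.
\<close>

definition det_wavenumber ::
  "(real^3 \<Rightarrow> real) \<Rightarrow> real \<Rightarrow> real \<Rightarrow> real \<Rightarrow> real \<Rightarrow> (real^3 \<Rightarrow> real^3) \<Rightarrow> ereal" where
  "det_wavenumber chi L \<nu> c r g =
     Inf {ereal (lam L (int q)) | q :: nat.
       (\<forall>p > int q. lam L p powr (-1 + 3 / r) * Lp_norm L r (LP_proj chi L p g) < c * \<nu>) \<and>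
       ereal (1 / lam L (int q)) * Linf_norm L (LP_low chi L (enat q) g) < ereal (c * \<nu>)}"

end

theory Submission
  imports Defs
begin

text \<open>
  Let \<open>w = u - v\<close>. Testing both equations with single Fourier modes yields the energy balance of the sharp
  Fourier truncation \<open>S\<^sub>N w\<close>, whose only problematic term is the flux \<open>(u \<cdot> \<nabla>w, S\<^sub>N w) + (w \<cdot> \<nabla>v, S\<^sub>N w)\<close>. After
  an integration by parts in the second part it is a sum of integrals of \<open>a g h\<close>, where \<open>a\<close> is a component of
  \<open>u\<close> or \<open>v\<close>, one of \<open>g, h\<close> is a component of \<open>w\<close> or \<open>S\<^sub>N w\<close> and the other one a derivative of such a component.
  Since \<open>w\<close> has no modes below \<open>Q\<close>, splitting \<open>g\<close> and \<open>h\<close> into dyadic blocks only the pieces \<open>a\<^sub>p\<close>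
  with \<open>p\<close> close to or below the larger block contribute. The bounds that define the determining wavenumber,
  with Bernstein's inequality, make the contribution of blocks \<open>j, l\<close> at most \<open>C c \<nu> 2\<^bsup>-(3/r-1)|j-l|\<^esup>\<close> times the
  natural norms, and Schur's test bounds the flux by \<open>C c \<nu> \<parallel>\<nabla>w\<parallel>\<^sup>2\<close> uniformly in \<open>N\<close>. For small \<open>c\<close> the viscous
  term absorbs it. Letting \<open>N\<close> tend to infinity, the energy of \<open>w\<close> is nonincreasing and, by Poincare's
  inequality, its time integral is bounded, so it tends to \<open>0\<close>. The truncation makes
  it unnecessary to give a meaning to \<open>(u \<cdot> \<nabla>w, w)\<close>.
\<close>

section \<open>Square integrable functions on the torus\<close>

text \<open>Weak solutions carry no energy inequality here and \<open>w\<close> is not an admissible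
  test function, so every balance is first proved for finitely many modes. The sharp truncation
  costs nothing, because \<open>w\<close> and its truncation enter only through L^2 norms of dyadic
  blocks; the L^r norms fall on smooth Littlewood-Paley pieces of \<open>u\<close> and
  \<open>v\<close>. The decay in |j - l| comes from the place where Bernstein's inequality is
  applied. Let n and m be the smaller and the larger block index. If they are well separated, only
  pieces near or slightly above level m interact, and their L^r norm is of order c \<nu> lam_m^(1 -
  3/r). Charging Bernstein to block n costs lam_n^(3/r), in total c \<nu> lam_n (lam_n / lam_m)^(3/r
  - 1): one derivative, times a factor that decays because r < 3. The condition r > 2 is the one
  under which Hoelder's inequality with exponents r/2 and r/(r - 2) is available. If the blocks are
  comparable, all lower pieces contribute, but their sup norms c \<nu> lam_p sum geometrically. The
  flux is bounded by the full dissipation, so the viscous term absorbs it only in the limit of the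
  truncation.\<close>

lemma space_torus [simp]: "space (torus L) = cbox 0 (vec L)"
  by (simp add: torus_def)

lemma finite_measure_torus: "finite_measure (torus L)"
  unfolding torus_def by (rule finite_measure_lebesgue_on) (rule lmeasurable_cbox)

lemma borel_measurable_torus: "g \<in> borel_measurable borel \<Longrightarrow> g \<in> borel_measurable (torus L)"
  unfolding torus_def
  by (rule measurable_restrict_space1) (rule measurable_completion, simp)

lemma continuous_measurable_torus:
  "continuous_on UNIV g \<Longrightarrow> g \<in> borel_measurable (torus L)"
  by (rule borel_measurable_torus) (rule borel_measurable_continuous_onI)

lemma integrable_torus_bounded:
  fixes g :: "real^3 \<Rightarrow> 'b::{banach,second_countable_topology}"
  assumes "g \<in> borel_measurable (torus L)" "\<And>x. x \<in> cbox 0 (vec L) \<Longrightarrow> norm (g x) \<le> B"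
  shows "integrable (torus L) g"
proof -
  interpret finite_measure "torus L" by (rule finite_measure_torus)
  show ?thesis by (rule integrable_const_bound[of _ B]) (use assms in auto)
qed

lemma integral_torus_const:
  fixes c :: "'b::{banach,second_countable_topology}"
  assumes "L > 0"
  shows "(LINT x|torus L. c) = (L ^ 3) *\<^sub>R c"
proof -
  interpret finite_measure "torus L" by (rule finite_measure_torus)
  have "measure (torus L) (space (torus L)) = measure lebesgue (cbox (0::real^3) (vec L))"
    unfolding torus_def by (simp add: measure_restrict_space)
  also have "\<dots> = L ^ 3"
  proof -
    have "measure lborel (cbox (0::real^3) (vec L)) = (\<Prod>i\<in>UNIV. (vec L :: real^3) $ i - 0 $ i)"
      using assms by (intro content_cbox_cart) (auto simp: interval_ne_empty_cart)
    then show ?thesis by simp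
  qed
  finally show ?thesis by simp
qed

text \<open>The squared norm is the working quantity: it is additive over components and over
  Fourier modes, so limits of truncations need no square roots.\<close>

definition sqn :: "real \<Rightarrow> (real^3 \<Rightarrow> 'b::euclidean_space) \<Rightarrow> real" where
  "sqn L g = (LINT x|torus L. (norm (g x))\<^sup>2)"

lemma sqn_nonneg [simp]: "sqn L g \<ge> 0"
  unfolding sqn_def by (rule integral_nonneg_AE) simp

lemma in_L2_measurable: "in_L2 L g \<Longrightarrow> g \<in> borel_measurable (torus L)"
  and in_L2_sq_integrable: "in_L2 L g \<Longrightarrow> integrable (torus L) (\<lambda>x. (norm (g x))\<^sup>2)"
  by (simp_all add: in_L2_def)

lemma in_L2_dominated:
  fixes g :: "real^3 \<Rightarrow> 'b::euclidean_space" and h :: "real^3 \<Rightarrow> 'c::euclidean_space"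
  assumes "in_L2 L g" "h \<in> borel_measurable (torus L)" "AE x in torus L. norm (h x) \<le> B * norm (g x)"
  shows "in_L2 L h" and "sqn L h \<le> B\<^sup>2 * sqn L g"
proof -
  have sq: "AE x in torus L. (norm (h x))\<^sup>2 \<le> B\<^sup>2 * (norm (g x))\<^sup>2"
    using assms(3) by eventually_elim (metis norm_ge_zero power_mono power_mult_distrib)
  have i: "integrable (torus L) (\<lambda>x. B\<^sup>2 * (norm (g x))\<^sup>2)"
    using in_L2_sq_integrable[OF assms(1)] by simp
  have "integrable (torus L) (\<lambda>x. (norm (h x))\<^sup>2)"
    by (rule Bochner_Integration.integrable_bound[OF i]) (use assms(2) sq in auto)
  then show h: "in_L2 L h" using assms(2) by (simp add: in_L2_def)
  have "sqn L h \<le> (LINT x|torus L. B\<^sup>2 * (norm (g x))\<^sup>2)"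
    unfolding sqn_def by (rule integral_mono_AE[OF in_L2_sq_integrable[OF h] i sq])
  then show "sqn L h \<le> B\<^sup>2 * sqn L g" by (simp add: sqn_def)
qed

lemma in_L2_bounded:
  fixes g :: "real^3 \<Rightarrow> 'b::euclidean_space"
  assumes "g \<in> borel_measurable (torus L)" "\<And>x. x \<in> cbox 0 (vec L) \<Longrightarrow> norm (g x) \<le> B"
  shows "in_L2 L g"
proof -
  have "norm ((norm (g x))\<^sup>2) \<le> B\<^sup>2" if "x \<in> cbox 0 (vec L)" for x
    using assms(2)[OF that] by (simp add: power_mono)
  then show ?thesis
    unfolding in_L2_def using assms(1) by (auto intro!: integrable_torus_bounded[where B="B\<^sup>2"])
qed

lemma norm_add_sq_le: "(norm (a + b :: 'b::real_normed_vector))\<^sup>2 \<le> 2 * (norm a)\<^sup>2 + 2 * (norm b)\<^sup>2"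
proof -
  have "(norm (a + b))\<^sup>2 \<le> (norm a + norm b)\<^sup>2"
    by (simp add: norm_triangle_ineq power_mono)
  also have "\<dots> \<le> 2 * (norm a)\<^sup>2 + 2 * (norm b)\<^sup>2"
    using sum_squares_bound[of "norm a" "norm b"] by (simp add: power2_sum)
  finally show ?thesis .
qed

lemma in_L2_add:
  fixes g h :: "real^3 \<Rightarrow> 'b::euclidean_space"
  assumes "in_L2 L g" "in_L2 L h"
  shows "in_L2 L (\<lambda>x. g x + h x)" and "sqn L (\<lambda>x. g x + h x) \<le> 2 * sqn L g + 2 * sqn L h"
proof -
  have i: "integrable (torus L) (\<lambda>x. 2 * (norm (g x))\<^sup>2 + 2 * (norm (h x))\<^sup>2)"
    using assms[THEN in_L2_sq_integrable] by simp
  have m: "(\<lambda>x. g x + h x) \<in> borel_measurable (torus L)"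
    using assms[THEN in_L2_measurable] by simp
  have "integrable (torus L) (\<lambda>x. (norm (g x + h x))\<^sup>2)"
    by (rule Bochner_Integration.integrable_bound[OF i])
       (use m norm_add_sq_le in \<open>auto intro!: AE_I2\<close>)
  then show h: "in_L2 L (\<lambda>x. g x + h x)" using m by (simp add: in_L2_def)
  have "sqn L (\<lambda>x. g x + h x) \<le> (LINT x|torus L. 2 * (norm (g x))\<^sup>2 + 2 * (norm (h x))\<^sup>2)"
    unfolding sqn_def
    by (rule integral_mono[OF in_L2_sq_integrable[OF h] i]) (rule norm_add_sq_le)
  then show "sqn L (\<lambda>x. g x + h x) \<le> 2 * sqn L g + 2 * sqn L h"
    using assms[THEN in_L2_sq_integrable] by (simp add: sqn_def)
qed

lemma in_L2_linear_image:
  fixes g :: "real^3 \<Rightarrow> 'b::euclidean_space" and T :: "'b \<Rightarrow> 'c::euclidean_space"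
  assumes "in_L2 L g" "bounded_linear T"
  shows "in_L2 L (\<lambda>x. T (g x))"
proof -
  obtain B where B: "\<And>x. norm (T x) \<le> norm x * B" using bounded_linear.bounded[OF assms(2)] by auto
  show ?thesis
  proof (rule in_L2_dominated(1)[OF assms(1), where B=B])
    show "(\<lambda>x. T (g x)) \<in> borel_measurable (torus L)"
      by (rule borel_measurable_continuous_on[OF linear_continuous_on[OF assms(2)] in_L2_measurable[OF assms(1)]])
    show "AE x in torus L. norm (T (g x)) \<le> B * norm (g x)"
      using B by (simp add: mult.commute)
  qed
qed

lemma in_L2_diff:
  fixes g h :: "real^3 \<Rightarrow> 'b::euclidean_space"
  assumes "in_L2 L g" "in_L2 L h"
  shows "in_L2 L (\<lambda>x. g x - h x)"
proof -
  have "in_L2 L (\<lambda>x. - h x)"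
    by (rule in_L2_linear_image[OF assms(2)]) (intro bounded_linear_minus bounded_linear_ident)
  from in_L2_add(1)[OF assms(1) this] show ?thesis by simp
qed

lemma in_L2_zero: "in_L2 L (\<lambda>x. 0 :: 'b::euclidean_space)"
  by (rule in_L2_bounded[where B=0]) auto

lemma in_L2_mult_bounded:
  fixes g a :: "real^3 \<Rightarrow> complex"
  assumes "in_L2 L g" "a \<in> borel_measurable (torus L)" "\<And>x. norm (a x) \<le> B"
  shows "in_L2 L (\<lambda>x. a x * g x)"
  by (rule in_L2_dominated(1)[OF assms(1), where B=B])
     (use assms in_L2_measurable[OF assms(1)] in \<open>auto simp: norm_mult intro!: AE_I2 mult_right_mono\<close>)

lemma in_L2_cnj: "in_L2 L g \<Longrightarrow> in_L2 L (\<lambda>x. cnj (g x))"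
  by (rule in_L2_linear_image[OF _ bounded_linear_cnj])

lemma in_L2_integrable_mult:
  fixes g h :: "real^3 \<Rightarrow> complex"
  assumes "in_L2 L g" "in_L2 L h"
  shows "integrable (torus L) (\<lambda>x. g x * h x)"
proof -
  have i: "integrable (torus L) (\<lambda>x. (norm (g x))\<^sup>2 + (norm (h x))\<^sup>2)"
    using assms[THEN in_L2_sq_integrable] by simp
  have "norm (g x * h x) \<le> (norm (g x))\<^sup>2 + (norm (h x))\<^sup>2" for x
  proof -
    have "0 \<le> norm (g x) * norm (h x)" by simp
    then show ?thesis
      using sum_squares_bound[of "norm (g x)" "norm (h x)"] unfolding norm_mult by linarith
  qed
  then show ?thesis
    by (intro Bochner_Integration.integrable_bound[OF i])
       (use assms[THEN in_L2_measurable] in \<open>auto intro!: AE_I2\<close>)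
qed

lemma in_L2_const: "in_L2 L (\<lambda>x. c :: 'b::euclidean_space)"
  by (rule in_L2_bounded[where B="norm c"]) auto

lemma in_L2_integrable:
  fixes g :: "real^3 \<Rightarrow> complex"
  shows "in_L2 L g \<Longrightarrow> integrable (torus L) g"
  using in_L2_integrable_mult[of L g "\<lambda>x. 1"] by (simp add: in_L2_const)

text \<open>The weight \<open>t\<close> stays free: optimizing it gives Cauchy-Schwarz, and
  \<open>t = 1\<close> is the form used in \<open>norm_nonlin_le\<close>.\<close>

lemma L2_CS_weighted:
  fixes g h :: "real^3 \<Rightarrow> complex"
  assumes "in_L2 L g" "in_L2 L h" "t > 0"
  shows "norm (LINT x|torus L. g x * h x) \<le> (t * sqn L g + sqn L h / t) / 2"
proof -
  have "norm (LINT x|torus L. g x * h x) \<le> (LINT x|torus L. norm (g x * h x))"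
    by (rule integral_norm_bound)
  also have "\<dots> \<le> (LINT x|torus L. (t * (norm (g x))\<^sup>2 + (norm (h x))\<^sup>2 / t) / 2)"
  proof (rule integral_mono)
    show "integrable (torus L) (\<lambda>x. norm (g x * h x))"
      using in_L2_integrable_mult[OF assms(1,2)] by simp
    show "integrable (torus L) (\<lambda>x. (t * (norm (g x))\<^sup>2 + (norm (h x))\<^sup>2 / t) / 2)"
      using assms(1,2)[THEN in_L2_sq_integrable] by simp
    show "norm (g x * h x) \<le> (t * (norm (g x))\<^sup>2 + (norm (h x))\<^sup>2 / t) / 2" for x
    proof -
      have "0 \<le> (t * norm (g x) - norm (h x))\<^sup>2" by simp
      then have "2 * t * (norm (g x) * norm (h x)) \<le> t\<^sup>2 * (norm (g x))\<^sup>2 + (norm (h x))\<^sup>2"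
        by (simp add: power2_diff power_mult_distrib algebra_simps)
      then have "2 * (norm (g x) * norm (h x)) \<le> (t\<^sup>2 * (norm (g x))\<^sup>2 + (norm (h x))\<^sup>2) / t"
        using assms(3) by (simp add: field_simps)
      also have "\<dots> = t * (norm (g x))\<^sup>2 + (norm (h x))\<^sup>2 / t"
        using assms(3) by (simp add: field_simps power2_eq_square)
      finally show ?thesis by (simp add: norm_mult)
    qed
  qed
  also have "\<dots> = (t * sqn L g + sqn L h / t) / 2"
    using assms(1,2)[THEN in_L2_sq_integrable] by (simp add: sqn_def)
  finally show ?thesis .
qed

text \<open>For positive \<open>a\<close> and \<open>b\<close> the choice
  \<open>t = sqrt b / sqrt a\<close> is optimal. If one of them vanishes, the infimum over
  \<open>t\<close> need not be attained, hence the slack \<open>e\<close>.\<close>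

lemma le_sqrt_mult_of_weighted:
  fixes x a b :: real
  assumes "\<And>t. t > 0 \<Longrightarrow> x \<le> (t * a + b / t) / 2" "a \<ge> 0" "b \<ge> 0"
  shows "x \<le> sqrt a * sqrt b"
proof (rule field_le_epsilon)
  fix e :: real assume e: "e > 0"
  show "x \<le> sqrt a * sqrt b + e"
  proof (cases "a = 0")
    case True
    have t: "b / e + 1 > 0" using assms(3) e by (simp add: add_nonneg_pos)
    have "b \<le> e * (b / e + 1)" using e by (simp add: field_simps)
    then have "b / (b / e + 1) \<le> e" using t by (simp add: pos_divide_le_eq)
    moreover have "x \<le> b / (b / e + 1) / 2" using assms(1)[OF t] True by simp
    ultimately have "x \<le> e / 2" by (meson divide_right_mono order_trans zero_le_numeral)
    then have "x \<le> e" using e by simp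
    then show ?thesis using True by simp
  next
    case False
    then have a: "a > 0" using assms(2) by simp
    show ?thesis
    proof (cases "b = 0")
      case True
      have "x \<le> e / a * a / 2" using assms(1)[of "e/a"] True e a by simp
      then show ?thesis using True e a by simp
    next
      case False
      then have b: "b > 0" using assms(3) by simp
      have s: "sqrt a > 0" "sqrt b > 0" using a b by auto
      have "x \<le> (sqrt b / sqrt a * a + b / (sqrt b / sqrt a)) / 2"
        using assms(1)[of "sqrt b / sqrt a"] s by simp
      also have "sqrt b / sqrt a * a = sqrt a * sqrt b"
        using a s by (simp add: field_simps)
      also have "b / (sqrt b / sqrt a) = sqrt a * sqrt b"
        using b s by (simp add: field_simps)
      finally show ?thesis using e by simp
    qed
  qed
qed

lemma L2_CS:
  fixes g h :: "real^3 \<Rightarrow> complex"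
  assumes "in_L2 L g" "in_L2 L h"
  shows "norm (LINT x|torus L. g x * h x) \<le> sqrt (sqn L g) * sqrt (sqn L h)"
  by (rule le_sqrt_mult_of_weighted) (use L2_CS_weighted[OF assms] in auto)

section \<open>Trigonometric polynomials\<close>

definition ek :: "real \<Rightarrow> int^3 \<Rightarrow> real^3 \<Rightarrow> complex" where
  "ek L k x = cis (2 * pi / L * (freq k \<bullet> x))"

lemma freq_add: "freq (k + l) = freq k + freq l"
  and freq_minus: "freq (- k) = - freq k"
  and freq_diff: "freq (k - l) = freq k - freq l"
  and freq_zero [simp]: "freq 0 = 0"
  by (simp_all add: freq_def vec_eq_iff)

lemma norm_ek [simp]: "norm (ek L k x) = 1"
  by (simp add: ek_def)

lemma ek_mult: "ek L k x * ek L l x = ek L (k + l) x"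
  by (simp add: ek_def cis_mult freq_add inner_add_left algebra_simps)

lemma ek_cnj: "cnj (ek L k x) = ek L (- k) x"
  by (simp add: ek_def cis_cnj freq_minus)

lemma ek_zero [simp]: "ek L 0 x = 1"
  by (simp add: ek_def)

lemma continuous_ek: "continuous_on S (ek L k)"
  unfolding ek_def by (intro continuous_intros)

lemma measurable_ek: "ek L k \<in> borel_measurable (torus L')"
  by (rule continuous_measurable_torus) (rule continuous_ek)

lemma in_L2_ek: "in_L2 L' (ek L k)"
  by (rule in_L2_bounded[where B=1]) (auto simp: measurable_ek)

lemma integral_ek_coord:
  fixes m :: int
  assumes "L > 0" "m \<noteq> 0"
  shows "(LINT t|lborel. indicator {0..L} t *\<^sub>R cis (2 * pi / L * (of_int m * t))) = 0"
proof -
  define a where "a = 2 * pi / L * of_int m"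
  have a: "a \<noteq> 0" using assms by (simp add: a_def)
  have "((\<lambda>t. cis (a * t)) has_integral (- \<i> / a * cis (a * L) - (- \<i> / a * cis (a * 0)))) {0..L}"
  proof (rule fundamental_theorem_of_calculus)
    show "0 \<le> L" using assms by simp
    fix x assume "x \<in> {0..L}"
    have "((\<lambda>t. cis (a * t)) has_vector_derivative (\<i> * a * cis (a * x))) (at x within {0..L})"
    proof -
      have "((\<lambda>z. exp (\<i> * a * z)) has_field_derivative \<i> * a * exp (\<i> * a * of_real x)) (at (of_real x))"
        by (auto intro!: derivative_eq_intros)
      from has_vector_derivative_real_field[OF this, of "{0..L}"] show ?thesis
        by (simp add: cis_conv_exp mult.assoc)
    qed
    from has_vector_derivative_mult_right[OF this, of "- \<i> / a"]
    show "((\<lambda>t. - \<i> / a * cis (a * t)) has_vector_derivative cis (a * x)) (at x within {0..L})"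
      using a by (simp add: field_simps)
  qed
  moreover have "cis (a * L) = 1"
    using assms cis_multiple_2pi[of "of_int m"] by (simp add: a_def mult.commute)
  ultimately have "((\<lambda>t. cis (a * t)) has_integral 0) {0..L}" by simp
  moreover have "set_integrable lborel {0..L} (\<lambda>t. cis (a * t))"
    unfolding set_integrable_def
    by (rule borel_integrable_compact) (auto intro!: continuous_intros simp: cis_conv_exp)
  ultimately have "(LINT t:{0..L}|lborel. cis (a * t)) = 0"
    using set_borel_integral_eq_integral(2) by (metis integral_unique)
  then show ?thesis by (simp add: set_lebesgue_integral_def a_def mult.assoc)
qed

text \<open>Fubini for integrands that separate in the coordinates. Lebesgue measure on
  \<open>real^3\<close> is an image of a product measure indexed by \<open>Basis\<close>, so the
  index type \<open>3\<close> is carried there by \<open>axis_index\<close>.\<close>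

lemma integral_prod_coords:
  fixes f :: "3 \<Rightarrow> real \<Rightarrow> complex"
  assumes "\<And>i. integrable lborel (f i)"
  shows "(LINT x|(lborel :: (real^3) measure). (\<Prod>i\<in>UNIV. f i (x $ i))) = (\<Prod>i\<in>UNIV. LINT t|lborel. f i t)"
proof -
  interpret product_sigma_finite "\<lambda>b::real^3. lborel :: real measure"
    by standard
  define g where "g b = f (axis_index b)" for b :: "real^3"
  have B: "(\<Prod>b\<in>(Basis::(real^3) set). F b) = (\<Prod>i\<in>(UNIV::3 set). F (axis i 1))" for F :: "real^3 \<Rightarrow> complex"
    by (simp add: Basis_vec_def axis_eq_axis prod.UNION_disjoint)
  have [measurable]: "f i \<in> borel_measurable borel" for i
    using assms[of i] by auto
  have "(LINT x|(lborel :: (real^3) measure). (\<Prod>i\<in>UNIV. f i (x $ i)))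
      = (LINT x|(lborel :: (real^3) measure). (\<Prod>b\<in>Basis. g b (x \<bullet> b)))"
    by (simp add: B g_def axis_index_axis inner_axis)
  also have "\<dots> = (LINT x|(\<Pi>\<^sub>M b\<in>(Basis::(real^3) set). lborel). (\<Prod>b\<in>Basis. g b ((\<Sum>b\<in>Basis. x b *\<^sub>R b) \<bullet> b)))"
    by (subst lborel_eq, subst integral_distr) (auto simp: g_def)
  also have "\<dots> = (LINT x|(\<Pi>\<^sub>M b\<in>(Basis::(real^3) set). lborel). (\<Prod>b\<in>Basis. g b (x b)))"
    by (intro Bochner_Integration.integral_cong refl prod.cong)
       (simp add: inner_sum_left inner_Basis if_distrib cong: if_cong)
  also have "\<dots> = (\<Prod>b\<in>Basis. LINT t|lborel. g b t)"
    by (rule product_integral_prod) (auto simp: g_def assms)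
  finally show ?thesis by (simp add: B g_def axis_index_axis)
qed

lemma cis_sum: "cis (\<Sum>i\<in>I. a i) = (\<Prod>i\<in>I. cis (a i))" if "finite I"
  using that by (induction I) (auto simp: cis_mult[symmetric])

lemma integral_torus_lborel:
  fixes g :: "real^3 \<Rightarrow> complex"
  assumes "g \<in> borel_measurable borel"
  shows "(LINT x|torus L. g x) = (LINT x|lborel. indicator (cbox 0 (vec L)) x *\<^sub>R g x)"
  unfolding torus_def
  using assms by (subst integral_restrict_space) (auto intro!: integral_completion)

lemma integral_ek:
  assumes L: "L > 0"
  shows "(LINT x|torus L. ek L k x) = (if k = 0 then of_real (L ^ 3) else 0)"
proof (cases "k = 0")
  case True
  have "(LINT x|torus L. ek L k x) = (L ^ 3) *\<^sub>R (1::complex)"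
    unfolding True ek_zero by (rule integral_torus_const[OF L])
  then show ?thesis unfolding if_P[OF True] by (simp only: scaleR_conv_of_real mult_1_right)
next
  case False
  then obtain j where j: "k $ j \<noteq> 0" by (auto simp: vec_eq_iff)
  define f where "f i t = indicator {0..L} t *\<^sub>R cis (2 * pi / L * (of_int (k $ i) * t))" for i :: 3 and t
  have f: "integrable lborel (f i)" for i
    unfolding f_def using L by (intro borel_integrable_compact) (auto intro!: continuous_intros simp: cis_conv_exp)
  have "indicator (cbox 0 (vec L)) x *\<^sub>R ek L k x = (\<Prod>i\<in>UNIV. f i (x $ i))" for x :: "real^3"
  proof -
    have "indicator (cbox 0 (vec L)) x = (\<Prod>i\<in>UNIV. indicator {0..L} (x $ i) :: real)"
      by (auto simp: indicator_def mem_box_cart prod_eq_1_iff split: if_splits)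
    moreover have "ek L k x = (\<Prod>i\<in>UNIV. cis (2 * pi / L * (of_int (k $ i) * x $ i)))"
      by (simp add: ek_def inner_vec_def freq_def sum_distrib_left cis_sum)
    ultimately show ?thesis
      by (simp add: f_def prod.distrib scaleR_conv_of_real)
  qed
  then have "(LINT x|torus L. ek L k x) = (LINT x|lborel. (\<Prod>i\<in>UNIV. f i (x $ i)))"
    by (subst integral_torus_lborel)
       (auto intro!: borel_measurable_continuous_onI continuous_ek)
  also have "\<dots> = (\<Prod>i\<in>UNIV. LINT t|lborel. f i t)"
    by (rule integral_prod_coords[OF f])
  also have "\<dots> = 0"
    using integral_ek_coord[OF L j] by (intro prod_zero) (auto simp: f_def intro!: exI[of _ j])
  finally show ?thesis using False by simp
qed

text \<open>Scalar counterpart of \<open>fourier_coeff\<close> (see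
  \<open>fourier_coeff_nth\<close>): components of fields, of their gradients, and products of these
  are all treated as complex scalars.\<close>

definition fcc :: "real \<Rightarrow> (real^3 \<Rightarrow> complex) \<Rightarrow> int^3 \<Rightarrow> complex" where
  "fcc L g k = (LINT x|torus L. g x * ek L (- k) x) / of_real (L ^ 3)"

definition tp :: "real \<Rightarrow> (int^3) set \<Rightarrow> (int^3 \<Rightarrow> complex) \<Rightarrow> real^3 \<Rightarrow> complex" where
  "tp L K c x = (\<Sum>k\<in>K. c k * ek L k x)"

lemma continuous_tp: "continuous_on S (tp L K c)"
  unfolding tp_def by (intro continuous_intros continuous_ek)

lemma measurable_tp: "tp L K c \<in> borel_measurable (torus L')"
  by (rule continuous_measurable_torus) (rule continuous_tp)

lemma norm_tp_le: "norm (tp L K c x) \<le> (\<Sum>k\<in>K. norm (c k))"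
  unfolding tp_def by (rule order_trans[OF norm_sum]) (simp add: norm_mult)

lemma in_L2_tp: "in_L2 L' (tp L K c)"
  by (rule in_L2_bounded[OF measurable_tp norm_tp_le])

lemma tp_cong: "(\<And>k. k \<in> K \<Longrightarrow> c k = d k) \<Longrightarrow> tp L K c = tp L K d"
  by (auto simp: tp_def fun_eq_iff intro!: sum.cong)

lemma tp_superset:
  assumes "finite K'" "K \<subseteq> K'"
  shows "tp L K c = tp L K' (\<lambda>k. if k \<in> K then c k else 0)"
proof
  show "tp L K c x = tp L K' (\<lambda>k. if k \<in> K then c k else 0) x" for x
    unfolding tp_def using assms by (intro sum.mono_neutral_cong_left) auto
qed

lemma integral_mult_tp:
  assumes L: "L > 0" and g: "in_L2 L g"
  shows "(LINT x|torus L. g x * tp L K c x) = of_real (L ^ 3) * (\<Sum>k\<in>K. c k * fcc L g (- k))"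
proof -
  have i: "integrable (torus L) (\<lambda>x. g x * ek L k x)" for k
    by (rule in_L2_integrable_mult[OF g in_L2_ek])
  have "(LINT x|torus L. g x * tp L K c x) = (LINT x|torus L. (\<Sum>k\<in>K. c k * (g x * ek L k x)))"
    by (simp add: tp_def sum_distrib_left algebra_simps)
  also have "\<dots> = (\<Sum>k\<in>K. c k * (LINT x|torus L. g x * ek L k x))"
    by (subst Bochner_Integration.integral_sum) (auto intro!: integrable_mult_right i)
  also have "\<dots> = of_real (L ^ 3) * (\<Sum>k\<in>K. c k * fcc L g (- k))"
    using L by (simp add: fcc_def sum_distrib_left algebra_simps)
  finally show ?thesis .
qed

lemma fcc_ek: "L > 0 \<Longrightarrow> fcc L (ek L k) l = (if k = l then 1 else 0)"
  by (simp add: fcc_def ek_mult integral_ek)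

lemma fcc_tp:
  assumes L: "L > 0" and K: "finite K"
  shows "fcc L (tp L K c) l = (if l \<in> K then c l else 0)"
proof -
  have "(LINT x|torus L. tp L K c x * ek L (- l) x) = of_real (L ^ 3) * (\<Sum>k\<in>K. c k * fcc L (ek L (- l)) (- k))"
    using integral_mult_tp[OF L in_L2_ek, where K=K and c=c] by (simp add: mult.commute)
  also have "(\<Sum>k\<in>K. c k * fcc L (ek L (- l)) (- k)) = (\<Sum>k\<in>K. if l = k then c k else 0)"
    using L by (intro sum.cong) (auto simp: fcc_ek)
  also have "\<dots> = (if l \<in> K then c l else 0)" using K by simp
  finally show ?thesis using L by (simp add: fcc_def)
qed

lemma fcc_cnj: "fcc L (\<lambda>x. cnj (g x)) k = cnj (fcc L g (- k))"
proof -
  have "(LINT x|torus L. cnj (g x) * ek L (- k) x) = (LINT x|torus L. cnj (g x * ek L k x))"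
    by (simp add: ek_cnj)
  also have "\<dots> = cnj (LINT x|torus L. g x * ek L k x)"
    by (rule Bochner_Integration.integral_cnj)
  finally show ?thesis by (simp add: fcc_def)
qed

lemma sqn_complex: "of_real (sqn L g) = (LINT x|torus L. g x * cnj (g x))" for g :: "real^3 \<Rightarrow> complex"
  unfolding sqn_def complex_norm_square[symmetric] by (rule integral_complex_of_real[symmetric])

lemma sqn_tp:
  assumes L: "L > 0" and K: "finite K"
  shows "sqn L (tp L K c) = L ^ 3 * (\<Sum>k\<in>K. (norm (c k))\<^sup>2)"
proof -
  have "of_real (sqn L (tp L K c)) = (LINT x|torus L. cnj (tp L K c x) * tp L K c x)"
    by (simp add: sqn_complex mult.commute)
  also have "\<dots> = of_real (L ^ 3) * (\<Sum>k\<in>K. c k * fcc L (\<lambda>x. cnj (tp L K c x)) (- k))"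
    by (rule integral_mult_tp[OF L in_L2_cnj[OF in_L2_tp]])
  also have "\<dots> = of_real (L ^ 3) * (\<Sum>k\<in>K. of_real ((norm (c k))\<^sup>2))"
    by (simp add: fcc_cnj fcc_tp[OF L K] complex_norm_square del: of_real_power cong: sum.cong)
  also have "\<dots> = of_real (L ^ 3 * (\<Sum>k\<in>K. (norm (c k))\<^sup>2))" by simp
  finally show ?thesis by (simp only: of_real_eq_iff)
qed

lemma fcc_diff:
  assumes "in_L2 L g" "in_L2 L h"
  shows "fcc L (\<lambda>x. g x - h x) k = fcc L g k - fcc L h k"
  using assms[THEN in_L2_integrable_mult[OF _ in_L2_ek]]
  by (simp add: fcc_def left_diff_distrib diff_divide_distrib)

text \<open>Completing the square in \<open>c\<close>: the last sum vanishes when \<open>c\<close>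
  agrees with the Fourier coefficients on \<open>K\<close>. Best approximation, Bessel's inequality
  and Parseval's identity are all read off from this formula.\<close>

lemma sqn_diff_tp:
  assumes L: "L > 0" and K: "finite K" and g: "in_L2 L g"
  shows "sqn L (\<lambda>x. g x - tp L K c x) =
     sqn L g - L ^ 3 * (\<Sum>k\<in>K. (norm (fcc L g k))\<^sup>2) + L ^ 3 * (\<Sum>k\<in>K. (norm (c k - fcc L g k))\<^sup>2)"
proof -
  let ?t = "tp L K c"
  have I1: "integrable (torus L) (\<lambda>x. g x * cnj (g x))" "integrable (torus L) (\<lambda>x. ?t x * cnj (?t x))"
       "integrable (torus L) (\<lambda>x. g x * cnj (?t x))" "integrable (torus L) (\<lambda>x. ?t x * cnj (g x))"
    by (intro in_L2_integrable_mult in_L2_cnj g in_L2_tp)+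
  have 1: "(LINT x|torus L. ?t x * cnj (g x)) = of_real (L ^ 3) * (\<Sum>k\<in>K. c k * cnj (fcc L g k))"
    using integral_mult_tp[OF L in_L2_cnj[OF g], of K c] by (simp add: fcc_cnj mult.commute)
  have "(LINT x|torus L. g x * cnj (?t x)) = (LINT x|torus L. cnj (?t x * cnj (g x)))"
    unfolding complex_cnj_mult complex_cnj_cnj by (simp only: mult.commute)
  also have "\<dots> = cnj (LINT x|torus L. ?t x * cnj (g x))"
    by (rule Bochner_Integration.integral_cnj)
  finally have 2: "(LINT x|torus L. g x * cnj (?t x)) = of_real (L ^ 3) * (\<Sum>k\<in>K. cnj (c k) * fcc L g k)"
    by (simp add: 1)
  have "of_real (sqn L (\<lambda>x. g x - ?t x)) = (LINT x|torus L. g x * cnj (g x) + ?t x * cnj (?t x) - g x * cnj (?t x) - ?t x * cnj (g x))"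
    unfolding sqn_complex by (rule Bochner_Integration.integral_cong) (simp_all add: algebra_simps)
  also have "\<dots> = of_real (sqn L g) + of_real (sqn L ?t) - (LINT x|torus L. g x * cnj (?t x)) - (LINT x|torus L. ?t x * cnj (g x))"
    by (simp add: I1 sqn_complex)
  also have "\<dots> = of_real (sqn L g) + of_real (L ^ 3) * (\<Sum>k\<in>K. c k * cnj (c k) - cnj (c k) * fcc L g k - c k * cnj (fcc L g k))"
  proof -
    have "complex_of_real (\<Sum>k\<in>K. (norm (c k))\<^sup>2) = (\<Sum>k\<in>K. c k * cnj (c k))"
      unfolding of_real_sum complex_norm_square ..
    then show ?thesis
      unfolding 1 2 sqn_tp[OF L K] of_real_mult by (simp only: sum_subtractf right_diff_distrib add_diff_eq)
  qed
  also have "(\<Sum>k\<in>K. c k * cnj (c k) - cnj (c k) * fcc L g k - c k * cnj (fcc L g k))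
      = (\<Sum>k\<in>K. of_real ((norm (c k - fcc L g k))\<^sup>2 - (norm (fcc L g k))\<^sup>2))"
    unfolding of_real_diff complex_norm_square by (intro sum.cong) (simp_all add: algebra_simps)
  also have "of_real (sqn L g) + of_real (L ^ 3) * \<dots> = complex_of_real (sqn L g + L ^ 3 * (\<Sum>k\<in>K. (norm (c k - fcc L g k))\<^sup>2 - (norm (fcc L g k))\<^sup>2))"
    by simp
  finally have "sqn L (\<lambda>x. g x - ?t x) = sqn L g + L ^ 3 * (\<Sum>k\<in>K. (norm (c k - fcc L g k))\<^sup>2 - (norm (fcc L g k))\<^sup>2)"
    by (simp only: of_real_eq_iff)
  then show ?thesis by (simp add: sum_subtractf algebra_simps)
qed

text \<open>\<open>K\<close> only has to contain the spectrum, so that sums and products can be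
  moved to a common frequency set; \<open>trig_poly_restrict\<close> recovers the tight
  spectrum.\<close>

definition trig_poly :: "real \<Rightarrow> (int^3) set \<Rightarrow> (real^3 \<Rightarrow> complex) \<Rightarrow> bool" where
  "trig_poly L K g \<longleftrightarrow> finite K \<and> (\<exists>c. g = tp L K c)"

lemma trig_poly_tp: "finite K \<Longrightarrow> trig_poly L K (tp L K c)"
  by (auto simp: trig_poly_def)

lemma trig_poly_mono: "trig_poly L K g \<Longrightarrow> K \<subseteq> K' \<Longrightarrow> finite K' \<Longrightarrow> trig_poly L K' g"
  unfolding trig_poly_def using tp_superset by blast

lemma trig_poly_in_L2: "trig_poly L K g \<Longrightarrow> in_L2 L' g"
  by (auto simp: trig_poly_def in_L2_tp)

lemma trig_poly_fcc:
  assumes "L > 0" "trig_poly L K g"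
  shows "g = tp L K (fcc L g)" and "k \<notin> K \<Longrightarrow> fcc L g k = 0"
proof -
  obtain c where K: "finite K" and g: "g = tp L K c" using assms by (auto simp: trig_poly_def)
  show "g = tp L K (fcc L g)" unfolding g
    by (rule tp_cong) (simp add: fcc_tp[OF assms(1) K])
  show "k \<notin> K \<Longrightarrow> fcc L g k = 0" by (simp add: g fcc_tp[OF assms(1) K])
qed

lemma trig_poly_add:
  assumes "trig_poly L K g" "trig_poly L K h"
  shows "trig_poly L K (\<lambda>x. g x + h x)"
proof -
  from assms obtain c d where "finite K" "g = tp L K c" "h = tp L K d" by (auto simp: trig_poly_def)
  then have "(\<lambda>x. g x + h x) = tp L K (\<lambda>k. c k + d k)"
    by (simp add: tp_def fun_eq_iff sum.distrib algebra_simps)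
  then show ?thesis using \<open>finite K\<close> by (auto simp: trig_poly_def)
qed

lemma trig_poly_cmult:
  assumes "trig_poly L K g"
  shows "trig_poly L K (\<lambda>x. a * g x)"
proof -
  from assms obtain c where "finite K" "g = tp L K c" by (auto simp: trig_poly_def)
  then have "(\<lambda>x. a * g x) = tp L K (\<lambda>k. a * c k)"
    by (simp add: tp_def fun_eq_iff sum_distrib_left algebra_simps)
  then show ?thesis using \<open>finite K\<close> by (auto simp: trig_poly_def)
qed

lemma trig_poly_zero: "finite K \<Longrightarrow> trig_poly L K (\<lambda>x. 0)"
  unfolding trig_poly_def by (auto simp: tp_def intro!: exI[of _ "\<lambda>k. 0"])

lemma trig_poly_sum:
  assumes "finite K" "\<And>i. i \<in> I \<Longrightarrow> trig_poly L K (g i)"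
  shows "trig_poly L K (\<lambda>x. \<Sum>i\<in>I. g i x)"
  using assms(2)
  by (induction I rule: infinite_finite_induct) (auto intro: trig_poly_add trig_poly_zero assms(1))

lemma trig_poly_ek: "finite K \<Longrightarrow> k \<in> K \<Longrightarrow> trig_poly L K (ek L k)"
  unfolding trig_poly_def
  by (auto simp: tp_def fun_eq_iff if_distrib[of "\<lambda>x. x * _"] cong: if_cong
      intro!: exI[of _ "\<lambda>l. if l = k then 1 else 0"])

lemma trig_poly_mult:
  assumes "trig_poly L K g" "trig_poly L K' h" "finite J" "\<And>k l. k \<in> K \<Longrightarrow> l \<in> K' \<Longrightarrow> k + l \<in> J"
  shows "trig_poly L J (\<lambda>x. g x * h x)"
proof -
  from assms obtain c d where "finite K" "g = tp L K c" "finite K'" "h = tp L K' d" by (auto simp: trig_poly_def)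
  then have "(\<lambda>x. g x * h x) = (\<lambda>x. \<Sum>k\<in>K. \<Sum>l\<in>K'. (c k * d l) * ek L (k + l) x)"
    by (simp add: tp_def fun_eq_iff sum_product ek_mult[symmetric] algebra_simps)
  then show ?thesis
    using assms by (auto intro!: trig_poly_sum trig_poly_cmult trig_poly_ek)
qed

section \<open>Density of trigonometric polynomials in L^2 of the torus\<close>

definition tp_approx :: "real \<Rightarrow> (real^3 \<Rightarrow> complex) \<Rightarrow> bool" where
  "tp_approx L g \<longleftrightarrow> in_L2 L g \<and> (\<forall>e>0. \<exists>K h. trig_poly L K h \<and> sqn L (\<lambda>x. g x - h x) < e)"

lemma tp_approx_trig_poly: "trig_poly L K g \<Longrightarrow> tp_approx L g"
  unfolding tp_approx_def using trig_poly_in_L2 by (fastforce simp: sqn_def)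

lemma tp_approx_limit:
  assumes g: "in_L2 L g" and h: "\<And>e. e > 0 \<Longrightarrow> \<exists>h. tp_approx L h \<and> sqn L (\<lambda>x. g x - h x) < e"
  shows "tp_approx L g"
  unfolding tp_approx_def
proof (intro conjI allI impI g)
  fix e :: real assume e: "e > 0"
  obtain h where h: "tp_approx L h" "sqn L (\<lambda>x. g x - h x) < e / 4" using assms(2)[of "e/4"] e by auto
  obtain K t where t: "trig_poly L K t" "sqn L (\<lambda>x. h x - t x) < e / 4"
    using h(1) e by (auto simp: tp_approx_def dest!: spec[of _ "e/4"])
  have h2: "in_L2 L h" using h by (simp add: tp_approx_def)
  have "sqn L (\<lambda>x. (g x - h x) + (h x - t x)) \<le> 2 * sqn L (\<lambda>x. g x - h x) + 2 * sqn L (\<lambda>x. h x - t x)"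
    by (intro in_L2_add(2) in_L2_diff g h2 trig_poly_in_L2[OF t(1)])
  then show "\<exists>K h. trig_poly L K h \<and> sqn L (\<lambda>x. g x - h x) < e"
    using h t by (intro exI[of _ K] exI[of _ t]) auto
qed

lemma tp_approx_add:
  assumes "tp_approx L g" "tp_approx L h"
  shows "tp_approx L (\<lambda>x. g x + h x)"
  unfolding tp_approx_def
proof (intro conjI allI impI)
  have g: "in_L2 L g" and h: "in_L2 L h" using assms by (auto simp: tp_approx_def)
  then show "in_L2 L (\<lambda>x. g x + h x)" by (rule in_L2_add)
  fix e :: real assume e: "e > 0"
  obtain K t where t: "trig_poly L K t" "sqn L (\<lambda>x. g x - t x) < e / 4"
    using assms(1) e by (auto simp: tp_approx_def dest!: spec[of _ "e/4"])
  obtain J s where s: "trig_poly L J s" "sqn L (\<lambda>x. h x - s x) < e / 4"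
    using assms(2) e by (auto simp: tp_approx_def dest!: spec[of _ "e/4"])
  have f: "finite (K \<union> J)" using s t by (auto simp: trig_poly_def)
  have "sqn L (\<lambda>x. (g x - t x) + (h x - s x)) \<le> 2 * sqn L (\<lambda>x. g x - t x) + 2 * sqn L (\<lambda>x. h x - s x)"
    by (intro in_L2_add(2) in_L2_diff g h trig_poly_in_L2[OF t(1)] trig_poly_in_L2[OF s(1)])
  moreover have "(\<lambda>x. (g x - t x) + (h x - s x)) = (\<lambda>x. g x + h x - (t x + s x))" by auto
  moreover have "trig_poly L (K \<union> J) (\<lambda>x. t x + s x)"
    by (intro trig_poly_add trig_poly_mono[OF t(1)] trig_poly_mono[OF s(1)] f) auto
  ultimately show "\<exists>K f. trig_poly L K f \<and> sqn L (\<lambda>x. g x + h x - f x) < e"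
    using s t by (intro exI[of _ "K \<union> J"] exI[of _ "\<lambda>x. t x + s x"]) auto
qed

lemma sqn_cmult: "sqn L (\<lambda>x. a * g x) = (norm a)\<^sup>2 * sqn L g" for g :: "real^3 \<Rightarrow> complex"
  by (simp add: sqn_def norm_mult power_mult_distrib)

lemma in_L2_cmult: "in_L2 L g \<Longrightarrow> in_L2 L (\<lambda>x. a * g x)" for g :: "real^3 \<Rightarrow> complex"
  by (rule in_L2_mult_bounded[where B="norm a"]) auto

lemma tp_approx_cmult:
  assumes "tp_approx L g"
  shows "tp_approx L (\<lambda>x. a * g x)"
proof (cases "a = 0")
  case True
  then show ?thesis using tp_approx_trig_poly[OF trig_poly_zero[of "{}"]] by simp
next
  case False
  show ?thesis unfolding tp_approx_def
  proof (intro conjI allI impI)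
    show "in_L2 L (\<lambda>x. a * g x)" using assms by (auto simp: tp_approx_def intro: in_L2_cmult)
    fix e :: real assume e: "e > 0"
    have "e / (norm a)\<^sup>2 > 0" using e False by simp
    then obtain K t where t: "trig_poly L K t" "sqn L (\<lambda>x. g x - t x) < e / (norm a)\<^sup>2"
      using assms unfolding tp_approx_def by blast
    have "(norm a)\<^sup>2 * sqn L (\<lambda>x. g x - t x) < e"
      using t(2) False by (simp add: field_simps)
    then have "sqn L (\<lambda>x. a * g x - a * t x) < e"
      by (simp add: sqn_cmult[symmetric] right_diff_distrib)
    then show "\<exists>K f. trig_poly L K f \<and> sqn L (\<lambda>x. a * g x - f x) < e"
      using trig_poly_cmult[OF t(1)] by blast
  qed
qed

lemma tp_approx_sum:
  "(\<And>i. i \<in> I \<Longrightarrow> tp_approx L (g i)) \<Longrightarrow> tp_approx L (\<lambda>x. \<Sum>i\<in>I. g i x)"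
  by (induction I rule: infinite_finite_induct)
     (auto intro: tp_approx_add tp_approx_trig_poly[OF trig_poly_zero[of "{}"]])

text \<open>Realizes the torus inside \<open>complex^3\<close>. Polynomials in the coordinates
  become trigonometric polynomials, so Stone-Weierstrass on the compact image gives the density
  without a separate treatment of periodicity.\<close>

definition torus_map :: "real \<Rightarrow> real^3 \<Rightarrow> complex^3" where
  "torus_map L x = (\<chi> i. ek L (axis i 1) x)"

lemma continuous_torus_map: "continuous_on S (torus_map L)"
  unfolding torus_map_def by (intro continuous_on_vec_lambda continuous_ek)

text \<open>Opposite faces of the closed cube are identified, so one of the points has to lie in the
  open cube: then the coordinates differ by a multiple of \<open>L\<close> of absolute value less
  than \<open>L\<close>.\<close>

lemma torus_map_inj:
  assumes L: "L > 0" and x: "x \<in> cbox 0 (vec L)" and y: "y \<in> box 0 (vec L)"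
    and eq: "torus_map L x = torus_map L y"
  shows "x = y"
proof -
  have "x $ i = y $ i" for i
  proof -
    have f: "freq (axis i 1) \<bullet> z = z $ i" for z :: "real^3"
    proof -
      have "freq (axis i 1) = axis i 1" by (simp add: freq_def axis_def vec_eq_iff)
      then show ?thesis by (simp add: inner_axis')
    qed
    have "cis (2 * pi / L * x $ i) = cis (2 * pi / L * y $ i)"
      using arg_cong[OF eq, of "\<lambda>z. z $ i"] unfolding torus_map_def ek_def vec_lambda_beta f .
    then obtain n :: int where n: "2 * pi / L * x $ i = 2 * pi / L * y $ i + 2 * pi * n"
      by (metis sin_cos_eq_iff cis.sel)
    have "L / (2 * pi) * (2 * pi / L * x $ i) = L / (2 * pi) * (2 * pi / L * y $ i + 2 * pi * n)"
      by (simp only: n)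
    then have "x $ i = y $ i + L * n" using L by (simp add: distrib_left)
    moreover have "0 \<le> x $ i" "x $ i \<le> L" "0 < y $ i" "y $ i < L"
      using x y by (auto simp: mem_box_cart)
    ultimately have "L * n < L * 1" "L * (-1) < L * n" by linarith+
    then have "real_of_int n < 1" "- 1 < real_of_int n"
      using L mult_less_cancel_left_pos[OF L, of n 1] mult_less_cancel_left_pos[OF L, of "-1" n] by metis+
    then have "n < 1" "-1 < n" by linarith+
    then have "n = 0" by linarith
    then show ?thesis using \<open>x $ i = y $ i + L * n\<close> by simp
  qed
  then show ?thesis by (simp add: vec_eq_iff)
qed

text \<open>A real linear functional of \<open>torus_map\<close> involves real and imaginary parts
  of the coordinates, that is, the frequencies \<open>axis i 1\<close> and
  \<open>- axis i 1\<close>; products add frequencies.\<close>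

lemma trig_poly_polynomial:
  assumes "real_polynomial_function p"
  shows "\<exists>K. trig_poly L K (\<lambda>x. of_real (p (torus_map L x)))"
  using assms
proof induction
  case (linear f)
  interpret f: bounded_linear f by (rule linear)
  let ?K = "(\<lambda>i. axis i 1) ` UNIV \<union> (\<lambda>i. - axis i 1) ` UNIV :: (int^3) set"
  have z: "z = (\<Sum>i\<in>UNIV. Re (z $ i) *\<^sub>R axis i 1 + Im (z $ i) *\<^sub>R axis i \<i>)" for z :: "complex^3"
  proof -
    have "(\<Sum>i\<in>UNIV. Re (z $ i) *\<^sub>R axis i 1 + Im (z $ i) *\<^sub>R axis i \<i>) $ j = z $ j" for j
    proof -
      have "(\<Sum>i\<in>UNIV. Re (z $ i) *\<^sub>R axis i 1 + Im (z $ i) *\<^sub>R axis i \<i>) $ j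
          = (\<Sum>i\<in>UNIV. if i = j then Re (z $ i) *\<^sub>R 1 + Im (z $ i) *\<^sub>R \<i> else 0)"
        unfolding sum_component by (intro sum.cong) (auto simp: axis_def)
      also have "\<dots> = z $ j" by (simp add: complex_eq_iff)
      finally show ?thesis .
    qed
    then show ?thesis by (simp add: vec_eq_iff)
  qed
  have fz: "f z = (\<Sum>i\<in>UNIV. Re (z $ i) * f (axis i 1) + Im (z $ i) * f (axis i \<i>))" for z
    using arg_cong[OF z[of z], of f] by (simp only: f.sum f.add f.scaleR real_scaleR_def)
  have e: "(\<lambda>x. of_real (f (torus_map L x))) = (\<lambda>x. \<Sum>i\<in>UNIV.
      (of_real (f (axis i 1)) / 2 - \<i> / 2 * of_real (f (axis i \<i>))) * ek L (axis i 1) x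
      + (of_real (f (axis i 1)) / 2 + \<i> / 2 * of_real (f (axis i \<i>))) * ek L (- axis i 1) x)"
  proof (intro ext)
    \<comment> \<open>\<open>Re c\<close> and \<open>Im c\<close> are written through
      \<open>c\<close> and \<open>cnj c\<close>; \<open>cnj\<close> turns the mode
      \<open>axis i 1\<close> into \<open>- axis i 1\<close>.\<close>
    have "of_real (Re c * a + Im c * b) = (of_real a / 2 - \<i> / 2 * of_real b) * c + (of_real a / 2 + \<i> / 2 * of_real b) * cnj c"
      for a b c by (simp add: complex_eq_iff)
    then show "complex_of_real (f (torus_map L x)) = (\<Sum>i\<in>UNIV.
      (of_real (f (axis i 1)) / 2 - \<i> / 2 * of_real (f (axis i \<i>))) * ek L (axis i 1) x
      + (of_real (f (axis i 1)) / 2 + \<i> / 2 * of_real (f (axis i \<i>))) * ek L (- axis i 1) x)" for x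
      unfolding ek_cnj[symmetric] fz[of "torus_map L x"] of_real_sum by (simp only: torus_map_def vec_lambda_beta)
  qed
  show ?case unfolding e
    by (intro exI[of _ ?K] trig_poly_sum trig_poly_add trig_poly_cmult trig_poly_ek) auto
next
  case (const c)
  have "trig_poly L {0} (\<lambda>x. of_real c * ek L 0 x)"
    by (intro trig_poly_cmult trig_poly_ek) auto
  then show ?case by auto
next
  case (add f g)
  then obtain K J where "trig_poly L K (\<lambda>x. of_real (f (torus_map L x)))" "trig_poly L J (\<lambda>x. of_real (g (torus_map L x)))"
    by blast
  moreover from this have "finite (K \<union> J)" by (auto simp: trig_poly_def)
  ultimately have "trig_poly L (K \<union> J) (\<lambda>x. of_real (f (torus_map L x)) + of_real (g (torus_map L x)))"
    by (intro trig_poly_add) (auto elim: trig_poly_mono)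
  then show ?case by (auto simp del: of_real_add simp flip: of_real_add)
next
  case (mult f g)
  then obtain K J where *: "trig_poly L K (\<lambda>x. of_real (f (torus_map L x)))" "trig_poly L J (\<lambda>x. of_real (g (torus_map L x)))"
    by blast
  then have "finite ((\<lambda>(k, l). k + l) ` (K \<times> J))" by (auto simp: trig_poly_def)
  with * have "trig_poly L ((\<lambda>(k, l). k + l) ` (K \<times> J)) (\<lambda>x. of_real (f (torus_map L x)) * of_real (g (torus_map L x)))"
    by (intro trig_poly_mult) auto
  then show ?case by (auto simp flip: of_real_mult)
qed

lemma sqn_bounded:
  assumes L: "L > 0" and "g \<in> borel_measurable (torus L)" "\<And>x. x \<in> cbox 0 (vec L) \<Longrightarrow> norm (g x) \<le> e"
  shows "sqn L g \<le> L ^ 3 * e\<^sup>2"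
proof -
  interpret finite_measure "torus L" by (rule finite_measure_torus)
  have b: "(norm (g x))\<^sup>2 \<le> e\<^sup>2" if "x \<in> cbox 0 (vec L)" for x
    using assms(3)[OF that] by (intro power_mono) auto
  have "sqn L g \<le> (LINT x|torus L. e\<^sup>2)"
    unfolding sqn_def
    by (intro integral_mono_AE integrable_const_bound[of _ "e\<^sup>2"] AE_I2) (use b assms(2) in auto)
  also have "\<dots> = L ^ 3 * e\<^sup>2" using integral_torus_const[OF L, of "e\<^sup>2"] by (simp del: lebesgue_integral_const)
  finally show ?thesis .
qed

lemma tp_approx_continuous:
  fixes F :: "complex^3 \<Rightarrow> real"
  assumes L: "L > 0" and F: "continuous_on UNIV F"
  shows "tp_approx L (\<lambda>x. of_real (F (torus_map L x)))"
proof -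
  let ?S = "torus_map L ` cbox 0 (vec L)"
  have S: "compact ?S" by (intro compact_continuous_image continuous_torus_map compact_cbox)
  have m: "(\<lambda>x. of_real (F (torus_map L x)) :: complex) \<in> borel_measurable (torus L)"
    by (intro continuous_measurable_torus continuous_intros continuous_on_compose2[OF F] continuous_torus_map) auto
  show ?thesis unfolding tp_approx_def
  proof (intro conjI allI impI)
    have "compact (F ` ?S)" by (intro compact_continuous_image S continuous_on_subset[OF F]) auto
    then have "bounded (F ` ?S)" by (rule compact_imp_bounded)
    then obtain B where B: "\<And>y. y \<in> ?S \<Longrightarrow> norm (F y) \<le> B"
      unfolding bounded_iff by blast
    show "in_L2 L (\<lambda>x. of_real (F (torus_map L x)) :: complex)"
      by (rule in_L2_bounded[OF m, of B]) (use B in auto)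
  next
    fix e :: real assume e: "e > 0"
    \<comment> \<open>A uniform error \<open>d\<close> costs at most
      \<open>L ^ 3 * d\<^sup>2 = e / 2\<close> in the squared norm.\<close>
    define d where "d = sqrt (e / (2 * L ^ 3))"
    have d: "d > 0" "L ^ 3 * d\<^sup>2 < e" using e L by (auto simp: d_def field_simps)
    obtain p where p: "real_polynomial_function p" "\<And>x. x \<in> ?S \<Longrightarrow> \<bar>F x - p x\<bar> < d"
      using Stone_Weierstrass_real_polynomial_function[OF S continuous_on_subset[OF F] d(1)] by auto
    obtain K where K: "trig_poly L K (\<lambda>x. of_real (p (torus_map L x)))" using trig_poly_polynomial[OF p(1)] by blast
    have "sqn L (\<lambda>x. of_real (F (torus_map L x)) - of_real (p (torus_map L x)) :: complex) \<le> L ^ 3 * d\<^sup>2"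
    proof (rule sqn_bounded[OF L])
      show "(\<lambda>x. of_real (F (torus_map L x)) - of_real (p (torus_map L x)) :: complex) \<in> borel_measurable (torus L)"
        by (intro borel_measurable_diff m in_L2_measurable trig_poly_in_L2[OF K])
      fix x :: "real^3" assume "x \<in> cbox 0 (vec L)"
      then show "norm (of_real (F (torus_map L x)) - of_real (p (torus_map L x)) :: complex) \<le> d"
        using p(2)[of "torus_map L x"] by (simp flip: of_real_diff)
    qed
    then show "\<exists>K h. trig_poly L K h \<and> sqn L (\<lambda>x. of_real (F (torus_map L x)) - h x) < e"
      using K d(2) by (auto dest: order.strict_trans1)
  qed
qed

lemma sqn_tendsto_0:
  fixes h :: "nat \<Rightarrow> real^3 \<Rightarrow> complex"
  assumes g: "in_L2 L g"
    and m: "\<And>n. h n \<in> borel_measurable (torus L)"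
    and lim: "\<And>x. x \<in> cbox 0 (vec L) \<Longrightarrow> (\<lambda>n. h n x) \<longlonglongrightarrow> 0"
    and b: "\<And>n x. x \<in> cbox 0 (vec L) \<Longrightarrow> norm (h n x) \<le> norm (g x)"
  shows "(\<lambda>n. sqn L (h n)) \<longlonglongrightarrow> 0"
proof -
  have "(\<lambda>n. LINT x|torus L. (norm (h n x))\<^sup>2) \<longlonglongrightarrow> (LINT x|torus L. 0)"
  proof (rule integral_dominated_convergence[where w="\<lambda>x. (norm (g x))\<^sup>2"])
    show "integrable (torus L) (\<lambda>x. (norm (g x))\<^sup>2)" by (rule in_L2_sq_integrable[OF g])
    show "(\<lambda>x. (norm (h n x))\<^sup>2) \<in> borel_measurable (torus L)" for n using m by simp
    have "(\<lambda>n. (norm (h n x))\<^sup>2) \<longlonglongrightarrow> 0" if "x \<in> cbox 0 (vec L)" for x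
      using tendsto_power[OF tendsto_norm[OF lim[OF that]], of 2] by simp
    then show "AE x in torus L. (\<lambda>n. (norm (h n x))\<^sup>2) \<longlonglongrightarrow> 0" by (intro AE_I2) auto
    show "AE x in torus L. norm ((norm (h n x))\<^sup>2) \<le> (norm (g x))\<^sup>2" for n
      using b by (intro AE_I2) (auto intro: power_mono)
  qed simp
  then show ?thesis by (simp add: sqn_def)
qed

lemma tp_approx_sequence:
  assumes g: "in_L2 L g" and h: "\<And>n::nat. tp_approx L (h n)"
    and lim: "(\<lambda>n. sqn L (\<lambda>x. g x - h n x)) \<longlonglongrightarrow> 0"
  shows "tp_approx L g"
proof (rule tp_approx_limit[OF g])
  fix e :: real assume "e > 0"
  then have "\<forall>\<^sub>F n in sequentially. sqn L (\<lambda>x. g x - h n x) < e"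
    using lim by (simp add: order_tendsto_iff)
  then obtain n where "sqn L (\<lambda>x. g x - h n x) < e" by (auto dest: eventually_happens)
  then show "\<exists>h. tp_approx L h \<and> sqn L (\<lambda>x. g x - h x) < e" using h by blast
qed

text \<open>The functions \<open>F n\<close> are continuous on \<open>complex^3\<close> and tend to
  the indicator of the compact image of \<open>K\<close>. Since \<open>K\<close> avoids the boundary
  of the cube, injectivity of \<open>torus_map\<close> makes the pullback of that indicator the
  indicator of \<open>K\<close>.\<close>

lemma tp_approx_indicator_compact:
  assumes L: "L > 0" and K: "compact K" "K \<subseteq> box 0 (vec L)"
  shows "tp_approx L (indicator K)"
proof (cases "K = {}")
  case True
  have "indicator {} = (\<lambda>x::real^3. 0 :: complex)" by (simp add: fun_eq_iff)
  then show ?thesis unfolding True using tp_approx_trig_poly[OF trig_poly_zero[of "{}"]] by simp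
next
  case False
  let ?C = "torus_map L ` K"
  have C: "closed ?C" "?C \<noteq> {}"
    using False by (auto intro!: compact_imp_closed compact_continuous_image continuous_torus_map K)
  define F where "F n z = max 0 (1 - real n * infdist z ?C)" for n z
  have F: "continuous_on UNIV (F n)" for n
    unfolding F_def by (intro continuous_intros)
  have in_C: "torus_map L x \<in> ?C \<longleftrightarrow> x \<in> K" if "x \<in> cbox 0 (vec L)" for x
    using torus_map_inj[OF L that] K(2) by auto
  have Kl: "K \<in> sets lebesgue" using K(1) by (simp add: lmeasurable_compact fmeasurableD)
  have ind_m: "(indicator K :: real^3 \<Rightarrow> complex) \<in> borel_measurable (torus L)"
    using K(1) by (intro borel_measurable_torus borel_measurable_indicator) (simp add: borel_compact)
  have ind: "in_L2 L (indicator K :: real^3 \<Rightarrow> complex)"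
    by (rule in_L2_bounded[OF ind_m, of 1]) (simp add: indicator_def)
  show ?thesis
  proof (rule tp_approx_sequence[OF ind tp_approx_continuous[OF L F]])
    show "(\<lambda>n. sqn L (\<lambda>x. indicator K x - complex_of_real (F n (torus_map L x)))) \<longlonglongrightarrow> 0"
    proof (rule sqn_tendsto_0[OF in_L2_const[of L "1::complex"]])
      show "(\<lambda>x. indicator K x - complex_of_real (F n (torus_map L x))) \<in> borel_measurable (torus L)" for n
        using tp_approx_continuous[OF L F] by (intro borel_measurable_diff ind_m) (auto simp: tp_approx_def in_L2_measurable)
      fix x :: "real^3" assume x: "x \<in> cbox 0 (vec L)"
      show "(\<lambda>n. indicator K x - complex_of_real (F n (torus_map L x))) \<longlonglongrightarrow> 0"
      proof (cases "x \<in> K")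
        case True
        then have "infdist (torus_map L x) ?C = 0" using in_C[OF x] by (simp add: in_closed_iff_infdist_zero[OF C])
        then show ?thesis using True by (simp add: F_def)
      next
        case False
        then have pos: "infdist (torus_map L x) ?C > 0" using in_C[OF x] infdist_pos_not_in_closed[OF C(1,2)] by auto
        obtain N :: nat where N: "1 < N * infdist (torus_map L x) ?C"
          using reals_Archimedean3[OF pos] by blast
        have "F n (torus_map L x) = 0" if "n \<ge> N" for n
        proof -
          have "N * infdist (torus_map L x) ?C \<le> n * infdist (torus_map L x) ?C"
            using that pos by (intro mult_right_mono) auto
          then show ?thesis using N by (simp add: F_def)
        qed
        then have "\<forall>\<^sub>F n in sequentially. indicator K x - complex_of_real (F n (torus_map L x)) = 0"
          using False by (intro eventually_sequentiallyI[of N]) simp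
        then show ?thesis by (rule tendsto_eventually)
      qed
      fix n
      show "norm (indicator K x - complex_of_real (F n (torus_map L x))) \<le> norm (1::complex)"
      proof (cases "x \<in> K")
        case True
        then have "infdist (torus_map L x) ?C = 0" using in_C[OF x] by (simp add: in_closed_iff_infdist_zero[OF C])
        then show ?thesis using True by (simp add: F_def)
      next
        case False
        have "0 \<le> F n (torus_map L x)" "F n (torus_map L x) \<le> 1"
          by (auto simp: F_def infdist_nonneg)
        then show ?thesis using False by simp
      qed
    qed
  qed
qed

lemma tp_approx_indicator:
  assumes L: "L > 0" and A: "A \<in> sets (torus L)"
  shows "tp_approx L (indicator A)"
proof (rule tp_approx_limit)
  have m: "(indicator B :: real^3 \<Rightarrow> complex) \<in> borel_measurable (torus L)" if "B \<in> sets (torus L)" for B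
    using that by (rule borel_measurable_indicator)
  show "in_L2 L (indicator A :: real^3 \<Rightarrow> complex)"
    by (rule in_L2_bounded[OF m[OF A], of 1]) (simp add: indicator_def)
  fix e :: real assume e: "e > 0"
  have Al: "A \<in> sets lebesgue" "A \<subseteq> cbox 0 (vec L)"
    using A unfolding torus_def by (auto simp: sets_restrict_space)
  \<comment> \<open>The boundary of the cube is dropped to reach the situation of
    \<open>tp_approx_indicator_compact\<close>; it is a null set, so measures do not change.\<close>
  let ?A = "A \<inter> box 0 (vec L)"
  have "?A \<in> sets lebesgue" using Al by auto
  from sets_lebesgue_inner_closed[OF this e]
  obtain T where T: "closed T" "T \<subseteq> ?A" "?A - T \<in> lmeasurable" "emeasure lebesgue (?A - T) < ennreal e" by auto
  have "bounded T" using T(2) by (meson Int_lower2 bounded_box bounded_subset)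
  then have cT: "compact T" using T(1) by (simp add: compact_eq_bounded_closed)
  have T': "tp_approx L (indicator T)"
    by (rule tp_approx_indicator_compact[OF L cT]) (use T(2) in auto)
  have Ts: "T \<in> sets lebesgue" using T(1) by (simp add: borel_closed)
  have AT: "A - T \<in> sets lebesgue" using Al Ts by auto
  have "sqn L (\<lambda>x. indicator A x - indicator T x :: complex) = (LINT x|torus L. indicator (A - T) x)"
    unfolding sqn_def using T(2)
    by (intro Bochner_Integration.integral_cong) (auto simp: indicator_def)
  also have "\<dots> = measure lebesgue (A - T)"
  proof -
    have "A - T \<in> sets (torus L)"
      using AT Al(2) unfolding torus_def sets_restrict_space by (auto intro!: image_eqI[of _ _ "A - T"])
    moreover have "A - T \<inter> cbox 0 (vec L) \<subseteq> cbox 0 (vec L)" "(A - T) \<inter> cbox 0 (vec L) = A - T" using Al(2) by auto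
    ultimately show ?thesis
      using AT Al(2) by (simp add: torus_def measure_restrict_space Diff_subset[THEN order_trans])
  qed
  also have "\<dots> = measure lebesgue (?A - T)"
  proof (rule measure_negligible_symdiff[symmetric])
    show "A - T \<in> lmeasurable"
      using AT Al(2) by (intro bounded_set_imp_lmeasurable bounded_subset[OF bounded_cbox]) auto
    have "negligible (cbox 0 (vec L) - box 0 (vec L :: real^3))"
      by (rule negligible_frontier_interval)
    then show "negligible (sym_diff (A - T) (?A - T))"
      by (rule negligible_subset) (use Al(2) in auto)
  qed
  also have "\<dots> < e"
    using T(3,4) e by (simp add: emeasure_eq_measure2 ennreal_less_iff)
  finally show "\<exists>h. tp_approx L h \<and> sqn L (\<lambda>x. indicator A x - h x) < e" using T' by blast
qed

theorem tp_approx_in_L2: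
  assumes L: "L > 0" and g: "in_L2 L g"
  shows "tp_approx L g"
proof -
  obtain s where s: "\<And>i. simple_function (torus L) (s i)"
      "\<And>x. x \<in> cbox 0 (vec L) \<Longrightarrow> (\<lambda>i. s i x) \<longlonglongrightarrow> g x"
      "\<And>i x. x \<in> cbox 0 (vec L) \<Longrightarrow> norm (s i x) \<le> 2 * norm (g x)"
    using borel_measurable_implies_sequence_metric[OF in_L2_measurable[OF g], of 0] by (auto simp: dist_norm) blast
  \<comment> \<open>Dominating function: the simple functions satisfy
    \<open>norm (s i x) \<le> 2 * norm (g x)\<close>, so the errors are at most
    \<open>3 * norm (g x)\<close>.\<close>
  have g3: "in_L2 L (\<lambda>x. 3 * g x)" by (rule in_L2_cmult[OF g])
  define t where "t i x = (\<Sum>y\<in>s i ` cbox 0 (vec L). y * indicator (s i -` {y} \<inter> cbox 0 (vec L)) x)" for i x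
  have fin: "finite (s i ` cbox 0 (vec L))" for i
    using simple_functionD(1)[OF s(1)] by simp
  have t: "tp_approx L (t i)" for i
    unfolding t_def using simple_functionD(2)[OF s(1)]
    by (intro tp_approx_sum tp_approx_cmult tp_approx_indicator[OF L]) simp
  have ts: "t i x = s i x" if x: "x \<in> cbox 0 (vec L)" for i x
  proof -
    have "t i x = (\<Sum>y\<in>s i ` cbox 0 (vec L). if y = s i x then y else 0)"
      unfolding t_def using x by (intro sum.cong) (auto simp: indicator_def)
    also have "\<dots> = s i x" using x fin[of i] by simp
    finally show ?thesis .
  qed
  show ?thesis
  proof (rule tp_approx_sequence[OF g t])
    show "(\<lambda>n. sqn L (\<lambda>x. g x - t n x)) \<longlonglongrightarrow> 0"
    proof (rule sqn_tendsto_0[OF g3])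
      show "(\<lambda>x. g x - t n x) \<in> borel_measurable (torus L)" for n
        using t[of n] by (intro borel_measurable_diff in_L2_measurable g) (simp add: tp_approx_def)
      fix x :: "real^3" assume x: "x \<in> cbox 0 (vec L)"
      show "(\<lambda>n. g x - t n x) \<longlonglongrightarrow> 0"
        using tendsto_diff[OF tendsto_const s(2)[OF x], of "g x"] by (simp add: ts[OF x])
      show "norm (g x - t n x) \<le> norm (3 * g x)" for n
        using norm_triangle_ineq4[of "g x" "s n x"] s(3)[OF x, of n] by (simp add: ts[OF x] norm_mult)
    qed
  qed
qed

section \<open>Sharp Fourier truncation and Parseval's identity\<close>

definition freq_box :: "nat \<Rightarrow> (int^3) set" where
  "freq_box N = {k. \<forall>i. \<bar>k $ i\<bar> \<le> int N}"

lemma freq_box_eq_image: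
  "freq_box N = vec_lambda ` (PiE UNIV (\<lambda>i::3. {- int N .. int N}))"
proof (intro equalityI subsetI)
  fix k assume "k \<in> freq_box N"
  then show "k \<in> vec_lambda ` (PiE UNIV (\<lambda>i::3. {- int N .. int N}))"
    by (intro image_eqI[of _ _ "\<lambda>i. k $ i"]) (auto simp: freq_box_def PiE_def abs_le_iff minus_le_iff)
qed (auto simp: freq_box_def PiE_def Pi_def abs_le_iff minus_le_iff)

lemma finite_freq_box [simp]: "finite (freq_box N)"
  unfolding freq_box_eq_image by (intro finite_imageI finite_PiE) auto

lemma card_freq_box: "card (freq_box N) = (2 * N + 1) ^ 3"
proof -
  have "card (freq_box N) = card (PiE UNIV (\<lambda>i::3. {- int N .. int N}))"
    unfolding freq_box_eq_image by (rule card_image) (auto simp: inj_on_def vec_lambda_inject)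
  also have "\<dots> = (2 * N + 1) ^ 3" by (simp add: card_PiE nat_add_distrib nat_mult_distrib)
  finally show ?thesis .
qed

lemma freq_box_mono: "M \<le> N \<Longrightarrow> freq_box M \<subseteq> freq_box N"
  unfolding freq_box_def by (auto intro: order_trans)

lemma freq_box_uminus: "- k \<in> freq_box N \<longleftrightarrow> k \<in> freq_box N"
  by (simp add: freq_box_def)

lemma freq_box_exhaust:
  assumes "finite K" shows "\<exists>N. K \<subseteq> freq_box N"
  using assms
proof induction
  case (insert k K)
  then obtain N where N: "K \<subseteq> freq_box N" by blast
  define M where "M = max N (nat (\<Sum>i\<in>UNIV. \<bar>k $ i\<bar>))"
  have "\<bar>k $ i\<bar> \<le> (\<Sum>i\<in>UNIV. \<bar>k $ i\<bar>)" for i by (rule member_le_sum) auto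
  moreover have "(\<Sum>i\<in>UNIV. \<bar>k $ i\<bar>) \<le> int M" unfolding M_def by simp
  ultimately have "\<bar>k $ i\<bar> \<le> int M" for i by (rule order_trans)
  then have "k \<in> freq_box M" by (simp add: freq_box_def)
  moreover have "K \<subseteq> freq_box M" using N freq_box_mono[of N M] by (auto simp: M_def)
  ultimately show ?case by auto
qed auto

abbreviation trunc :: "real \<Rightarrow> nat \<Rightarrow> (real^3 \<Rightarrow> complex) \<Rightarrow> real^3 \<Rightarrow> complex" where
  "trunc L N g \<equiv> tp L (freq_box N) (fcc L g)"

text \<open>By \<open>sqn_diff_tp\<close> the truncation is the best approximation with frequencies
  in the box, so it is at least as good as the polynomial supplied by density, once the box contains
  that polynomial's spectrum.\<close>

theorem trunc_tendsto:
  assumes L: "L > 0" and g: "in_L2 L g"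
  shows "(\<lambda>N. sqn L (\<lambda>x. g x - trunc L N g x)) \<longlonglongrightarrow> 0"
proof (rule LIMSEQ_I)
  fix e :: real assume "e > 0"
  then obtain K h where h: "trig_poly L K h" "sqn L (\<lambda>x. g x - h x) < e"
    using tp_approx_in_L2[OF L g] unfolding tp_approx_def by blast
  obtain M where M: "K \<subseteq> freq_box M" using freq_box_exhaust h(1) by (auto simp: trig_poly_def)
  have "sqn L (\<lambda>x. g x - trunc L N g x) < e" if "N \<ge> M" for N
  proof -
    have "trig_poly L (freq_box N) h"
      using trig_poly_mono[OF h(1)] M freq_box_mono[OF that] by auto
    then obtain c where c: "h = tp L (freq_box N) c" by (auto simp: trig_poly_def)
    have "sqn L (\<lambda>x. g x - trunc L N g x) \<le> sqn L (\<lambda>x. g x - h x)"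
      unfolding c sqn_diff_tp[OF L finite_freq_box g] using L by (simp add: sum_nonneg)
    then show ?thesis using h(2) by simp
  qed
  then show "\<exists>M. \<forall>N\<ge>M. norm (sqn L (\<lambda>x. g x - trunc L N g x) - 0) < e" by auto
qed

lemma sqn_trunc_le:
  assumes L: "L > 0" and g: "in_L2 L g" and K: "finite K"
  shows "L ^ 3 * (\<Sum>k\<in>K. (norm (fcc L g k))\<^sup>2) \<le> sqn L g"
  using sqn_diff_tp[OF L K g, of "fcc L g"] sqn_nonneg[of L "\<lambda>x. g x - tp L K (fcc L g) x"] by simp

theorem parseval:
  assumes L: "L > 0" and g: "in_L2 L g"
  shows "(\<lambda>N. L ^ 3 * (\<Sum>k\<in>freq_box N. (norm (fcc L g k))\<^sup>2)) \<longlonglongrightarrow> sqn L g"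
proof -
  have "(\<lambda>N. sqn L g - sqn L (\<lambda>x. g x - trunc L N g x)) \<longlonglongrightarrow> sqn L g - 0"
    by (intro tendsto_diff tendsto_const trunc_tendsto assms)
  then show ?thesis by (simp add: sqn_diff_tp[OF L finite_freq_box g])
qed

lemma integral_mult_trunc_tendsto:
  assumes L: "L > 0" and g: "in_L2 L g" and h: "in_L2 L h"
  shows "(\<lambda>N. LINT x|torus L. h x * trunc L N g x) \<longlonglongrightarrow> (LINT x|torus L. h x * g x)"
proof -
  have "(\<lambda>N. (LINT x|torus L. h x * g x) - (LINT x|torus L. h x * trunc L N g x)) \<longlonglongrightarrow> 0"
  proof (rule Lim_null_comparison)
    have "(\<lambda>N. sqrt (sqn L h) * sqrt (sqn L (\<lambda>x. g x - trunc L N g x))) \<longlonglongrightarrow> sqrt (sqn L h) * sqrt 0"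
      by (intro tendsto_intros trunc_tendsto assms)
    then show "(\<lambda>N. sqrt (sqn L h) * sqrt (sqn L (\<lambda>x. g x - trunc L N g x))) \<longlonglongrightarrow> 0" by simp
    show "\<forall>\<^sub>F N in sequentially. norm ((LINT x|torus L. h x * g x) - (LINT x|torus L. h x * trunc L N g x))
       \<le> sqrt (sqn L h) * sqrt (sqn L (\<lambda>x. g x - trunc L N g x))"
    proof (intro always_eventually allI)
      fix N
      have "(LINT x|torus L. h x * g x) - (LINT x|torus L. h x * trunc L N g x)
          = (LINT x|torus L. h x * g x - h x * trunc L N g x)"
        by (intro Bochner_Integration.integral_diff[symmetric] in_L2_integrable_mult g h in_L2_tp)
      then show "norm ((LINT x|torus L. h x * g x) - (LINT x|torus L. h x * trunc L N g x))
         \<le> sqrt (sqn L h) * sqrt (sqn L (\<lambda>x. g x - trunc L N g x))"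
        using L2_CS[OF h in_L2_diff[OF g in_L2_tp], of L "freq_box N" "fcc L g"]
        by (simp add: right_diff_distrib)
    qed
  qed
  from tendsto_diff[OF tendsto_const[of "LINT x|torus L. h x * g x"] this] show ?thesis by simp
qed

text \<open>No conjugate is taken, hence the frequency \<open>- k\<close> in the second
  factor.\<close>

theorem parseval_bilinear:
  assumes L: "L > 0" and g: "in_L2 L g" and h: "in_L2 L h"
  shows "(\<lambda>N. of_real (L ^ 3) * (\<Sum>k\<in>freq_box N. fcc L g k * fcc L h (- k))) \<longlonglongrightarrow> (LINT x|torus L. g x * h x)"
  using integral_mult_trunc_tendsto[OF assms] by (simp only: integral_mult_tp[OF L h] mult.commute)

section \<open>Hoelder and Bernstein inequalities\<close>

text \<open>Young's inequality for \<open>x / a\<close> and \<open>y / b\<close>. With the integrals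
  of the two functions as \<open>a\<close> and \<open>b\<close>, the bracket integrates to 1, and
  Hoelder's inequality results.\<close>

lemma young_powr:
  fixes x y a b :: real
  assumes "0 < t" "t < 1" "x \<ge> 0" "y \<ge> 0" "a > 0" "b > 0"
  shows "x powr t * y powr (1 - t) \<le> a powr t * b powr (1 - t) * (t * (x / a) + (1 - t) * (y / b))"
proof (cases "x = 0 \<or> y = 0")
  case True
  have "0 \<le> t * (x / a) + (1 - t) * (y / b)" using assms by simp
  then have "0 \<le> a powr t * b powr (1 - t) * (t * (x / a) + (1 - t) * (y / b))" by simp
  moreover have "x powr t * y powr (1 - t) = 0" using True by auto
  ultimately show ?thesis by linarith
next
  case False
  then have "x > 0" "y > 0" using assms by auto
  then have "(x / a) powr t * (y / b) powr (1 - t) \<le> t * (x / a) + (1 - t) * (y / b)"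
    using assms by (intro Youngs_inequality_0) auto
  moreover have "x powr t * y powr (1 - t) = a powr t * b powr (1 - t) * ((x / a) powr t * (y / b) powr (1 - t))"
    using assms by (simp add: powr_divide)
  ultimately show ?thesis by (simp add: mult_left_mono)
qed

lemma holder_powr:
  fixes X Y :: "'a \<Rightarrow> real"
  assumes t: "0 < t" "t < 1" and X: "integrable M X" "\<And>x. X x \<ge> 0" and Y: "integrable M Y" "\<And>x. Y x \<ge> 0"
  shows "(LINT x|M. X x powr t * Y x powr (1 - t)) \<le> (LINT x|M. X x) powr t * (LINT x|M. Y x) powr (1 - t)"
proof -
  let ?A = "LINT x|M. X x" and ?B = "LINT x|M. Y x"
  have nn: "?A \<ge> 0" "?B \<ge> 0" using X Y by (auto intro: integral_nonneg_AE)
  \<comment> \<open>Enlarging both integrals by \<open>e\<close> makes them usable as denominators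
    even if they vanish; the limit below removes \<open>e\<close>.\<close>
  have "(LINT x|M. X x powr t * Y x powr (1 - t)) \<le> (?A + e) powr t * (?B + e) powr (1 - t)" if e: "e > 0" for e
  proof -
    let ?a = "?A + e" and ?b = "?B + e"
    have ab: "?a > 0" "?b > 0" using nn e by auto
    have i: "integrable M (\<lambda>x. ?a powr t * ?b powr (1 - t) * (t * (X x / ?a) + (1 - t) * (Y x / ?b)))"
      using X Y by simp
    have "(LINT x|M. X x powr t * Y x powr (1 - t)) \<le> (LINT x|M. ?a powr t * ?b powr (1 - t) * (t * (X x / ?a) + (1 - t) * (Y x / ?b)))"
      by (rule integral_mono'[OF i young_powr]) (use t X Y ab in auto)
    also have "\<dots> = ?a powr t * ?b powr (1 - t) * (t * (?A / ?a) + (1 - t) * (?B / ?b))"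
      using X Y by simp
    also have "\<dots> \<le> ?a powr t * ?b powr (1 - t) * (t * 1 + (1 - t) * 1)"
      using nn e t ab by (intro mult_left_mono add_mono) (auto simp: divide_le_eq_1)
    finally show ?thesis by simp
  qed
  then have ev: "\<forall>\<^sub>F n in sequentially. (LINT x|M. X x powr t * Y x powr (1 - t)) \<le> (?A + 1 / real (Suc n)) powr t * (?B + 1 / real (Suc n)) powr (1 - t)"
    by (intro always_eventually allI) auto
  have z: "(\<lambda>n. 1 / real (Suc n)) \<longlonglongrightarrow> 0"
    using LIMSEQ_inverse_real_of_nat by (simp add: inverse_eq_divide)
  have "(\<lambda>n. (?A + 1 / real (Suc n)) powr t * (?B + 1 / real (Suc n)) powr (1 - t)) \<longlonglongrightarrow> (?A + 0) powr t * (?B + 0) powr (1 - t)"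
    by (intro tendsto_mult tendsto_powr' tendsto_add tendsto_const z disjI2 conjI always_eventually allI)
       (use nn t in \<open>auto intro: add_nonneg_nonneg\<close>)
  from tendsto_lowerbound[OF this ev] show ?thesis by simp
qed

lemma trig_poly_measurable: "trig_poly L K g \<Longrightarrow> g \<in> borel_measurable (torus L')"
  by (auto simp: trig_poly_def measurable_tp)

lemma trig_poly_bounded: "trig_poly L K g \<Longrightarrow> \<exists>B. \<forall>x. norm (g x) \<le> B"
  unfolding trig_poly_def using norm_tp_le by blast

lemma Lp_norm_nonneg: "Lp_norm L p g \<ge> 0"
  by (simp add: Lp_norm_def)

text \<open>Hoelder with exponents \<open>r / 2\<close> and \<open>r / (r - 2)\<close> is applied to
  \<open>|a|^2\<close> times \<open>|g|^(2 - 4/r)\<close>; the remaining power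
  \<open>|g|^(4/r)\<close> is estimated by the supremum \<open>G\<close>.\<close>

lemma sqn_mult_le_holder:
  fixes a g :: "real^3 \<Rightarrow> complex"
  assumes L: "L > 0" and r: "r > 2" and a: "trig_poly L Ka a" and g: "trig_poly L Kg g"
    and G: "\<And>x. norm (g x) \<le> G"
  shows "sqn L (\<lambda>x. a x * g x) \<le> (Lp_norm L r a)\<^sup>2 * (G powr (4 / r) * sqn L g powr (1 - 2 / r))"
proof -
  have G0: "G \<ge> 0" using G[of 0] norm_ge_zero order_trans by blast
  obtain Ba where Ba: "\<And>x. norm (a x) \<le> Ba" using trig_poly_bounded[OF a] by blast
  define t where "t = 2 / r"
  have t: "0 < t" "t < 1" using r by (auto simp: t_def)
  define X where "X x = norm (a x) powr r" for x
  define Y where "Y x = (norm (g x))\<^sup>2" for x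
  have m: "a \<in> borel_measurable (torus L)" "g \<in> borel_measurable (torus L)"
    using trig_poly_measurable a g by auto
  have X: "integrable (torus L) X" unfolding X_def
    by (rule integrable_torus_bounded[of _ _ "Ba powr r"]) (use m Ba r in \<open>auto intro!: powr_mono2\<close>)
  have Y: "integrable (torus L) Y" unfolding Y_def
    by (rule in_L2_sq_integrable[OF trig_poly_in_L2[OF g]])
  have XY: "X x powr t * Y x powr (1 - t) = (norm (a x))\<^sup>2 * norm (g x) powr (2 - 4 / r)" for x
  proof -
    have "X x powr t = (norm (a x))\<^sup>2"
      using r by (cases "a x = 0") (auto simp: X_def t_def powr_powr simp flip: powr_numeral)
    moreover have "Y x powr (1 - t) = norm (g x) powr (2 - 4 / r)"
    proof (cases "g x = 0")
      case False
      then have "Y x = norm (g x) powr 2" by (simp add: Y_def)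
      then have "Y x powr (1 - t) = norm (g x) powr (2 * (1 - t))" by (simp only: powr_powr)
      then show ?thesis by (simp add: t_def algebra_simps)
    qed (simp add: Y_def)
    ultimately show ?thesis by simp
  qed
  have "integrable (torus L) (\<lambda>x. X x powr t * Y x powr (1 - t))"
    unfolding XY
  proof (rule integrable_torus_bounded[of _ _ "Ba\<^sup>2 * G powr (2 - 4 / r)"])
    show "(\<lambda>x. (norm (a x))\<^sup>2 * norm (g x) powr (2 - 4 / r)) \<in> borel_measurable (torus L)" using m by simp
    have "norm (g x) powr (2 - 4 / r) \<le> G powr (2 - 4 / r)" for x
      using G r by (intro powr_mono2) (auto simp: field_simps)
    moreover have "(norm (a x))\<^sup>2 \<le> Ba\<^sup>2" for x using Ba by (intro power_mono) auto
    ultimately show "norm ((norm (a x))\<^sup>2 * norm (g x) powr (2 - 4 / r)) \<le> Ba\<^sup>2 * G powr (2 - 4 / r)" for x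
      by (auto intro!: mult_mono)
  qed
  then have i: "integrable (torus L) (\<lambda>x. G powr (4 / r) * (X x powr t * Y x powr (1 - t)))" by simp
  have "sqn L (\<lambda>x. a x * g x) \<le> (LINT x|torus L. G powr (4 / r) * (X x powr t * Y x powr (1 - t)))"
    unfolding sqn_def
  proof (rule integral_mono'[OF i])
    fix x
    show "(norm (a x * g x))\<^sup>2 \<le> G powr (4 / r) * (X x powr t * Y x powr (1 - t))"
    proof (cases "g x = 0")
      case False
      have "(norm (g x))\<^sup>2 = norm (g x) powr (4 / r) * norm (g x) powr (2 - 4 / r)"
        using False by (simp add: powr_add[symmetric])
      also have "\<dots> \<le> G powr (4 / r) * norm (g x) powr (2 - 4 / r)"
        using G r by (intro mult_right_mono powr_mono2) auto
      finally have "(norm (a x))\<^sup>2 * (norm (g x))\<^sup>2 \<le> (norm (a x))\<^sup>2 * (G powr (4 / r) * norm (g x) powr (2 - 4 / r))"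
        by (rule mult_left_mono) simp
      then show ?thesis by (simp add: XY norm_mult power_mult_distrib mult_ac)
    qed simp
  qed simp
  also have "\<dots> = G powr (4 / r) * (LINT x|torus L. X x powr t * Y x powr (1 - t))" by simp
  also have "\<dots> \<le> G powr (4 / r) * ((LINT x|torus L. X x) powr t * (LINT x|torus L. Y x) powr (1 - t))"
    by (intro mult_left_mono holder_powr t X Y) (auto simp: X_def Y_def)
  also have "(LINT x|torus L. X x) powr t = (Lp_norm L r a)\<^sup>2"
  proof -
    have "(Lp_norm L r a)\<^sup>2 = Lp_norm L r a powr 2" using Lp_norm_nonneg[of L r a] by simp
    also have "\<dots> = (LINT x|torus L. X x) powr t" by (simp add: Lp_norm_def X_def powr_powr t_def)
    finally show ?thesis by simp
  qed
  finally show ?thesis by (simp add: Y_def sqn_def t_def mult_ac)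
qed

text \<open>Cauchy-Schwarz over the modes and Parseval: counting frequencies replaces kernel
  estimates.\<close>

lemma trig_poly_sup_le_sqn:
  assumes L: "L > 0" and g: "trig_poly L K g"
  shows "(norm (g x))\<^sup>2 \<le> card K / L ^ 3 * sqn L g"
proof -
  obtain c where K: "finite K" and c: "g = tp L K c" using g by (auto simp: trig_poly_def)
  have "(norm (g x))\<^sup>2 \<le> (\<Sum>k\<in>K. norm (c k))\<^sup>2" unfolding c by (intro power_mono norm_tp_le) auto
  also have "\<dots> = (\<Sum>k\<in>K. 1 * norm (c k))\<^sup>2" by simp
  also have "\<dots> \<le> (\<Sum>k\<in>K. 1\<^sup>2) * (\<Sum>k\<in>K. (norm (c k))\<^sup>2)" by (rule Cauchy_Schwarz_ineq_sum)
  also have "\<dots> = card K / L ^ 3 * sqn L g" using L unfolding c by (simp add: sqn_tp[OF L K])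
  finally show ?thesis .
qed

text \<open>The supremum of \<open>g\<close> in \<open>sqn_mult_le_holder\<close> is replaced by its
  L^2 bound; the powers \<open>2 / r\<close> and \<open>1 - 2 / r\<close> of \<open>sqn L g\<close>
  then add up to 1.\<close>

lemma sqn_mult_le_bernstein:
  assumes L: "L > 0" and r: "r > 2" and a: "trig_poly L Ka a" and g: "trig_poly L Kg g"
    and n: "real (card Kg) \<le> n" "n > 0"
  shows "sqn L (\<lambda>x. a x * g x) \<le> (Lp_norm L r a)\<^sup>2 * ((n / L ^ 3) powr (2 / r) * sqn L g)"
proof (cases "sqn L g = 0")
  case True
  obtain Ba where Ba: "\<And>x. norm (a x) \<le> Ba" using trig_poly_bounded[OF a] by blast
  have "sqn L (\<lambda>x. a x * g x) \<le> Ba\<^sup>2 * sqn L g"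
    by (rule in_L2_dominated(2)[OF trig_poly_in_L2[OF g]])
       (use trig_poly_measurable[OF a] trig_poly_measurable[OF g] Ba in \<open>auto simp: norm_mult intro!: mult_right_mono AE_I2\<close>)
  then show ?thesis using True by simp
next
  case False
  then have s: "sqn L g > 0" using sqn_nonneg[of L g] by linarith
  define G where "G = sqrt (n / L ^ 3 * sqn L g)"
  have p: "n / L ^ 3 > 0" using n L by simp
  have "norm (g x) \<le> G" for x
  proof -
    have "(norm (g x))\<^sup>2 \<le> card Kg / L ^ 3 * sqn L g" by (rule trig_poly_sup_le_sqn[OF L g])
    also have "\<dots> \<le> n / L ^ 3 * sqn L g" using n L by (intro mult_right_mono divide_right_mono) auto
    finally show ?thesis unfolding G_def by (rule real_le_rsqrt)
  qed
  from sqn_mult_le_holder[OF L r a g this]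
  have "sqn L (\<lambda>x. a x * g x) \<le> (Lp_norm L r a)\<^sup>2 * (G powr (4 / r) * sqn L g powr (1 - 2 / r))" .
  also have "G powr (4 / r) = (n / L ^ 3 * sqn L g) powr (2 / r)"
  proof -
    have "0 \<le> n / L ^ 3 * sqn L g" using p s by (intro mult_nonneg_nonneg) auto
    then have "G powr (4 / r) = (n / L ^ 3 * sqn L g) powr (1 / 2 * (4 / r))"
      unfolding G_def by (simp only: powr_half_sqrt[symmetric] powr_powr)
    then show ?thesis by simp
  qed
  also have "\<dots> = (n / L ^ 3) powr (2 / r) * sqn L g powr (2 / r)"
    using p s by (intro powr_mult)
  also have "\<dots> * sqn L g powr (1 - 2 / r) = (n / L ^ 3) powr (2 / r) * sqn L g"
    using s by (simp add: mult.assoc powr_add[symmetric])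
  finally show ?thesis .
qed

lemma freq_box_add: "k \<in> freq_box M \<Longrightarrow> l \<in> freq_box N \<Longrightarrow> k + l \<in> freq_box (M + N)"
  unfolding freq_box_def by (auto intro: order_trans[OF abs_triangle_ineq] add_mono)

text \<open>
  The number \<open>a x\<close> is the value at \<open>x\<close> of the product of \<open>a\<close> with a normalized Dirichlet kernel centred
  at \<open>x\<close>, so that the \<open>L\<^sup>2\<close> estimates above suffice and no kernel bounds in \<open>L\<^sup>p\<close> are needed.
\<close>

lemma trig_poly_sup_le_Lp_norm:
  assumes L: "L > 0" and r: "r > 2" and a: "trig_poly L K a" and K: "K \<subseteq> freq_box M" and M: "M \<ge> 1"
  shows "(norm (a x))\<^sup>2 \<le> 8 * ((real (2 * M + 1) ^ 3 / L ^ 3) powr (2 / r) * (Lp_norm L r a)\<^sup>2)"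
proof -
  define n where "n = real ((2 * M + 1) ^ 3)"
  have n: "n > 0" "n = card (freq_box M)" by (auto simp: n_def card_freq_box)
  define g where "g = tp L (freq_box M) (\<lambda>k. ek L (- k) x / n)"
  have g: "trig_poly L (freq_box M) g" by (simp add: g_def trig_poly_tp)
  have gx: "g x = 1"
    using n(1) unfolding n(2) by (auto simp add: g_def tp_def ek_mult n(2) card_gt_0_iff)
  have sg: "sqn L g = L ^ 3 / n"
    using n by (simp add: g_def sqn_tp[OF L] norm_divide power2_eq_square)
  have ag: "trig_poly L (freq_box (M + M)) (\<lambda>x. a x * g x)"
    by (rule trig_poly_mult[OF trig_poly_mono[OF a K finite_freq_box] g finite_freq_box]) (rule freq_box_add)
  have "(norm (a x))\<^sup>2 = (norm (a x * g x))\<^sup>2" using gx by simp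
  also have "\<dots> \<le> card (freq_box (M + M)) / L ^ 3 * sqn L (\<lambda>x. a x * g x)"
    by (rule trig_poly_sup_le_sqn[OF L ag])
  also have "\<dots> \<le> card (freq_box (M + M)) / L ^ 3 * ((Lp_norm L r a)\<^sup>2 * ((n / L ^ 3) powr (2 / r) * sqn L g))"
    using L n by (intro mult_left_mono sqn_mult_le_bernstein[OF L r a g]) auto
  also have "\<dots> = card (freq_box (M + M)) / n * ((n / L ^ 3) powr (2 / r) * (Lp_norm L r a)\<^sup>2)"
    using L by (simp add: sg)
  also have "\<dots> \<le> 8 * ((n / L ^ 3) powr (2 / r) * (Lp_norm L r a)\<^sup>2)"
  proof (rule mult_right_mono)
    \<comment> \<open>Multiplication by \<open>g\<close> doubles the frequency box, which multiplies
      the number of modes by at most \<open>2 ^ 3 = 8\<close>.\<close>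
    have "(real (4 * M + 1)) ^ 3 \<le> (2 * real (2 * M + 1)) ^ 3" by (intro power_mono) auto
    also have "\<dots> = 8 * n" unfolding power_mult_distrib by (simp add: n_def)
    finally show "card (freq_box (M + M)) / n \<le> 8" using n(1) by (simp add: card_freq_box divide_le_eq)
  qed simp
  finally show ?thesis by (simp add: n_def)
qed

text \<open>For \<open>M \<ge> 1\<close> the side \<open>2 * M + 1\<close> of the box is at most
  \<open>3 * M\<close>; this turns the number of modes into the usual Bernstein power of the
  wavenumber.\<close>

lemma freq_box_bound_powr:
  assumes "L > 0" "r > 0" "M \<ge> 1"
  shows "(real (2 * M + 1) ^ 3 / L ^ 3) powr (2 / r) \<le> ((3 * real M / L) powr (3 / r))\<^sup>2"
proof -
  have "(real (2 * M + 1) ^ 3 / L ^ 3) powr (2 / r) \<le> ((3 * real M / L) ^ 3) powr (2 / r)"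
    using assms unfolding power_divide[symmetric]
    by (intro powr_mono2 power_mono divide_right_mono) auto
  also have "\<dots> = (3 * real M / L) powr (3 * (2 / r))"
  proof -
    have "3 * real M / L > 0" using assms by simp
    then have "(3 * real M / L) ^ 3 = (3 * real M / L) powr 3" by simp
    then show ?thesis by (simp only: powr_powr)
  qed
  also have "\<dots> = ((3 * real M / L) powr (3 / r)) powr 2"
    by (simp add: powr_powr)
  also have "\<dots> = ((3 * real M / L) powr (3 / r))\<^sup>2" by simp
  finally show ?thesis .
qed

lemma bernstein_sup:
  assumes L: "L > 0" and r: "r > 2" and a: "trig_poly L K a" and K: "K \<subseteq> freq_box M" and M: "M \<ge> 1"
  shows "norm (a x) \<le> 3 * ((3 * real M / L) powr (3 / r) * Lp_norm L r a)"
proof -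
  have "(norm (a x))\<^sup>2 \<le> 8 * ((real (2 * M + 1) ^ 3 / L ^ 3) powr (2 / r) * (Lp_norm L r a)\<^sup>2)"
    by (rule trig_poly_sup_le_Lp_norm[OF assms])
  \<comment> \<open>The \<open>8\<close> is rounded up to \<open>9\<close> so that the right-hand
    side is a square.\<close>
  also have "\<dots> \<le> 9 * (((3 * real M / L) powr (3 / r))\<^sup>2 * (Lp_norm L r a)\<^sup>2)"
    using freq_box_bound_powr[OF L _ M, of r] r by (intro mult_mono) auto
  also have "\<dots> = (3 * ((3 * real M / L) powr (3 / r) * Lp_norm L r a))\<^sup>2"
    by (simp add: power_mult_distrib)
  finally show ?thesis by (rule power2_le_imp_le) (simp add: Lp_norm_nonneg)
qed

text \<open>The power of the wavenumber is charged to the spectrum of \<open>g\<close> and not to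
  that of \<open>a\<close>. When \<open>g\<close> has much lower frequencies than \<open>a\<close>,
  this difference is the gain that becomes off-diagonal decay.\<close>

lemma bernstein_mult:
  assumes L: "L > 0" and r: "r > 2" and a: "trig_poly L Ka a" and g: "trig_poly L K g"
    and K: "K \<subseteq> freq_box M" and M: "M \<ge> 1"
  shows "sqrt (sqn L (\<lambda>x. a x * g x)) \<le> (3 * real M / L) powr (3 / r) * Lp_norm L r a * sqrt (sqn L g)"
proof -
  have "real (card K) \<le> real (2 * M + 1) ^ 3"
    using card_mono[OF finite_freq_box K] unfolding card_freq_box of_nat_power[symmetric] of_nat_le_iff .
  from sqn_mult_le_bernstein[OF L r a g this]
  have "sqn L (\<lambda>x. a x * g x) \<le> (Lp_norm L r a)\<^sup>2 * ((real (2 * M + 1) ^ 3 / L ^ 3) powr (2 / r) * sqn L g)"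
    by simp
  also have "\<dots> \<le> (Lp_norm L r a)\<^sup>2 * (((3 * real M / L) powr (3 / r))\<^sup>2 * sqn L g)"
    using freq_box_bound_powr[OF L _ M, of r] r by (intro mult_left_mono mult_right_mono) auto
  also have "\<dots> = ((3 * real M / L) powr (3 / r) * Lp_norm L r a * sqrt (sqn L g))\<^sup>2"
    by (simp add: power_mult_distrib)
  finally show ?thesis by (intro real_le_lsqrt) (simp_all add: Lp_norm_nonneg)
qed

section \<open>The trilinear estimate\<close>

text \<open>Two decompositions are used. The factors \<open>g\<close> and \<open>h\<close> are cut
  into these sharp disjoint blocks, as only their L^2 norms matter; \<open>a\<close> is cut into
  smooth pieces, supported in the overlapping sets \<open>lp_shell\<close>, because its L^r norms
  are controlled for smooth projections only.\<close>

definition dyadic_block :: "nat \<Rightarrow> (int^3) set" where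
  "dyadic_block j = {k. 2 ^ j \<le> norm (freq k) \<and> norm (freq k) < 2 ^ (j + 1)}"

definition lp_shell :: "nat \<Rightarrow> (int^3) set" where
  "lp_shell p = {k. 3 / 4 * 2 ^ p < norm (freq k) \<and> norm (freq k) < 2 ^ (p + 1)}"

lemma ball_subset_freq_box: "norm (freq k) < 2 ^ n \<Longrightarrow> k \<in> freq_box (2 ^ n)"
proof -
  assume a: "norm (freq k) < 2 ^ n"
  have "\<bar>k $ i\<bar> \<le> 2 ^ n" for i
  proof -
    have "real_of_int \<bar>k $ i\<bar> \<le> norm (freq k)"
      using component_le_norm_cart[of "freq k" i] by (simp add: freq_def)
    then have "real_of_int \<bar>k $ i\<bar> < real_of_int (2 ^ n)" using a by simp
    then show ?thesis by linarith
  qed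
  then show ?thesis by (simp add: freq_box_def)
qed

lemma lp_shell_subset: "lp_shell p \<subseteq> freq_box (2 ^ (p + 1))"
  and dyadic_block_subset: "dyadic_block p \<subseteq> freq_box (2 ^ (p + 1))"
  by (auto simp: lp_shell_def dyadic_block_def simp del: power_Suc intro!: ball_subset_freq_box)

lemma finite_lp_shell [simp]: "finite (lp_shell p)"
  and finite_dyadic_block [simp]: "finite (dyadic_block p)"
  using finite_subset[OF lp_shell_subset] finite_subset[OF dyadic_block_subset] by auto

text \<open>Only the zeroth mode of a product contributes to its integral. Combined with the
  triangle inequality, this limits which triples of shells interact.\<close>

lemma integral_triple_zero:
  assumes L: "L > 0" and a: "trig_poly L A a" and g: "trig_poly L G g" and h: "trig_poly L H h"
    and ne: "\<And>k1 k2 k3. k1 \<in> A \<Longrightarrow> k2 \<in> G \<Longrightarrow> k3 \<in> H \<Longrightarrow> k1 + k2 + k3 \<noteq> 0"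
  shows "(LINT x|torus L. a x * (g x * h x)) = 0"
proof -
  let ?J = "(\<lambda>(k, l). k + l) ` (A \<times> G)"
  have ag: "trig_poly L ?J (\<lambda>x. a x * g x)"
    by (rule trig_poly_mult[OF a g]) (use a g in \<open>auto simp: trig_poly_def\<close>)
  have z: "fcc L (\<lambda>x. a x * g x) (- k) = 0" if "k \<in> H" for k
  proof (rule trig_poly_fcc(2)[OF L ag])
    show "- k \<notin> ?J"
    proof
      assume "- k \<in> ?J"
      then obtain k1 k2 where "k1 \<in> A" "k2 \<in> G" "- k = k1 + k2" by auto
      then show False using ne[of k1 k2 k] that by (metis add.left_inverse)
    qed
  qed
  obtain c where c: "h = tp L H c" using h by (auto simp: trig_poly_def)
  have "(LINT x|torus L. a x * (g x * h x)) = (LINT x|torus L. (a x * g x) * tp L H c x)"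
    by (simp add: c mult.assoc)
  also have "\<dots> = 0" using z by (simp add: integral_mult_tp[OF L trig_poly_in_L2[OF ag]])
  finally show ?thesis .
qed

text \<open>The factor 3 from \<open>freq_box_bound_powr\<close> and the factor 2 in the outer
  radius of a shell make 6, and \<open>6 powr e \<le> 36\<close>.\<close>

lemma shell_coefficient:
  assumes "L > 0" and e: "1 < e" "e < 2"
  shows "(3 * real (2 ^ (n + 1)) / L) powr e \<le> 36 * (2 ^ n / L) powr e"
proof -
  have "(3 * real (2 ^ (n + 1)) / L) = 6 * (2 ^ n / L)" by simp
  then have "(3 * real (2 ^ (n + 1)) / L) powr e = 6 powr e * (2 ^ n / L) powr e"
    using assms by (simp only: powr_mult)
  also have "\<dots> \<le> 6 powr 2 * (2 ^ n / L) powr e"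
    using e by (intro mult_right_mono powr_mono) auto
  finally show ?thesis by simp
qed

definition decay :: "real \<Rightarrow> nat \<Rightarrow> nat \<Rightarrow> real" where
  "decay e j l = 2 powr ((1 - e) * \<bar>real j - real l\<bar>)"

lemma decay_pos: "decay e j l > 0"
  by (simp add: decay_def)

text \<open>The exponents agree exactly in the bad case \<open>l < j\<close>, where the derivative
  sits on the smaller block; for \<open>j \<le> l\<close> there is a spare factor
  \<open>2 powr (- (l - j))\<close>.\<close>

lemma decay_le:
  assumes L: "L > 0" and e: "1 < e" "e < 2"
  shows "(2 ^ min j l / L) powr e * (2 ^ max j l / L) powr (1 - e) \<le> 2 ^ l / L * decay e j l"
proof -
  have p: "(2 ^ n / L) powr x = 2 powr (real n * x) * (1 / L) powr x" for n x
    using L by (simp add: powr_mult[symmetric] powr_powr[symmetric] powr_realpow)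
  have "(2 ^ min j l / L) powr e * (2 ^ max j l / L) powr (1 - e)
     = 2 powr (real (min j l) * e + real (max j l) * (1 - e)) * ((1 / L) powr e * (1 / L) powr (1 - e))"
    unfolding p by (simp add: powr_add)
  also have "(1 / L) powr e * (1 / L) powr (1 - e) = 1 / L"
    using L by (simp add: powr_add[symmetric])
  also have "2 powr (real (min j l) * e + real (max j l) * (1 - e)) \<le> 2 powr (real l + (1 - e) * \<bar>real j - real l\<bar>)"
  proof (rule powr_mono)
    show "real (min j l) * e + real (max j l) * (1 - e) \<le> real l + (1 - e) * \<bar>real j - real l\<bar>"
    proof (cases "j \<le> l")
      case True
      then have "real j * e + real l * (1 - e) = real l + (1 - e) * (real l - real j) - (real l - real j)"
        by (simp add: algebra_simps)
      then show ?thesis using True by (simp add: abs_real_def)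
    next
      case False
      then show ?thesis by (simp add: abs_real_def algebra_simps)
    qed
  qed simp
  finally show ?thesis using L by (simp add: powr_add powr_realpow decay_def mult_ac mult_right_mono divide_right_mono)
qed

text \<open>Let \<open>m = max j l\<close>. If \<open>j\<close> and \<open>l\<close> differ by at
  most 1, all \<open>p \<le> m + 2\<close> may interact, and \<open>a\<close> is taken in the sup
  norm. Otherwise the two largest frequencies must be comparable, which forces
  \<open>p \<ge> m - 1\<close>, and Bernstein is charged to the smaller block. The factor
  \<open>2 ^ p / 2 ^ m\<close> makes both cases summable in \<open>p\<close>.\<close>

lemma triad_bound:
  assumes L: "L > 0" and r: "2 < r" "r < 3" and b: "b \<ge> 0"
    and a: "trig_poly L (lp_shell p) a" "Lp_norm L r a \<le> b * (2 ^ p / L) powr (1 - 3 / r)"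
    and g: "trig_poly L G g" "G \<subseteq> dyadic_block j" and h: "trig_poly L H h" "H \<subseteq> dyadic_block l"
  shows "norm (LINT x|torus L. a x * (g x * h x)) \<le>
     (if p \<le> max j l + 2 then 432 * b * (2 ^ p / 2 ^ max j l) * (2 ^ l / L) * decay (3 / r) j l else 0)
       * (sqrt (sqn L g) * sqrt (sqn L h))"
proof -
  define e where "e = 3 / r"
  have e: "1 < e" "e < 3/2" "e < 2" using r by (auto simp: e_def field_simps)
  have tri: "norm (freq k1) \<le> norm (freq k2) + norm (freq k3)" if "k1 + k2 + k3 = 0" for k1 k2 k3
  proof -
    have "k1 = - k2 - k3" using that by (metis add_eq_0_iff2 diff_conv_add_uminus minus_add_distrib add.assoc add.commute neg_eq_iff_add_eq_0)
    then have "freq k1 = - freq k2 - freq k3" by (simp add: freq_diff freq_minus)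
    then show ?thesis using norm_triangle_ineq4[of "- freq k2" "freq k3"] by simp
  qed
  have tri': "norm (freq k1) \<le> norm (freq k2) + norm (freq k3)" "norm (freq k2) \<le> norm (freq k1) + norm (freq k3)"
       "norm (freq k3) \<le> norm (freq k1) + norm (freq k2)" if "k1 + k2 + k3 = 0" for k1 k2 k3
    using tri[of k1 k2 k3] tri[of k2 k1 k3] tri[of k3 k1 k2] that by (auto simp: add_ac)
  define m where "m = max j l"
  have jm: "(2::real) ^ j \<le> 2 ^ m" "(2::real) ^ l \<le> 2 ^ m"
    by (auto simp: m_def intro!: power_increasing)
  define A where "A = sqrt (sqn L g) * sqrt (sqn L h)"
  have A: "A \<ge> 0" by (simp add: A_def)
  have La: "0 \<le> Lp_norm L r a" by (rule Lp_norm_nonneg)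
  show ?thesis
  proof (cases "p \<le> m + 2")
    case False
    \<comment> \<open>With \<open>p \<ge> m + 3\<close> the frequencies of \<open>a\<close> exceed
      \<open>6 * 2 ^ m\<close>, while those of \<open>g\<close> and \<open>h\<close> together stay
      below \<open>4 * 2 ^ m\<close>.\<close>
    have "(LINT x|torus L. a x * (g x * h x)) = 0"
    proof (rule integral_triple_zero[OF L a(1) g(1) h(1)])
      fix k1 k2 k3 assume k: "k1 \<in> lp_shell p" "k2 \<in> G" "k3 \<in> H"
      show "k1 + k2 + k3 \<noteq> 0"
      proof
        assume "k1 + k2 + k3 = 0"
        from tri[OF this] have "3 / 4 * 2 ^ p < 2 ^ (j + 1) + (2::real) ^ (l + 1)"
          using k g(2) h(2) by (force simp: lp_shell_def dyadic_block_def)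
        also have "\<dots> \<le> 4 * 2 ^ m" using jm unfolding power_add power_one_right by linarith
        finally have "3 / 4 * 2 ^ p < 4 * (2::real) ^ m" .
        moreover have "(2::real) ^ (m + 3) \<le> 2 ^ p" using False by (intro power_increasing) auto
        moreover have "(2::real) ^ m > 0" by simp
        ultimately show False unfolding power_add by (simp del: zero_less_power)
      qed
    qed
    then show ?thesis using False by (simp add: m_def)
  next
    case pm: True
    have "norm (LINT x|torus L. a x * (g x * h x)) \<le> 432 * b * (2 ^ p / 2 ^ m) * (2 ^ l / L) * decay e j l * A"
    proof (cases "max j l \<le> min j l + 1")
      case near: True
      \<comment> \<open>\<open>108 = 3 * 36\<close>, from \<open>bernstein_sup\<close> and
        \<open>shell_coefficient\<close>; the exponents \<open>e\<close> and \<open>1 - e\<close> of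
        the wavenumber add up to 1.\<close>
      define S where "S = 108 * b * (2 ^ p / L)"
      have S0: "S \<ge> 0" using b L by (simp add: S_def)
      have aS: "norm (a x) \<le> S" for x
      proof -
        have "norm (a x) \<le> 3 * ((3 * real (2 ^ (p + 1)) / L) powr e * Lp_norm L r a)"
          unfolding e_def by (rule bernstein_sup[OF L r(1) a(1) lp_shell_subset]) simp
        also have "\<dots> \<le> 3 * (36 * (2 ^ p / L) powr e * (b * (2 ^ p / L) powr (1 - e)))"
          using a(2) La shell_coefficient[OF L e(1,3), of p] unfolding e_def[symmetric]
          by (intro mult_left_mono mult_mono) auto
        also have "\<dots> = 108 * b * ((2 ^ p / L) powr e * (2 ^ p / L) powr (1 - e))" by simp
        also have "(2 ^ p / L) powr e * (2 ^ p / L) powr (1 - e) = 2 ^ p / L"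
          using L by (simp add: powr_add[symmetric])
        finally show ?thesis by (simp add: S_def)
      qed
      have ag: "in_L2 L (\<lambda>x. a x * g x)" "sqn L (\<lambda>x. a x * g x) \<le> S\<^sup>2 * sqn L g"
        by (rule in_L2_dominated[OF trig_poly_in_L2[OF g(1)]],
            use trig_poly_measurable[OF a(1)] trig_poly_measurable[OF g(1)] aS in
              \<open>auto simp: norm_mult intro!: AE_I2 mult_right_mono\<close>)+
      have "norm (LINT x|torus L. a x * (g x * h x)) \<le> sqrt (sqn L (\<lambda>x. a x * g x)) * sqrt (sqn L h)"
        using L2_CS[OF ag(1) trig_poly_in_L2[OF h(1)]] by (simp add: mult.assoc)
      also have "\<dots> \<le> sqrt (S\<^sup>2 * sqn L g) * sqrt (sqn L h)"
        using ag(2) by (intro mult_right_mono real_sqrt_le_mono) auto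
      also have "\<dots> = S * A" using S0 by (simp add: real_sqrt_mult A_def)
      also have "\<dots> \<le> 432 * b * (2 ^ p / 2 ^ m) * (2 ^ l / L) * decay e j l * A"
      proof (rule mult_right_mono[OF _ A])
        \<comment> \<open>Replacing \<open>2 ^ m\<close> by \<open>2 ^ l\<close> and inserting
          \<open>decay\<close> cost a factor of at most 2 each, whence
          \<open>432 = 4 * 108\<close>.\<close>
        have "2 ^ m \<le> (2::real) ^ (l + 1)" using near by (intro power_increasing) (auto simp: m_def)
        then have 1: "1 / 2 \<le> (2::real) ^ l / 2 ^ m" by (simp add: field_simps)
        have ab: "\<bar>real j - real l\<bar> \<le> 1" using near by linarith
        have "(1 - e) * \<bar>real j - real l\<bar> \<ge> (1 - e) * 1" using ab e by (intro mult_left_mono_neg) auto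
        moreover have "- 1 \<le> (1 - e) * 1" using e by simp
        ultimately have "- 1 \<le> (1 - e) * \<bar>real j - real l\<bar>" by (rule order_trans[rotated])
        then have "2 powr (- 1) \<le> decay e j l" unfolding decay_def by (rule powr_mono) simp
        then have 2: "1 / 2 \<le> decay e j l" by (simp add: powr_minus)
        have "1 / 2 * (1 / 2) \<le> (2::real) ^ l / 2 ^ m * decay e j l"
          using 1 2 by (intro mult_mono) auto
        then have "S * (4 * (1 / 2 * (1 / 2))) \<le> S * (4 * ((2::real) ^ l / 2 ^ m * decay e j l))"
          using S0 by (intro mult_left_mono) auto
        then show "S \<le> 432 * b * (2 ^ p / 2 ^ m) * (2 ^ l / L) * decay e j l"
          by (simp add: S_def mult_ac)
      qed
      finally show ?thesis .
    next
      case far: False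
      define n where "n = min j l"
      have mn: "n + 2 \<le> m" using far unfolding n_def m_def by linarith
      show ?thesis
      proof (cases "m \<le> p + 1")
        \<comment> \<open>Now \<open>p + 2 \<le> m\<close> and \<open>n + 2 \<le> m\<close>, so the
          two smaller frequencies together stay below \<open>2 ^ m\<close> and cannot balance the
          largest one.\<close>
        case False
        have "(LINT x|torus L. a x * (g x * h x)) = 0"
        proof (rule integral_triple_zero[OF L a(1) g(1) h(1)])
          fix k1 k2 k3 assume k: "k1 \<in> lp_shell p" "k2 \<in> G" "k3 \<in> H"
          show "k1 + k2 + k3 \<noteq> 0"
          proof
            assume z: "k1 + k2 + k3 = 0"
            have k1: "norm (freq k1) < 2 ^ (p + 1)" using k by (auto simp: lp_shell_def)
            have kb: "2 ^ j \<le> norm (freq k2)" "norm (freq k2) < 2 ^ (j + 1)" "2 ^ l \<le> norm (freq k3)" "norm (freq k3) < 2 ^ (l + 1)"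
              using k g(2) h(2) by (auto simp: dyadic_block_def)
            have "2 ^ m < 2 ^ (p + 1) + (2::real) ^ (n + 1)"
            proof (cases "j \<le> l")
              case True
              then have "m = l" "n = j" by (auto simp: m_def n_def)
              then show ?thesis using tri'(3)[OF z] k1 kb by simp
            next
              case False
              then have "m = j" "n = l" by (auto simp: m_def n_def)
              then show ?thesis using tri'(2)[OF z] k1 kb by simp
            qed
            moreover have "(2::real) ^ (p + 2) \<le> 2 ^ m" using False by (intro power_increasing) auto
            moreover have "(2::real) ^ (n + 2) \<le> 2 ^ m" using mn by (intro power_increasing) auto
            ultimately show False by (simp add: power_add)
          qed
        qed
        then show ?thesis using b L A decay_pos[of e j l] by simp
      next
        case True
        \<comment> \<open>The power \<open>e\<close> sits at the smaller block \<open>n\<close> and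
          the power \<open>1 - e\<close> at \<open>p\<close>, where \<open>p \<ge> m - 1\<close>;
          this mismatch is the source of the decay.\<close>
        define S where "S = 36 * (2 ^ n / L) powr e * (b * (2 ^ p / L) powr (1 - e))"
        have S: "(3 * real (2 ^ (n + 1)) / L) powr e * Lp_norm L r a \<le> S"
          unfolding S_def using a(2) La shell_coefficient[OF L e(1,3), of n] unfolding e_def[symmetric]
          by (intro mult_mono) auto
        have al: "in_L2 L (\<lambda>x. a x * f x)" if "trig_poly L F f" for F f
        proof -
          obtain Ba where Ba: "\<And>x. norm (a x) \<le> Ba" using trig_poly_bounded[OF a(1)] by blast
          show ?thesis
            by (rule in_L2_mult_bounded[OF trig_poly_in_L2[OF that] trig_poly_measurable[OF a(1)] Ba])
        qed
        have bm: "sqrt (sqn L (\<lambda>x. a x * f x)) \<le> S * sqrt (sqn L f)" if "trig_poly L F f" "F \<subseteq> dyadic_block n" for F f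
        proof -
          have "sqrt (sqn L (\<lambda>x. a x * f x)) \<le> (3 * real (2 ^ (n + 1)) / L) powr (3 / r) * Lp_norm L r a * sqrt (sqn L f)"
            by (rule bernstein_mult[OF L r(1) a(1) that(1) order_trans[OF that(2) dyadic_block_subset]]) simp
          also have "\<dots> \<le> S * sqrt (sqn L f)"
            using S unfolding e_def by (intro mult_right_mono) auto
          finally show ?thesis .
        qed
        have "norm (LINT x|torus L. a x * (g x * h x)) \<le> S * A"
        proof (cases "j \<le> l")
          case True
          then have n: "n = j" by (simp add: n_def)
          have "norm (LINT x|torus L. (a x * g x) * h x) \<le> sqrt (sqn L (\<lambda>x. a x * g x)) * sqrt (sqn L h)"
            by (rule L2_CS[OF al[OF g(1)] trig_poly_in_L2[OF h(1)]])
          also have "\<dots> \<le> S * sqrt (sqn L g) * sqrt (sqn L h)"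
            using bm[OF g(1)] g(2) n by (intro mult_right_mono) auto
          finally show ?thesis by (simp add: A_def mult.assoc)
        next
          case False
          then have n: "n = l" by (simp add: n_def)
          have "norm (LINT x|torus L. (a x * h x) * g x) \<le> sqrt (sqn L (\<lambda>x. a x * h x)) * sqrt (sqn L g)"
            by (rule L2_CS[OF al[OF h(1)] trig_poly_in_L2[OF g(1)]])
          also have "\<dots> \<le> S * sqrt (sqn L h) * sqrt (sqn L g)"
            using bm[OF h(1)] h(2) n by (intro mult_right_mono) auto
          finally show ?thesis by (simp add: A_def mult_ac)
        qed
        also have "S * A \<le> 432 * b * (2 ^ p / 2 ^ m) * (2 ^ l / L) * decay e j l * A"
        proof (rule mult_right_mono[OF _ A])
          have "(2::real) ^ m \<le> 2 ^ (p + 1)" using True by (intro power_increasing) auto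
          then have p2: "1 / 2 \<le> (2::real) ^ p / 2 ^ m" by (simp add: field_simps)
          \<comment> \<open>The exponent \<open>1 - e\<close> is negative, so the lower bound on
            \<open>p\<close> yields an upper bound; passing from level \<open>m - 1\<close> to
            \<open>m\<close> costs at most 2.\<close>
          have "(2 ^ p / L) powr (1 - e) \<le> ((1 / 2) * (2 ^ m / L)) powr (1 - e)"
            using e L p2 by (intro powr_mono2') (auto simp: field_simps)
          also have "\<dots> = (1 / 2) powr (1 - e) * (2 ^ m / L) powr (1 - e)"
            using L by (intro powr_mult)
          also have "(1 / 2) powr (1 - e) \<le> (1 / 2 :: real) powr (- 1)"
            using e by (intro powr_mono') auto
          also have "(1 / 2 :: real) powr (- 1) = 2" by (simp add: powr_minus)
          finally have "(2 ^ p / L) powr (1 - e) \<le> 2 * (2 ^ m / L) powr (1 - e)" by (simp add: mult_right_mono)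
          then have "S \<le> 36 * (2 ^ n / L) powr e * (b * (2 * (2 ^ m / L) powr (1 - e)))"
            unfolding S_def using b by (intro mult_left_mono) auto
          also have "\<dots> = 72 * b * ((2 ^ n / L) powr e * (2 ^ m / L) powr (1 - e))" by simp
          also have "\<dots> \<le> 72 * b * (2 ^ l / L * decay e j l)"
            unfolding n_def m_def using b by (intro mult_left_mono decay_le L e) auto
          also have "\<dots> = 144 * b * (1 / 2) * (2 ^ l / L * decay e j l)" by simp
          also have "\<dots> \<le> 432 * b * (2 ^ p / 2 ^ m) * (2 ^ l / L * decay e j l)"
            using b L p2 decay_pos[of e j l] by (intro mult_right_mono mult_mono) auto
          finally show "S \<le> 432 * b * (2 ^ p / 2 ^ m) * (2 ^ l / L) * decay e j l" by (simp add: mult.assoc)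
        qed
        finally show ?thesis .
      qed
    qed
    then show ?thesis using pm by (simp add: m_def e_def A_def)
  qed
qed

section \<open>Summation over dyadic blocks and Schur's test\<close>

lemma dyadic_block_exists:
  assumes "1 \<le> norm (freq k)" "norm (freq k) < 2 ^ J"
  shows "\<exists>j<J. k \<in> dyadic_block j"
  using assms(2)
proof (induction J)
  case (Suc J)
  show ?case
  proof (cases "norm (freq k) < 2 ^ J")
    case False
    then show ?thesis using Suc.prems by (intro exI[of _ J]) (auto simp: dyadic_block_def)
  qed (use Suc.IH less_SucI in blast)
qed (use assms(1) in auto)

lemma dyadic_block_disjoint: "j \<noteq> l \<Longrightarrow> dyadic_block j \<inter> dyadic_block l = {}"
proof -
  have *: "dyadic_block j \<inter> dyadic_block l = {}" if "j < l" for j l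
  proof -
    have "(2::real) ^ (j + 1) \<le> 2 ^ l" using that by (intro power_increasing) auto
    then have False if "k \<in> dyadic_block j" "k \<in> dyadic_block l" for k
      using that unfolding dyadic_block_def mem_Collect_eq by linarith
    then show ?thesis by blast
  qed
  show "j \<noteq> l \<Longrightarrow> dyadic_block j \<inter> dyadic_block l = {}"
    using *[of j l] *[of l j] by (auto simp: neq_iff)
qed

lemma sum_dyadic_blocks:
  fixes f :: "int^3 \<Rightarrow> 'b::comm_monoid_add"
  assumes "finite G" "\<And>k. k \<in> G \<Longrightarrow> \<exists>j<J. k \<in> dyadic_block j"
  shows "(\<Sum>k\<in>G. f k) = (\<Sum>j<J. \<Sum>k\<in>G \<inter> dyadic_block j. f k)"
proof -
  have "G = (\<Union>j\<in>{..<J}. G \<inter> dyadic_block j)" using assms(2) by auto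
  then have "(\<Sum>k\<in>G. f k) = sum f (\<Union>j\<in>{..<J}. G \<inter> dyadic_block j)" by simp
  also have "\<dots> = (\<Sum>j<J. \<Sum>k\<in>G \<inter> dyadic_block j. f k)"
    using assms(1) dyadic_block_disjoint by (intro sum.UNION_disjoint) auto
  finally show ?thesis .
qed

lemma sum_geometric_le:
  fixes d :: real
  assumes "0 \<le> d" "d < 1"
  shows "(\<Sum>i<n. d ^ i) \<le> 1 / (1 - d)"
proof -
  have "(\<Sum>i<n. d ^ i) = (1 - d ^ n) / (1 - d)" using assms by (simp add: sum_gp_strict)
  also have "\<dots> \<le> 1 / (1 - d)" using assms by (intro divide_right_mono) auto
  finally show ?thesis .
qed

text \<open>Row sums of the decay kernel: one geometric series on each side of the diagonal, with
  ratio below 1 because \<open>e = 3 / r\<close> exceeds 1.\<close>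

lemma sum_decay_le:
  assumes "1 < e"
  shows "(\<Sum>l<n. decay e j l) \<le> 2 / (1 - 2 powr (1 - e))"
proof -
  define d where "d = 2 powr (1 - e)"
  have d: "0 \<le> d" "d < 1"
    using assms by (auto simp: d_def powr_less_one)
  have dec: "decay e j l = d ^ (if l \<le> j then j - l else l - j)" for l
    by (auto simp: decay_def d_def powr_powr[symmetric] powr_realpow[symmetric] of_nat_diff abs_real_def)
  have "(\<Sum>l<n. decay e j l) \<le> (\<Sum>l<n. (if l \<le> j then d ^ (j - l) else 0) + (if j \<le> l then d ^ (l - j) else 0))"
    unfolding dec using d by (intro sum_mono) auto
  also have "\<dots> = (\<Sum>l\<in>{..<n} \<inter> {..j}. d ^ (j - l)) + (\<Sum>l\<in>{..<n} \<inter> {j..}. d ^ (l - j))"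
    by (simp add: sum.distrib sum.inter_restrict atMost_def atLeast_def)
  also have "(\<Sum>l\<in>{..<n} \<inter> {..j}. d ^ (j - l)) \<le> (\<Sum>l\<in>{..j}. d ^ (j - l))"
    using d by (intro sum_mono2) auto
  also have "\<dots> = (\<Sum>i<Suc j. d ^ i)"
    by (rule sum.reindex_bij_witness[of _ "\<lambda>i. j - i" "\<lambda>l. j - l"]) auto
  also have "\<dots> \<le> 1 / (1 - d)" by (rule sum_geometric_le[OF d])
  also have "(\<Sum>l\<in>{..<n} \<inter> {j..}. d ^ (l - j)) \<le> (\<Sum>l\<in>{j..<j+n}. d ^ (l - j))"
    using d by (intro sum_mono2) auto
  also have "\<dots> = (\<Sum>i<n. d ^ i)"
    by (rule sum.reindex_bij_witness[of _ "\<lambda>i. j + i" "\<lambda>l. l - j"]) auto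
  also have "\<dots> \<le> 1 / (1 - d)" by (rule sum_geometric_le[OF d])
  finally show ?thesis by (simp add: d_def)
qed

lemma decay_commute: "decay e j l = decay e l j"
  by (simp add: decay_def abs_minus_commute)

text \<open>Schur's test: the product \<open>x j * y l\<close> is split into squares, and each
  square is summed against a row of the symmetric kernel.\<close>

lemma schur_decay:
  assumes "1 < e"
  shows "(\<Sum>j<J. \<Sum>l<J. decay e j l * (x j * y l)) \<le> 1 / (1 - 2 powr (1 - e)) * ((\<Sum>j<J. (x j)\<^sup>2) + (\<Sum>l<J. (y l)\<^sup>2))"
proof -
  let ?S = "2 / (1 - 2 powr (1 - e))"
  have "(\<Sum>j<J. \<Sum>l<J. decay e j l * (x j * y l)) \<le> (\<Sum>j<J. \<Sum>l<J. decay e j l * (((x j)\<^sup>2 + (y l)\<^sup>2) / 2))"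
  proof (intro sum_mono mult_left_mono)
    show "x j * y l \<le> ((x j)\<^sup>2 + (y l)\<^sup>2) / 2" for j l
      using sum_squares_bound[of "x j" "y l"] by (simp add: field_simps)
  qed (simp add: decay_pos less_imp_le)
  also have "\<dots> = (\<Sum>j<J. \<Sum>l<J. decay e j l * (x j)\<^sup>2) / 2 + (\<Sum>l<J. \<Sum>j<J. decay e l j * (y l)\<^sup>2) / 2"
    by (subst (3) sum.swap) (simp add: sum.distrib[symmetric] sum_divide_distrib distrib_left add_divide_distrib decay_commute)
  also have "\<dots> = (\<Sum>j<J. (\<Sum>l<J. decay e j l) * (x j)\<^sup>2) / 2 + (\<Sum>l<J. (\<Sum>j<J. decay e l j) * (y l)\<^sup>2) / 2"
    by (simp add: sum_distrib_right)
  also have "\<dots> \<le> (\<Sum>j<J. ?S * (x j)\<^sup>2) / 2 + (\<Sum>l<J. ?S * (y l)\<^sup>2) / 2"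
    by (intro add_mono divide_right_mono sum_mono mult_right_mono sum_decay_le assms) auto
  also have "\<dots> = 1 / (1 - 2 powr (1 - e)) * ((\<Sum>j<J. (x j)\<^sup>2) + (\<Sum>l<J. (y l)\<^sup>2))"
  proof -
    have "2 / D * A / 2 + 2 / D * B / 2 = 1 / D * (A + B)" for D A B :: real
      by (simp add: add_divide_distrib)
    then show ?thesis unfolding sum_distrib_left[symmetric] .
  qed
  finally show ?thesis .
qed

text \<open>\<open>3456 = 432 * 8\<close> is the constant of a triad times the sum over
  \<open>p\<close>; one more unit pays for the low modes, since the denominator is less than 1. The
  denominator comes from Schur's test.\<close>

definition trilinear_const :: "real \<Rightarrow> real" where
  "trilinear_const r = 3457 / (1 - 2 powr (1 - 3 / r))"

lemma trilinear_const_pos: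
  assumes "2 < r" "r < 3" shows "trilinear_const r > 0"
proof -
  have "3 / r > 1" using assms by (simp add: field_simps)
  then have "2 powr (1 - 3 / r) < 1" by (simp add: powr_less_one)
  then show ?thesis by (simp add: trilinear_const_def)
qed

text \<open>For fixed blocks the bounds of \<open>triad_bound\<close> grow like \<open>2 ^ p\<close>
  and stop at \<open>p = max j l + 2\<close>, so their sum over \<open>p\<close> is controlled by
  the top term, uniformly in \<open>P\<close>. What remains is the decay kernel with one derivative
  on \<open>h\<close>, to which Schur's test applies.\<close>

lemma high_part_bound:
  assumes L: "L > 0" and r: "2 < r" "r < 3" and b: "b \<ge> 0"
    and a: "\<And>p. q < p \<Longrightarrow> trig_poly L (lp_shell p) (a p)"
      "\<And>p. q < p \<Longrightarrow> Lp_norm L r (a p) \<le> b * (2 ^ p / L) powr (1 - 3 / r)"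
    and g: "trig_poly L G g" "\<And>k. k \<in> G \<Longrightarrow> 1 \<le> norm (freq k)"
    and h: "trig_poly L H h" "\<And>k. k \<in> H \<Longrightarrow> 1 \<le> norm (freq k)"
  shows "(\<Sum>p\<in>{q<..P}. norm (LINT x|torus L. a p x * (g x * h x))) \<le>
     3456 / (1 - 2 powr (1 - 3 / r)) * b * (sqn L g + L ^ 3 * (\<Sum>k\<in>H. (norm (freq k) / L)\<^sup>2 * (norm (fcc L h k))\<^sup>2))"
proof -
  define e where "e = 3 / r"
  have e: "1 < e" using r by (auto simp: e_def field_simps)
  have fin: "finite G" "finite H" using g(1) h(1) by (auto simp: trig_poly_def)
  have "bounded ((\<lambda>k. norm (freq k)) ` (G \<union> H))" using fin by (intro finite_imp_bounded) auto
  then obtain B where B: "\<And>k. k \<in> G \<union> H \<Longrightarrow> norm (freq k) \<le> B" unfolding bounded_iff by (auto simp: real_norm_def)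
  obtain J :: nat where "B < 2 ^ J" using real_arch_pow[of 2 B] by auto
  then have J: "\<And>k. k \<in> G \<Longrightarrow> \<exists>j<J. k \<in> dyadic_block j" "\<And>k. k \<in> H \<Longrightarrow> \<exists>j<J. k \<in> dyadic_block j"
    using B g(2) h(2) by (meson UnI1 UnI2 dyadic_block_exists le_less_trans)+
  define gj where "gj j = tp L (G \<inter> dyadic_block j) (fcc L g)" for j
  define hj where "hj j = tp L (H \<inter> dyadic_block j) (fcc L h)" for j
  have tgj: "trig_poly L (G \<inter> dyadic_block j) (gj j)" and thj: "trig_poly L (H \<inter> dyadic_block j) (hj j)" for j
    unfolding gj_def hj_def by (auto intro!: trig_poly_tp)
  have gsum: "g x = (\<Sum>j<J. gj j x)" for x
    by (subst trig_poly_fcc(1)[OF L g(1)]) (simp add: tp_def gj_def sum_dyadic_blocks[OF fin(1) J(1)])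
  have hsum: "h x = (\<Sum>j<J. hj j x)" for x
    by (subst trig_poly_fcc(1)[OF L h(1)]) (simp add: tp_def hj_def sum_dyadic_blocks[OF fin(2) J(2)])
  define X where "X j = sqrt (sqn L (gj j))" for j
  define Z where "Z l = sqrt (sqn L (hj l))" for l
  have XZ: "X j \<ge> 0" "Z j \<ge> 0" for j by (auto simp: X_def Z_def)
  define w where "w j l = 2 ^ l / L * decay e j l * (X j * Z l)" for j l
  have w: "w j l \<ge> 0" for j l using L XZ decay_pos[of e j l] by (simp add: w_def)
  define T where "T p j l = (if p \<le> max j l + 2 then 432 * b * (2 ^ p / 2 ^ max j l) * w j l else 0)" for p j l
  have int: "integrable (torus L) (\<lambda>x. a p x * (gj j x * hj l x))" if p: "q < p" for p j l
  proof -
    obtain Ba where Ba: "\<And>x. norm (a p x) \<le> Ba" using trig_poly_bounded[OF a(1)[OF p]] by blast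
    have "in_L2 L (\<lambda>x. a p x * gj j x)"
      by (rule in_L2_mult_bounded[OF trig_poly_in_L2[OF tgj] trig_poly_measurable[OF a(1)[OF p]] Ba])
    from in_L2_integrable_mult[OF this trig_poly_in_L2[OF thj]] show ?thesis by (simp add: mult.assoc)
  qed
  have Tb: "norm (LINT x|torus L. a p x * (g x * h x)) \<le> (\<Sum>j<J. \<Sum>l<J. T p j l)" if p: "q < p" for p
  proof -
    have "a p x * (g x * h x) = (\<Sum>j<J. \<Sum>l<J. a p x * (gj j x * hj l x))" for x
      unfolding gsum[of x] hsum[of x] sum_product by (simp only: sum_distrib_left)
    then have "(LINT x|torus L. a p x * (g x * h x)) = (LINT x|torus L. (\<Sum>j<J. \<Sum>l<J. a p x * (gj j x * hj l x)))"
      by simp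
    also have "\<dots> = (\<Sum>j<J. \<Sum>l<J. LINT x|torus L. a p x * (gj j x * hj l x))"
      using int[OF p] by (simp add: Bochner_Integration.integral_sum Bochner_Integration.integrable_sum)
    finally have "norm (LINT x|torus L. a p x * (g x * h x)) \<le> (\<Sum>j<J. \<Sum>l<J. norm (LINT x|torus L. a p x * (gj j x * hj l x)))"
      by (simp only:) (intro order_trans[OF norm_sum] sum_mono order_refl)
    also have "\<dots> \<le> (\<Sum>j<J. \<Sum>l<J. T p j l)"
    proof (intro sum_mono)
      fix j l
      have "norm (LINT x|torus L. a p x * (gj j x * hj l x)) \<le>
        (if p \<le> max j l + 2 then 432 * b * (2 ^ p / 2 ^ max j l) * (2 ^ l / L) * decay (3 / r) j l else 0)
       * (sqrt (sqn L (gj j)) * sqrt (sqn L (hj l)))"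
        by (rule triad_bound[OF L r b a(1)[OF p] a(2)[OF p] tgj _ thj]) auto
      also have "\<dots> = T p j l"
        by (simp add: T_def w_def X_def Z_def e_def)
      finally show "norm (LINT x|torus L. a p x * (gj j x * hj l x)) \<le> T p j l" .
    qed
    finally show ?thesis .
  qed
  \<comment> \<open>The sum of \<open>2 ^ p\<close> over \<open>p < m + 3\<close> is below
    \<open>8 * 2 ^ m\<close>.\<close>
  have Tp: "(\<Sum>p\<in>{q<..P}. T p j l) \<le> 3456 * b * w j l" for j l
  proof -
    define m where "m = max j l"
    have "(\<Sum>p\<in>{q<..P}. T p j l) \<le> (\<Sum>p\<in>{q<..P} \<inter> {..<m + 3}. 432 * b * (2 ^ p / 2 ^ m) * w j l)"
      unfolding T_def m_def[symmetric] by (subst sum.inter_restrict) (auto intro!: sum_mono)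
    also have "\<dots> \<le> (\<Sum>p<m + 3. 432 * b * (2 ^ p / 2 ^ m) * w j l)"
      using b w by (intro sum_mono2) auto
    also have "\<dots> = 432 * b * w j l * ((\<Sum>p<m + 3. 2 ^ p) / 2 ^ m)"
      by (simp add: sum_distrib_left sum_distrib_right sum_divide_distrib mult_ac del: sum.lessThan_Suc)
    also have "\<dots> \<le> 432 * b * w j l * 8"
    proof (rule mult_left_mono)
      have "(\<Sum>p<m + 3. (2::real) ^ p) = 2 ^ (m + 3) - 1" by (simp add: sum_gp_strict del: sum.lessThan_Suc)
      also have "\<dots> \<le> 8 * 2 ^ m" unfolding power_add by simp
      finally show "(\<Sum>p<m + 3. (2::real) ^ p) / 2 ^ m \<le> 8" by (simp add: divide_le_eq)
    qed (use b w in simp)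
    finally show ?thesis by simp
  qed
  have "(\<Sum>p\<in>{q<..P}. norm (LINT x|torus L. a p x * (g x * h x))) \<le> (\<Sum>p\<in>{q<..P}. \<Sum>j<J. \<Sum>l<J. T p j l)"
    by (rule sum_mono) (use Tb in auto)
  also have "\<dots> = (\<Sum>j<J. \<Sum>p\<in>{q<..P}. \<Sum>l<J. T p j l)" by (rule sum.swap)
  also have "\<dots> = (\<Sum>j<J. \<Sum>l<J. \<Sum>p\<in>{q<..P}. T p j l)" by (intro sum.cong sum.swap refl)
  also have "\<dots> \<le> (\<Sum>j<J. \<Sum>l<J. 3456 * b * w j l)" by (intro sum_mono Tp)
  also have "\<dots> = 3456 * b * (\<Sum>j<J. \<Sum>l<J. decay e j l * (X j * (2 ^ l / L * Z l)))"
    by (simp add: w_def sum_distrib_left mult_ac)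
  also have "\<dots> \<le> 3456 * b * (1 / (1 - 2 powr (1 - e)) * ((\<Sum>j<J. (X j)\<^sup>2) + (\<Sum>l<J. (2 ^ l / L * Z l)\<^sup>2)))"
    using b by (intro mult_left_mono schur_decay e) auto
  also have "\<dots> \<le> 3456 * b * (1 / (1 - 2 powr (1 - e)) * (sqn L g + L ^ 3 * (\<Sum>k\<in>H. (norm (freq k) / L)\<^sup>2 * (norm (fcc L h k))\<^sup>2)))"
  proof (intro mult_left_mono add_mono)
    have X2: "(X j)\<^sup>2 = L ^ 3 * (\<Sum>k\<in>G \<inter> dyadic_block j. (norm (fcc L g k))\<^sup>2)" for j
    proof -
      have "(X j)\<^sup>2 = sqn L (gj j)" by (simp add: X_def)
      then show ?thesis unfolding gj_def by (subst (asm) sqn_tp[OF L]) auto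
    qed
    have "(\<Sum>j<J. (X j)\<^sup>2) = L ^ 3 * (\<Sum>j<J. \<Sum>k\<in>G \<inter> dyadic_block j. (norm (fcc L g k))\<^sup>2)"
      unfolding X2 by (simp only: sum_distrib_left)
    also have "\<dots> = L ^ 3 * (\<Sum>k\<in>G. (norm (fcc L g k))\<^sup>2)"
      by (simp only: sum_dyadic_blocks[OF fin(1) J(1)])
    also have "\<dots> = sqn L g"
      using sqn_tp[OF L fin(1), of "fcc L g"] trig_poly_fcc(1)[OF L g(1)] by simp
    finally show "(\<Sum>j<J. (X j)\<^sup>2) \<le> sqn L g" by simp
    have Z2: "(2 ^ l / L * Z l)\<^sup>2 = L ^ 3 * (\<Sum>k\<in>H \<inter> dyadic_block l. (2 ^ l / L)\<^sup>2 * (norm (fcc L h k))\<^sup>2)" for l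
    proof -
      have "(2 ^ l / L * Z l)\<^sup>2 = (2 ^ l / L)\<^sup>2 * sqn L (hj l)"
        unfolding power_mult_distrib by (simp add: Z_def)
      then show ?thesis unfolding hj_def
        by (subst (asm) sqn_tp[OF L]) (auto simp: sum_distrib_left mult_ac)
    qed
    have "(\<Sum>l<J. (2 ^ l / L * Z l)\<^sup>2) = (\<Sum>l<J. L ^ 3 * (\<Sum>k\<in>H \<inter> dyadic_block l. (2 ^ l / L)\<^sup>2 * (norm (fcc L h k))\<^sup>2))"
      by (simp only: Z2)
    also have "\<dots> \<le> (\<Sum>l<J. L ^ 3 * (\<Sum>k\<in>H \<inter> dyadic_block l. (norm (freq k) / L)\<^sup>2 * (norm (fcc L h k))\<^sup>2))"
      using L by (intro sum_mono mult_left_mono mult_right_mono power_mono divide_right_mono)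
         (auto simp: dyadic_block_def)
    also have "\<dots> = L ^ 3 * (\<Sum>k\<in>H. (norm (freq k) / L)\<^sup>2 * (norm (fcc L h k))\<^sup>2)"
      by (simp only: sum_dyadic_blocks[OF fin(2) J(2)] sum_distrib_left)
    finally show "(\<Sum>l<J. (2 ^ l / L * Z l)\<^sup>2) \<le> L ^ 3 * (\<Sum>k\<in>H. (norm (freq k) / L)\<^sup>2 * (norm (fcc L h k))\<^sup>2)" .
    have "2 powr (1 - e) < 1" using e by (simp add: powr_less_one)
    then show "0 \<le> 1 / (1 - 2 powr (1 - e))" by simp
  qed (use b in simp)
  finally show ?thesis by (simp add: e_def mult_ac)
qed

text \<open>The low part \<open>f\<close> is known only through its sup bound, whose factor
  \<open>2 ^ q / L\<close> amounts to a derivative at frequency \<open>2 ^ q\<close>. As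
  \<open>h\<close> has no modes below \<open>2 ^ q\<close>, this factor is absorbed into the
  derivative of \<open>h\<close>; the pieces above \<open>q\<close> are covered by
  \<open>high_part_bound\<close>.\<close>

theorem trilinear_estimate:
  assumes L: "L > 0" and r: "2 < r" "r < 3" and b: "b \<ge> 0"
    and low: "f \<in> borel_measurable (torus L)" "AE x in torus L. norm (f x) \<le> b * (2 ^ q / L)"
    and a: "\<And>p. q < p \<Longrightarrow> trig_poly L (lp_shell p) (a p)"
      "\<And>p. q < p \<Longrightarrow> Lp_norm L r (a p) \<le> b * (2 ^ p / L) powr (1 - 3 / r)"
    and g: "trig_poly L G g" "\<And>k. k \<in> G \<Longrightarrow> 2 ^ q \<le> norm (freq k)"
    and h: "trig_poly L H h" "\<And>k. k \<in> H \<Longrightarrow> 2 ^ q \<le> norm (freq k)"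
  shows "norm (LINT x|torus L. (f x + (\<Sum>p\<in>{q<..P}. a p x)) * (g x * h x)) \<le>
     trilinear_const r * b * (sqn L g + L ^ 3 * (\<Sum>k\<in>H. (norm (freq k) / L)\<^sup>2 * (norm (fcc L h k))\<^sup>2))"
proof -
  let ?D = "L ^ 3 * (\<Sum>k\<in>H. (norm (freq k) / L)\<^sup>2 * (norm (fcc L h k))\<^sup>2)"
  let ?d = "2 powr (1 - 3 / r)"
  have D: "?D \<ge> 0" using L by (intro mult_nonneg_nonneg sum_nonneg) auto
  have q1: "(1::real) \<le> 2 ^ q" by simp
  have g2: "in_L2 L g" and h2: "in_L2 L h" using trig_poly_in_L2 g(1) h(1) by auto
  let ?c = "b * (2 ^ q / L)"
  have fg: "in_L2 L (\<lambda>x. f x * g x)" "sqn L (\<lambda>x. f x * g x) \<le> ?c\<^sup>2 * sqn L g"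
  proof -
    have m: "(\<lambda>x. f x * g x) \<in> borel_measurable (torus L)"
      using low(1) in_L2_measurable[OF g2] by simp
    have ae: "AE x in torus L. norm (f x * g x) \<le> ?c * norm (g x)"
      using low(2) by eventually_elim (simp only: norm_mult mult_right_mono norm_ge_zero)
    show "in_L2 L (\<lambda>x. f x * g x)" "sqn L (\<lambda>x. f x * g x) \<le> ?c\<^sup>2 * sqn L g"
      by (rule in_L2_dominated[OF g2 m ae])+
  qed
  have hD: "(2 ^ q / L)\<^sup>2 * sqn L h \<le> ?D"
  proof -
    have fin: "finite H" using h(1) by (auto simp: trig_poly_def)
    have "(2 ^ q / L)\<^sup>2 * sqn L h = L ^ 3 * (\<Sum>k\<in>H. (2 ^ q / L)\<^sup>2 * (norm (fcc L h k))\<^sup>2)"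
      using sqn_tp[OF L fin, of "fcc L h"] trig_poly_fcc(1)[OF L h(1)] by (simp add: sum_distrib_left mult_ac)
    also have "\<dots> \<le> ?D"
      using L h(2) by (intro mult_left_mono sum_mono mult_right_mono power_mono divide_right_mono) auto
    finally show ?thesis .
  qed
  have lowb: "norm (LINT x|torus L. f x * (g x * h x)) \<le> b * (sqn L g + ?D)"
  proof -
    have "norm (LINT x|torus L. f x * g x * h x) \<le> sqrt (sqn L (\<lambda>x. f x * g x)) * sqrt (sqn L h)"
      by (rule L2_CS[OF fg(1) h2])
    also have "\<dots> \<le> sqrt (?c\<^sup>2 * sqn L g) * sqrt (sqn L h)"
      using fg(2) by (intro mult_right_mono real_sqrt_le_mono) auto
    also have "\<dots> = b * (sqrt (sqn L g) * sqrt ((2 ^ q / L)\<^sup>2 * sqn L h))"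
      using b L by (simp add: real_sqrt_mult)
    also have "\<dots> \<le> b * (sqrt (sqn L g) * sqrt ?D)"
      using hD b by (intro mult_left_mono real_sqrt_le_mono) auto
    also have "\<dots> \<le> b * (sqn L g + ?D)"
    proof (rule mult_left_mono[OF _ b])
      have "2 * sqrt (sqn L g) * sqrt ?D \<le> (sqrt (sqn L g))\<^sup>2 + (sqrt ?D)\<^sup>2" by (rule sum_squares_bound)
      also have "\<dots> = sqn L g + ?D" using D by simp
      finally have "2 * (sqrt (sqn L g) * sqrt ?D) \<le> sqn L g + ?D" by simp
      moreover have "0 \<le> sqrt (sqn L g) * sqrt ?D" using D by simp
      ultimately show "sqrt (sqn L g) * sqrt ?D \<le> sqn L g + ?D" by linarith
    qed
    finally show ?thesis by (simp add: mult.assoc)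
  qed
  have if': "integrable (torus L) (\<lambda>x. f x * (g x * h x))"
    using in_L2_integrable_mult[OF fg(1) h2] by (simp add: mult.assoc)
  have ia: "integrable (torus L) (\<lambda>x. a p x * (g x * h x))" if p: "q < p" for p
  proof -
    obtain Ba where Ba: "\<And>x. norm (a p x) \<le> Ba" using trig_poly_bounded[OF a(1)[OF p]] by blast
    have "in_L2 L (\<lambda>x. a p x * g x)"
      by (rule in_L2_mult_bounded[OF g2 trig_poly_measurable[OF a(1)[OF p]] Ba])
    from in_L2_integrable_mult[OF this h2] show ?thesis by (simp add: mult.assoc)
  qed
  have "(LINT x|torus L. (f x + (\<Sum>p\<in>{q<..P}. a p x)) * (g x * h x))
      = (LINT x|torus L. f x * (g x * h x) + (\<Sum>p\<in>{q<..P}. a p x * (g x * h x)))"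
    by (simp only: distrib_right sum_distrib_right)
  also have "\<dots> = (LINT x|torus L. f x * (g x * h x)) + (\<Sum>p\<in>{q<..P}. LINT x|torus L. a p x * (g x * h x))"
    using ia if' by (subst Bochner_Integration.integral_add)
       (auto intro!: Bochner_Integration.integrable_sum Bochner_Integration.integral_sum)
  finally have eq: "(LINT x|torus L. (f x + (\<Sum>p\<in>{q<..P}. a p x)) * (g x * h x))
      = (LINT x|torus L. f x * (g x * h x)) + (\<Sum>p\<in>{q<..P}. LINT x|torus L. a p x * (g x * h x))" .
  have "norm (LINT x|torus L. (f x + (\<Sum>p\<in>{q<..P}. a p x)) * (g x * h x))
      \<le> norm (LINT x|torus L. f x * (g x * h x)) + (\<Sum>p\<in>{q<..P}. norm (LINT x|torus L. a p x * (g x * h x)))"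
    unfolding eq by (rule order_trans[OF norm_triangle_ineq add_left_mono[OF norm_sum]])
  also have "\<dots> \<le> b * (sqn L g + ?D) + 3456 / (1 - ?d) * b * (sqn L g + ?D)"
    by (intro add_mono lowb high_part_bound[OF L r b a g(1) _ h(1)])
       (simp_all add: order_trans[OF q1 g(2)] order_trans[OF q1 h(2)])
  also have "\<dots> = (1 + 3456 / (1 - ?d)) * (b * (sqn L g + ?D))" by (simp add: algebra_simps)
  also have "\<dots> \<le> trilinear_const r * (b * (sqn L g + ?D))"
  proof (rule mult_right_mono)
    have "3 / r > 1" using r by (simp add: field_simps)
    then have "?d < 1" "0 < ?d" by (simp_all add: powr_less_one)
    then show "1 + 3456 / (1 - ?d) \<le> trilinear_const r" by (simp add: trilinear_const_def field_simps)
    show "0 \<le> b * (sqn L g + ?D)" using b D by simp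
  qed
  finally show ?thesis by (simp add: mult.assoc)
qed

section \<open>Fourier coefficients of weak derivatives\<close>

lemma trig_has_derivative:
  assumes "bounded_linear l"
  shows "((\<lambda>x. cos (l x) *\<^sub>R a + sin (l x) *\<^sub>R b) has_derivative
     (\<lambda>v. cos (l x) *\<^sub>R (l v *\<^sub>R b) + sin (l x) *\<^sub>R (- l v *\<^sub>R a))) (at x within S)"
  by (rule has_derivative_eq_rhs,
      (rule derivative_intros bounded_linear_imp_has_derivative[OF assms] | simp)+)
     (simp add: fun_eq_iff algebra_simps)

text \<open>Directional derivatives stay in the family, with new coefficients
  \<open>l v *\<^sub>R b\<close> and \<open>- l v *\<^sub>R a\<close>, so the induction has to run
  over all \<open>a\<close> and \<open>b\<close>.\<close>

lemma Ck_on_trig: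
  assumes l: "bounded_linear l"
  shows "Ck_on n S (\<lambda>x. cos (l x) *\<^sub>R a + sin (l x) *\<^sub>R b)"
proof (induction n arbitrary: a b)
  case 0
  show ?case unfolding Ck_on.simps by (intro continuous_intros linear_continuous_on[OF l])
next
  case (Suc n)
  show ?case unfolding Ck_on.simps
    by (intro exI[of _ "\<lambda>x v. cos (l x) *\<^sub>R (l v *\<^sub>R b) + sin (l x) *\<^sub>R (- l v *\<^sub>R a)"] conjI ballI allI
        trig_has_derivative[OF l] Suc.IH)
qed

definition phase :: "real \<Rightarrow> int^3 \<Rightarrow> real^3 \<Rightarrow> real" where
  "phase L k x = 2 * pi / L * (freq k \<bullet> x)"

lemma bounded_linear_phase: "bounded_linear (phase L k)"
  unfolding phase_def
  by (intro bounded_linear_const_mult bounded_linear_inner_right)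

lemma ek_phase: "ek L k x = cis (phase L k x)"
  by (simp add: ek_def phase_def)

lemma phase_axis: "phase L k (axis j 1) = 2 * pi / L * of_int (k $ j)"
  by (simp add: phase_def inner_axis freq_def)

lemma periodic_phase:
  assumes "L > 0"
  shows "cos (phase L k (x + L *\<^sub>R axis i 1)) = cos (phase L k x)"
    and "sin (phase L k (x + L *\<^sub>R axis i 1)) = sin (phase L k x)"
proof -
  have "phase L k (x + L *\<^sub>R axis i 1) = phase L k x + 2 * pi * of_int (k $ i)"
    using assms by (simp add: phase_def inner_add_right inner_axis freq_def field_simps)
  then show "cos (phase L k (x + L *\<^sub>R axis i 1)) = cos (phase L k x)"
    and "sin (phase L k (x + L *\<^sub>R axis i 1)) = sin (phase L k x)"
    by (simp_all only: cos_add sin_add cos_int_2pin sin_int_2pin)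
qed

text \<open>Test functions are real, so a complex mode is split: against a real field, the
  coefficient pairs \<open>(e, 0)\<close> and \<open>(0, e)\<close> yield the real part and minus
  the imaginary part of a Fourier coefficient (\<open>L2_inner_trig\<close>).\<close>

definition trig :: "real \<Rightarrow> int^3 \<Rightarrow> 'b::real_normed_vector \<Rightarrow> 'b \<Rightarrow> real^3 \<Rightarrow> 'b" where
  "trig L k a b x = cos (phase L k x) *\<^sub>R a + sin (phase L k x) *\<^sub>R b"

lemma smooth_trig: "smooth_on S (trig L k a b)"
  unfolding smooth_on_def trig_def using Ck_on_trig[OF bounded_linear_phase] by blast

lemma periodic_trig: "L > 0 \<Longrightarrow> periodic L (trig L k a b)"
  by (simp add: periodic_def trig_def periodic_phase)

lemma trig_derivative:
  "frechet_derivative (trig L k a b) (at x) = (\<lambda>v. phase L k v *\<^sub>R trig L k b (- a) x)"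
proof -
  have "(trig L k a b has_derivative (\<lambda>v. phase L k v *\<^sub>R trig L k b (- a) x)) (at x)"
    using trig_has_derivative[OF bounded_linear_phase, of L k a b x UNIV]
    by (simp add: trig_def[abs_def] scaleR_diff_right mult.commute)
  then show ?thesis by (rule frechet_derivative_at[symmetric])
qed

lemma grad_trig: "grad (trig L k a b) x $ j = 2 * pi / L * of_int (k $ j) * trig L k b (- a) x"
  unfolding grad_def trig_derivative by (simp only: vec_lambda_beta phase_axis real_scaleR_def)

abbreviation coord :: "(real^3 \<Rightarrow> real^3) \<Rightarrow> 3 \<Rightarrow> real^3 \<Rightarrow> complex" where
  "coord g i \<equiv> \<lambda>x. of_real (g x $ i)"

abbreviation mcoord :: "(real^3 \<Rightarrow> real^3^3) \<Rightarrow> 3 \<Rightarrow> 3 \<Rightarrow> real^3 \<Rightarrow> complex" where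
  "mcoord G i j \<equiv> \<lambda>x. of_real (G x $ i $ j)"

lemma bounded_linear_of_real_nth: "bounded_linear (\<lambda>z. complex_of_real (z $ i))" for i :: 3
  by (rule bounded_linear_compose[OF bounded_linear_of_real bounded_linear_vec_nth])

lemma bounded_linear_of_real_nth2: "bounded_linear (\<lambda>z. complex_of_real (z $ i $ j))" for i j :: 3
  by (rule bounded_linear_compose[OF bounded_linear_of_real
        bounded_linear_compose[OF bounded_linear_vec_nth bounded_linear_vec_nth]])

lemma in_L2_coord: "in_L2 L g \<Longrightarrow> in_L2 L (coord g i)"
  by (rule in_L2_linear_image[OF _ bounded_linear_of_real_nth])

lemma in_L2_mcoord: "in_L2 L G \<Longrightarrow> in_L2 L (mcoord G i j)"
  by (rule in_L2_linear_image[OF _ bounded_linear_of_real_nth2])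

lemma in_L2_coord_integrable:
  fixes g :: "real^3 \<Rightarrow> real^3"
  assumes "in_L2 L g" shows "integrable (torus L) (\<lambda>x. g x $ i)"
  using integrable_Re[OF in_L2_integrable[OF in_L2_coord[OF assms, of i]]] by simp

lemma in_L2_mcoord_integrable:
  fixes G :: "real^3 \<Rightarrow> real^3^3"
  assumes "in_L2 L G" shows "integrable (torus L) (\<lambda>x. G x $ i $ j)"
  using integrable_Re[OF in_L2_integrable[OF in_L2_mcoord[OF assms, of i j]]] by simp

lemma fcc_trig:
  fixes g :: "real^3 \<Rightarrow> real"
  assumes L: "L > 0" and g: "integrable (torus L) g"
  shows "of_real (L ^ 3) * fcc L (\<lambda>x. of_real (g x)) k =
     Complex (LINT x|torus L. g x * cos (phase L k x)) (- (LINT x|torus L. g x * sin (phase L k x)))"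
proof -
  have i: "integrable (torus L) (\<lambda>x. of_real (g x) * ek L (- k) x)"
    by (rule Bochner_Integration.integrable_bound[OF g])
       (use g measurable_ek[of L "- k"] in \<open>auto simp: norm_mult intro!: borel_measurable_times borel_measurable_of_real\<close>)
  have e: "of_real (g x) * ek L (- k) x = Complex (g x * cos (phase L k x)) (- (g x * sin (phase L k x)))" for x
    by (simp add: ek_phase phase_def freq_minus complex_eq_iff)
  have "of_real (L ^ 3) * fcc L (\<lambda>x. of_real (g x)) k = (LINT x|torus L. of_real (g x) * ek L (- k) x)"
    using L by (simp add: fcc_def)
  also have "\<dots> = Complex (LINT x|torus L. Re (of_real (g x) * ek L (- k) x)) (LINT x|torus L. Im (of_real (g x) * ek L (- k) x))"
    using i by (simp only: complex_eq_iff integral_Re integral_Im complex.sel)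
  finally show ?thesis unfolding e by simp
qed

text \<open>The weak gradient is tested with cosine and sine; differentiation exchanges the two,
  which in complex notation is multiplication by the imaginary unit.\<close>

lemma fcc_weak_grad:
  assumes L: "L > 0" and g: "in_L2 L g" and G: "has_weak_grad L g G"
  shows "fcc L (mcoord G i j) k = \<i> * of_real (2 * pi / L * of_int (k $ j)) * fcc L (coord g i) k"
proof -
  let ?K = "2 * pi / L * of_int (k $ j)"
  have G2: "in_L2 L G" using G by (simp add: has_weak_grad_def)
  have *: "?K * (LINT x|torus L. g x $ i * trig L k b (- a) x) = - (LINT x|torus L. G x $ i $ j * trig L k a b x)" for a b
  proof -
    have "(LINT x|torus L. g x $ i * grad (trig L k a b) x $ j) = - (LINT x|torus L. G x $ i $ j * trig L k a b x)"
      using G periodic_trig[OF L] smooth_trig unfolding has_weak_grad_def by blast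
    moreover have "(LINT x|torus L. g x $ i * grad (trig L k a b) x $ j) = (LINT x|torus L. ?K * (g x $ i * trig L k b (- a) x))"
      by (simp only: grad_trig mult_ac)
    ultimately show ?thesis by (simp only: integral_mult_right_zero)
  qed
  have c: "?K * (LINT x|torus L. g x $ i * sin (phase L k x)) = (LINT x|torus L. G x $ i $ j * cos (phase L k x))"
    using *[of 0 1] by (simp add: trig_def)
  have s: "?K * (LINT x|torus L. g x $ i * cos (phase L k x)) = - (LINT x|torus L. G x $ i $ j * sin (phase L k x))"
    using *[of 1 0] by (simp add: trig_def)
  have "of_real (L ^ 3) * fcc L (mcoord G i j) k = \<i> * of_real ?K * (of_real (L ^ 3) * fcc L (coord g i) k)"
    unfolding fcc_trig[OF L in_L2_coord_integrable[OF g]] fcc_trig[OF L in_L2_mcoord_integrable[OF G2]]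
    using c s by (simp add: complex_eq_iff)
  then have "of_real (L ^ 3) * fcc L (mcoord G i j) k = of_real (L ^ 3) * (\<i> * of_real ?K * fcc L (coord g i) k)"
    by (simp only: mult.left_commute mult.assoc)
  then show ?thesis using L by (simp only: mult_cancel_left of_real_eq_0_iff) simp
qed

text \<open>On a single mode the divergence condition says that the coefficient vector is orthogonal
  to \<open>k\<close>; it is obtained by testing with the gradients of cosine and sine.\<close>

lemma fcc_div_free:
  assumes L: "L > 0" and g: "in_L2 L g" and d: "weakly_div_free L g"
  shows "(\<Sum>j\<in>UNIV. of_int (k $ j) * fcc L (coord g j) k) = 0"
proof -
  let ?K = "\<lambda>j. 2 * pi / L * of_int (k $ j)"
  have gi: "integrable (torus L) (\<lambda>x. g x $ j * cos (phase L k x))" "integrable (torus L) (\<lambda>x. g x $ j * sin (phase L k x))" for j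
  proof -
    have i: "integrable (torus L) (\<lambda>x. coord g j x * ek L k x)"
      by (rule in_L2_integrable_mult[OF in_L2_coord[OF g] in_L2_ek])
    from integrable_Re[OF i] integrable_Im[OF i]
    show "integrable (torus L) (\<lambda>x. g x $ j * cos (phase L k x))" "integrable (torus L) (\<lambda>x. g x $ j * sin (phase L k x))"
      by (simp_all add: ek_phase)
  qed
  have *: "(\<Sum>j\<in>UNIV. LINT x|torus L. ?K j * (g x $ j * trig L k b (- a) x)) = 0" for a b :: real
  proof -
    have i: "integrable (torus L) (\<lambda>x. ?K j * (g x $ j * trig L k b (- a) x))" for j
    proof -
      have "(\<lambda>x. ?K j * (g x $ j * trig L k b (- a) x))
        = (\<lambda>x. ?K j * b * (g x $ j * cos (phase L k x)) + ?K j * (- a) * (g x $ j * sin (phase L k x)))"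
        by (simp add: trig_def algebra_simps)
      then show ?thesis
        by (simp only:) (intro Bochner_Integration.integrable_add integrable_mult_right gi)
    qed
    have "L2_inner L g (grad (trig L k a b)) = 0"
      using d periodic_trig[OF L] smooth_trig unfolding weakly_div_free_def by blast
    then have "(LINT x|torus L. (\<Sum>j\<in>UNIV. g x $ j * (?K j * trig L k b (- a) x))) = 0"
      by (simp only: L2_inner_def inner_vec_def grad_trig inner_real_def)
    then show ?thesis using i by (subst Bochner_Integration.integral_sum[symmetric]) (auto simp: mult_ac)
  qed
  have c: "(\<Sum>j\<in>UNIV. ?K j * (LINT x|torus L. g x $ j * cos (phase L k x))) = 0"
    using *[of 1 0] by (simp add: trig_def)
  have s: "(\<Sum>j\<in>UNIV. ?K j * (LINT x|torus L. g x $ j * sin (phase L k x))) = 0"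
    using *[of 0 1] by (simp add: trig_def sum_negf)
  have "of_real (2 * pi / L * L ^ 3) * (\<Sum>j\<in>UNIV. of_int (k $ j) * fcc L (coord g j) k)
      = (\<Sum>j\<in>UNIV. of_real (?K j) * (of_real (L ^ 3) * fcc L (coord g j) k))"
    by (simp add: sum_distrib_left mult_ac)
  also have "\<dots> = 0"
    unfolding fcc_trig[OF L in_L2_coord_integrable[OF g]] using c s
    by (simp add: complex_eq_iff sum_negf)
  finally show ?thesis using L by simp
qed

lemma fcc_real: "fcc L (\<lambda>x. of_real (g x)) (- k) = cnj (fcc L (\<lambda>x. of_real (g x)) k)"
  using fcc_cnj[of L "\<lambda>x. of_real (g x)" "- k"] by simp

lemma has_weak_grad_weak_grad: "in_H1 L g \<Longrightarrow> has_weak_grad L g (weak_grad L g)"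
  unfolding in_H1_def weak_grad_def by (metis someI_ex)

lemma sqn_coord: assumes "in_L2 L g" shows "sqn L g = (\<Sum>i\<in>UNIV. sqn L (coord g i))"
proof -
  have "sqn L g = (LINT x|torus L. (\<Sum>i\<in>UNIV. (norm (coord g i x))\<^sup>2))"
    unfolding sqn_def by (intro Bochner_Integration.integral_cong) (auto simp: norm_vec_def L2_set_def sum_nonneg)
  also have "\<dots> = (\<Sum>i\<in>UNIV. sqn L (coord g i))" unfolding sqn_def
    by (rule Bochner_Integration.integral_sum) (rule in_L2_sq_integrable[OF in_L2_coord[OF assms]])
  finally show ?thesis .
qed

lemma sqn_mcoord: assumes "in_L2 L G" shows "sqn L G = (\<Sum>i\<in>UNIV. \<Sum>j\<in>UNIV. sqn L (mcoord G i j))"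
proof -
  have "sqn L G = (LINT x|torus L. (\<Sum>i\<in>UNIV. \<Sum>j\<in>UNIV. (norm (mcoord G i j x))\<^sup>2))"
    unfolding sqn_def by (intro Bochner_Integration.integral_cong) (auto simp: norm_vec_def L2_set_def sum_nonneg)
  also have "\<dots> = (\<Sum>i\<in>UNIV. \<Sum>j\<in>UNIV. sqn L (mcoord G i j))" unfolding sqn_def
    using in_L2_sq_integrable[OF in_L2_mcoord[OF assms]]
    by (subst Bochner_Integration.integral_sum, (intro Bochner_Integration.integrable_sum; simp), simp add: Bochner_Integration.integral_sum)
  finally show ?thesis .
qed

lemma Lp_norm_2: "Lp_norm L 2 g = sqrt (sqn L g)"
  by (simp add: Lp_norm_def sqn_def powr_half_sqrt)

section \<open>Littlewood--Paley pieces as trigonometric polynomials\<close>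

lemma LP_mult_nat: "LP_mult chi (int p) \<xi> = chi (\<xi> /\<^sub>R 2 ^ (p + 1)) - chi (\<xi> /\<^sub>R 2 ^ p)"
proof -
  have 1: "2 powi (- int p) = inverse ((2::real) ^ p)" by (simp add: power_int_minus)
  have 2: "\<xi> /\<^sub>R 2 ^ p /\<^sub>R 2 = \<xi> /\<^sub>R 2 ^ (p + 1)" by simp
  show ?thesis unfolding LP_mult_def Let_def 1 2 by simp
qed

text \<open>Telescoping. For a cutoff in the sense of \<open>LP_cutoff\<close> the result equals 1
  up to norm \<open>3/2 * 2 ^ q\<close>, which leaves a margin above the level \<open>2 ^ q\<close>
  used in \<open>fcc_w_support\<close>.\<close>

lemma sum_LP_mult: "(\<Sum>p = -1..int q. LP_mult chi p \<xi>) = chi (\<xi> /\<^sub>R 2 ^ (q + 1))"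
proof (induction q)
  case 0
  have "{-1..int 0} = {-1, int 0}" by auto
  then show ?case using LP_mult_nat[of chi 0 \<xi>] by (simp add: LP_mult_def)
next
  case (Suc q)
  have "{-1..int (Suc q)} = insert (int (Suc q)) {-1..int q}" by auto
  then have "(\<Sum>p = -1..int (Suc q). LP_mult chi p \<xi>) = LP_mult chi (int (Suc q)) \<xi> + (\<Sum>p = -1..int q. LP_mult chi p \<xi>)"
    by simp
  then show ?case unfolding Suc.IH LP_mult_nat by simp
qed

lemma chi_values:
  assumes "LP_cutoff chi"
  shows "norm \<xi> \<le> 3 / 4 * 2 ^ n \<Longrightarrow> chi (\<xi> /\<^sub>R 2 ^ n) = 1"
    and "2 ^ n \<le> norm \<xi> \<Longrightarrow> chi (\<xi> /\<^sub>R 2 ^ n) = 0"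
proof -
  have 1: "norm (\<xi> /\<^sub>R 2 ^ n) = norm \<xi> / 2 ^ n" by (simp add: divide_inverse mult.commute)
  show "chi (\<xi> /\<^sub>R 2 ^ n) = 1" if "norm \<xi> \<le> 3 / 4 * 2 ^ n"
  proof -
    have "norm (\<xi> /\<^sub>R 2 ^ n) \<le> 3 / 4" unfolding 1 using that by (simp add: pos_divide_le_eq)
    then show ?thesis using assms unfolding LP_cutoff_def by blast
  qed
  show "chi (\<xi> /\<^sub>R 2 ^ n) = 0" if "2 ^ n \<le> norm \<xi>"
  proof -
    have "norm (\<xi> /\<^sub>R 2 ^ n) \<ge> 1" unfolding 1 using that by (simp add: pos_le_divide_eq)
    then show ?thesis using assms unfolding LP_cutoff_def by blast
  qed
qed

lemma LP_mult_support:
  assumes chi: "LP_cutoff chi" and nz: "LP_mult chi (int p) (freq k) \<noteq> 0"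
  shows "k \<in> lp_shell p"
proof -
  have *: "3 / 4 * 2 ^ p \<le> 3 / 4 * (2::real) ^ (p + 1)" "(2::real) ^ p \<le> 2 ^ (p + 1)" by simp_all
  have "\<not> norm (freq k) \<le> 3 / 4 * 2 ^ p"
  proof
    assume a: "norm (freq k) \<le> 3 / 4 * 2 ^ p"
    from chi_values(1)[OF chi a] chi_values(1)[OF chi order_trans[OF a *(1)]] nz show False
      unfolding LP_mult_nat by simp
  qed
  moreover have "\<not> 2 ^ (p + 1) \<le> norm (freq k)"
  proof
    assume a: "2 ^ (p + 1) \<le> norm (freq k)"
    from chi_values(2)[OF chi a] chi_values(2)[OF chi order_trans[OF *(2) a]] nz show False
      unfolding LP_mult_nat by simp
  qed
  ultimately show ?thesis by (simp add: lp_shell_def not_le)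
qed

lemma LP_mult_support_le:
  assumes chi: "LP_cutoff chi" and p: "-1 \<le> p" "p \<le> int q" and nz: "LP_mult chi p (freq k) \<noteq> 0"
  shows "k \<in> freq_box (2 ^ (q + 1))"
proof (cases "p = -1")
  case True
  then have "\<not> 2 ^ 0 \<le> norm (freq k)"
    using nz chi_values(2)[OF chi, of 0 "freq k"] by (auto simp: LP_mult_def)
  then have "k \<in> freq_box (2 ^ 0)" by (intro ball_subset_freq_box) simp
  moreover have "(2::nat) ^ 0 \<le> 2 ^ (q + 1)" by simp
  ultimately show ?thesis using freq_box_mono by blast
next
  case False
  then have "0 \<le> p" using p(1) by linarith
  then obtain n where n: "p = int n" by (rule nonneg_int_cases)
  then have "k \<in> freq_box (2 ^ (n + 1))" using LP_mult_support[OF chi] nz lp_shell_subset by blast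
  moreover have "(2::nat) ^ (n + 1) \<le> 2 ^ (q + 1)" using n p by (intro power_increasing) auto
  ultimately show ?thesis using freq_box_mono by blast
qed

lemma fourier_coeff_nth: "fourier_coeff L g k $ i = fcc L (coord g i) k"
  by (simp add: fourier_coeff_def fcc_def ek_def freq_minus)

lemma LP_proj_nth:
  assumes "finite K" "\<And>k. LP_mult chi p (freq k) \<noteq> 0 \<Longrightarrow> k \<in> K"
  shows "LP_proj chi L p g x $ i = tp L K (\<lambda>k. of_real (LP_mult chi p (freq k)) * fcc L (coord g i) k) x"
proof -
  have "LP_proj chi L p g x = (\<Sum>\<^sub>\<infinity>k\<in>K. (complex_of_real (LP_mult chi p (freq k)) * cis (2 * pi / L * (freq k \<bullet> x))) *s fourier_coeff L g k)"
    unfolding LP_proj_def by (rule infsum_cong_neutral) (use assms(2) in auto)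
  also have "\<dots> = (\<Sum>k\<in>K. (complex_of_real (LP_mult chi p (freq k)) * cis (2 * pi / L * (freq k \<bullet> x))) *s fourier_coeff L g k)"
    by (rule infsum_finite[OF assms(1)])
  finally show ?thesis
    by (simp add: tp_def ek_def fourier_coeff_nth mult_ac)
qed

lemma LP_proj_shell:
  "LP_cutoff chi \<Longrightarrow> LP_proj chi L (int p) g x $ i
     = tp L (lp_shell p) (\<lambda>k. of_real (LP_mult chi (int p) (freq k)) * fcc L (coord g i) k) x"
  by (rule LP_proj_nth) (auto intro: LP_mult_support)

lemma LP_low_nth:
  assumes "LP_cutoff chi"
  shows "LP_low chi L (enat q) g x $ i
     = tp L (freq_box (2 ^ (q + 1))) (\<lambda>k. of_real (chi (freq k /\<^sub>R 2 ^ (q + 1))) * fcc L (coord g i) k) x"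
proof -
  have "LP_low chi L (enat q) g x $ i = (\<Sum>p = -1..int q.
      tp L (freq_box (2 ^ (q + 1))) (\<lambda>k. of_real (LP_mult chi p (freq k)) * fcc L (coord g i) k) x)"
    unfolding LP_low_def using LP_mult_support_le[OF assms]
    by (auto simp del: power_Suc intro!: sum.cong LP_proj_nth)
  also have "\<dots> = (\<Sum>k\<in>freq_box (2 ^ (q + 1)). of_real (\<Sum>p = -1..int q. LP_mult chi p (freq k)) * fcc L (coord g i) k * ek L k x)"
    unfolding tp_def by (subst sum.swap) (simp add: sum_distrib_right)
  finally show ?thesis unfolding sum_LP_mult tp_def .
qed

text \<open>The condition under the infimum in \<open>det_wavenumber\<close> for a single level
  \<open>q\<close>, with \<open>b\<close> in place of \<open>c * \<nu>\<close>.\<close>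

definition lp_bounds :: "(real^3 \<Rightarrow> real) \<Rightarrow> real \<Rightarrow> real \<Rightarrow> real \<Rightarrow> nat \<Rightarrow> (real^3 \<Rightarrow> real^3) \<Rightarrow> bool" where
  "lp_bounds chi L r b q g \<longleftrightarrow>
     (\<forall>p > int q. lam L p powr (-1 + 3 / r) * Lp_norm L r (LP_proj chi L p g) < b) \<and>
     ereal (1 / lam L (int q)) * Linf_norm L (LP_low chi L (enat q) g) < ereal b"

lemma lam_nat: "lam L (int p) = 2 ^ p / L"
  by (simp add: lam_def)

lemma lp_bounds_pos: "lp_bounds chi L r b q g \<Longrightarrow> b > 0"
proof -
  assume "lp_bounds chi L r b q g"
  then have "lam L (int q + 1) powr (-1 + 3 / r) * Lp_norm L r (LP_proj chi L (int q + 1) g) < b"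
    unfolding lp_bounds_def by auto
  moreover have "0 \<le> lam L (int q + 1) powr (-1 + 3 / r) * Lp_norm L r (LP_proj chi L (int q + 1) g)"
    by (simp add: Lp_norm_nonneg)
  ultimately show ?thesis by linarith
qed

lemma continuous_LP_proj:
  assumes "LP_cutoff chi" shows "continuous_on S (LP_proj chi L (int p) g)"
proof -
  have "LP_proj chi L (int p) g = (\<lambda>x. \<chi> i. tp L (lp_shell p) (\<lambda>k. of_real (LP_mult chi (int p) (freq k)) * fcc L (coord g i) k) x)"
    by (simp add: fun_eq_iff vec_eq_iff LP_proj_shell[OF assms])
  then show ?thesis by (simp add: continuous_on_vec_lambda continuous_tp)
qed

lemma Lp_norm_nth_le:
  assumes chi: "LP_cutoff chi" and r: "r > 0"
  shows "Lp_norm L r (\<lambda>x. LP_proj chi L (int p) g x $ i) \<le> Lp_norm L r (LP_proj chi L (int p) g)"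
proof -
  let ?F = "LP_proj chi L (int p) g"
  have "compact (?F ` cbox 0 (vec L))" by (intro compact_continuous_image continuous_LP_proj chi compact_cbox)
  then have "bounded (?F ` cbox 0 (vec L))" by (rule compact_imp_bounded)
  then obtain B where B: "\<And>x. x \<in> cbox 0 (vec L) \<Longrightarrow> norm (?F x) \<le> B" unfolding bounded_iff by blast
  have m: "?F \<in> borel_measurable (torus L)" by (intro continuous_measurable_torus continuous_LP_proj chi)
  have i: "integrable (torus L) (\<lambda>x. norm (?F x) powr r)"
    by (rule integrable_torus_bounded[of _ _ "B powr r"]) (use m B r in \<open>auto intro!: powr_mono2\<close>)
  show ?thesis unfolding Lp_norm_def
    by (intro powr_mono2 integral_mono'[OF i]) (use r in \<open>auto intro!: powr_mono2 integral_nonneg_AE simp: Finite_Cartesian_Product.norm_nth_le\<close>)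
qed

lemma lp_bounds_low:
  assumes chi: "LP_cutoff chi" and L: "L > 0" and b: "lp_bounds chi L r b q g"
  shows "AE x in torus L. norm (LP_low chi L (enat q) g x $ i) \<le> b * (2 ^ q / L)"
proof -
  let ?F = "LP_low chi L (enat q) g"
  have "?F = (\<lambda>x. \<chi> i. tp L (freq_box (2 ^ (q + 1))) (\<lambda>k. of_real (chi (freq k /\<^sub>R 2 ^ (q + 1))) * fcc L (coord g i) k) x)"
    by (simp add: fun_eq_iff vec_eq_iff LP_low_nth[OF chi])
  then have "continuous_on UNIV ?F" by (simp add: continuous_on_vec_lambda continuous_tp)
  then have m: "(\<lambda>x. ereal (norm (?F x))) \<in> borel_measurable (torus L)"
    by (intro borel_measurable_ereal continuous_measurable_torus continuous_on_norm)
  have l: "lam L (int q) > 0" using L by (simp add: lam_nat)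
  have le: "Linf_norm L ?F \<le> ereal (b * lam L (int q))"
  proof (rule ccontr)
    assume "\<not> ?thesis"
    then have "ereal (1 / lam L (int q)) * ereal (b * lam L (int q)) \<le> ereal (1 / lam L (int q)) * Linf_norm L ?F"
      using l by (intro ereal_mult_left_mono) auto
    moreover have "ereal (1 / lam L (int q)) * ereal (b * lam L (int q)) = ereal b" using l by simp
    ultimately show False using b unfolding lp_bounds_def by (auto simp: not_less[symmetric])
  qed
  have "AE x in torus L. ereal (norm (?F x)) \<le> Linf_norm L ?F"
    unfolding Linf_norm_def by (rule esssup_AE)
  then show ?thesis
  proof eventually_elim
    case (elim x)
    then have "ereal (norm (?F x)) \<le> ereal (b * lam L (int q))" using le by (rule order_trans)
    then show ?case using Finite_Cartesian_Product.norm_nth_le[of "?F x" i] by (simp add: lam_nat)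
  qed
qed

lemma lp_bounds_high:
  assumes chi: "LP_cutoff chi" and L: "L > 0" and r: "r > 0" and b: "lp_bounds chi L r b q g" and p: "q < p"
  shows "Lp_norm L r (\<lambda>x. LP_proj chi L (int p) g x $ i) \<le> b * (2 ^ p / L) powr (1 - 3 / r)"
proof -
  have l: "2 ^ p / L > 0" using L by simp
  have "(2 ^ p / L) powr (-1 + 3 / r) * Lp_norm L r (LP_proj chi L (int p) g) \<le> b"
  proof -
    have "lam L (int p) powr (-1 + 3 / r) * Lp_norm L r (LP_proj chi L (int p) g) < b"
      using b p unfolding lp_bounds_def by auto
    then show ?thesis unfolding lam_nat by (rule less_imp_le)
  qed
  then have "(2 ^ p / L) powr (1 - 3 / r) * ((2 ^ p / L) powr (-1 + 3 / r) * Lp_norm L r (LP_proj chi L (int p) g)) \<le> (2 ^ p / L) powr (1 - 3 / r) * b"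
    by (rule mult_left_mono) simp
  moreover have "(2 ^ p / L) powr (1 - 3 / r) * (2 ^ p / L) powr (-1 + 3 / r) = 1"
    using L by (simp add: powr_add[symmetric])
  ultimately have "Lp_norm L r (LP_proj chi L (int p) g) \<le> b * (2 ^ p / L) powr (1 - 3 / r)"
    unfolding mult.assoc[symmetric] by (simp only: mult_1 mult.commute[of b])
  then show ?thesis using Lp_norm_nth_le[OF chi r] order_trans by blast
qed

text \<open>The integral sees only the finitely many modes of \<open>u\<close> that meet the
  spectrum of \<open>g * h\<close>. So \<open>u\<close> may be replaced by \<open>LP_low\<close> at
  a level \<open>P\<close> whose cutoff equals 1 on these modes, and this is the low part at
  \<open>q\<close> plus the pieces with \<open>q < p \<le> P\<close>.\<close>

lemma trilinear_trig_poly: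
  assumes chi: "LP_cutoff chi" and L: "L > 0" and r: "2 < r" "r < 3"
    and u: "in_L2 L u" and b: "lp_bounds chi L r b q u"
    and g: "trig_poly L G g" "\<And>k. k \<in> G \<Longrightarrow> 2 ^ q \<le> norm (freq k)"
    and h: "trig_poly L H h" "\<And>k. k \<in> H \<Longrightarrow> 2 ^ q \<le> norm (freq k)"
  shows "norm (LINT x|torus L. coord u i x * (g x * h x)) \<le>
     trilinear_const r * b * (sqn L g + L ^ 3 * (\<Sum>k\<in>H. (norm (freq k) / L)\<^sup>2 * (norm (fcc L h k))\<^sup>2))"
proof -
  have b0: "b \<ge> 0" using lp_bounds_pos[OF b] by simp
  have "finite ((\<lambda>(k, l). k + l) ` (G \<times> H))" using g(1) h(1) by (auto simp: trig_poly_def)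
  then obtain N where N: "(\<lambda>(k, l). k + l) ` (G \<times> H) \<subseteq> freq_box N" using freq_box_exhaust by blast
  have gh: "trig_poly L (freq_box N) (\<lambda>x. g x * h x)"
    by (rule trig_poly_mult[OF g(1) h(1)]) (use N in auto)
  then obtain c where c: "(\<lambda>x. g x * h x) = tp L (freq_box N) c" by (auto simp: trig_poly_def)
  have "bounded ((\<lambda>k. norm (freq k)) ` freq_box N)" by (intro finite_imp_bounded) auto
  then obtain B where B: "\<And>k. k \<in> freq_box N \<Longrightarrow> norm (freq k) \<le> B" unfolding bounded_iff by (auto simp: real_norm_def)
  obtain P0 :: nat where P0: "B < 2 ^ P0" using real_arch_pow[of 2 B] by auto
  \<comment> \<open>The maximum with \<open>q\<close> guarantees that the splitting at
    \<open>q\<close> takes place below \<open>P\<close>.\<close>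
  define P where "P = max q P0"
  have chiP: "chi (freq k /\<^sub>R 2 ^ (P + 1)) = 1" if "k \<in> freq_box N" for k
  proof (rule chi_values(1)[OF chi])
    have "norm (freq k) \<le> 2 ^ P0" using B[OF that] P0 by simp
    also have "(2::real) ^ P0 \<le> 2 ^ P" by (simp add: P_def)
    also have "\<dots> \<le> 3 / 4 * 2 ^ (P + 1)" by simp
    finally show "norm (freq k) \<le> 3 / 4 * 2 ^ (P + 1)" .
  qed
  define f where "f = (\<lambda>x. LP_low chi L (enat q) u x $ i)"
  define a where "a = (\<lambda>p x. LP_proj chi L (int p) u x $ i)"
  have f: "f = tp L (freq_box (2 ^ (q + 1))) (\<lambda>k. of_real (chi (freq k /\<^sub>R 2 ^ (q + 1))) * fcc L (coord u i) k)"
    unfolding f_def LP_low_nth[OF chi] ..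
  have a: "a p = tp L (lp_shell p) (\<lambda>k. of_real (LP_mult chi (int p) (freq k)) * fcc L (coord u i) k)" for p
    unfolding a_def LP_proj_shell[OF chi] ..
  have ap: "trig_poly L (lp_shell p) (a p)" for p unfolding a by (rule trig_poly_tp) simp
  have fa: "f x + (\<Sum>p\<in>{q<..P}. a p x) = LP_low chi L (enat P) u x $ i" for x
  proof -
    have "(\<Sum>p\<in>{q<..P}. a p x) = (\<Sum>p\<in>int ` {q<..P}. LP_proj chi L p u x $ i)"
      by (simp add: sum.reindex a_def)
    moreover have "{-1..int P} = {-1..int q} \<union> int ` {q<..P}" "{-1..int q} \<inter> int ` {q<..P} = {}"
    proof -
      show "{-1..int P} = {-1..int q} \<union> int ` {q<..P}"
      proof (intro equalityI subsetI)
        fix z assume z: "z \<in> {-1..int P}"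
        show "z \<in> {-1..int q} \<union> int ` {q<..P}"
        proof (cases "z \<le> int q")
          case False
          then have "z = int (nat z)" "nat z \<in> {q<..P}" using z by auto
          then show ?thesis by blast
        qed (use z in auto)
      qed (auto simp: P_def)
    qed auto
    ultimately show ?thesis
      by (simp add: f_def LP_low_def sum.union_disjoint)
  qed
  have same: "(LINT x|torus L. coord u i x * (g x * h x)) = (LINT x|torus L. (f x + (\<Sum>p\<in>{q<..P}. a p x)) * (g x * h x))"
  proof -
    have "(LINT x|torus L. coord u i x * (g x * h x)) = of_real (L ^ 3) * (\<Sum>k\<in>freq_box N. c k * fcc L (coord u i) (- k))"
      using integral_mult_tp[OF L in_L2_coord[OF u], where K="freq_box N" and c=c] by (simp only: c[symmetric])
    also have "\<dots> = of_real (L ^ 3) * (\<Sum>k\<in>freq_box N. c k * fcc L (\<lambda>x. LP_low chi L (enat P) u x $ i) (- k))"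
    proof -
      have "fcc L (\<lambda>x. LP_low chi L (enat P) u x $ i) k = fcc L (coord u i) k" if k: "k \<in> freq_box N" for k
      proof -
        have "k \<in> freq_box (2 ^ (P + 1))"
        proof (rule ball_subset_freq_box)
          have "norm (freq k) < 2 ^ P0" using B[OF k] P0 by simp
          also have "(2::real) ^ P0 \<le> 2 ^ (P + 1)" by (rule power_increasing) (auto simp: P_def)
          finally show "norm (freq k) < 2 ^ (P + 1)" .
        qed
        then show ?thesis unfolding LP_low_nth[OF chi] fcc_tp[OF L finite_freq_box] by (simp only: chiP[OF k] if_True of_real_1 mult_1)
      qed
      then show ?thesis by (simp add: freq_box_uminus)
    qed
    also have "\<dots> = (LINT x|torus L. (LP_low chi L (enat P) u x $ i) * (g x * h x))"
    proof -
      have "in_L2 L (\<lambda>x. LP_low chi L (enat P) u x $ i)" unfolding LP_low_nth[OF chi] by (rule in_L2_tp)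
      from integral_mult_tp[OF L this, where K="freq_box N" and c=c] show ?thesis by (simp only: c[symmetric])
    qed
    finally show ?thesis unfolding fa .
  qed
  show ?thesis unfolding same
  proof (rule trilinear_estimate[OF L r b0])
    show "f \<in> borel_measurable (torus L)" unfolding f by (rule measurable_tp)
    show "AE x in torus L. norm (f x) \<le> b * (2 ^ q / L)" unfolding f_def by (rule lp_bounds_low[OF chi L b])
    show "trig_poly L (lp_shell p) (a p)" for p by (rule ap)
    show "Lp_norm L r (a p) \<le> b * (2 ^ p / L) powr (1 - 3 / r)" if "q < p" for p
      unfolding a_def using r by (intro lp_bounds_high[OF chi L _ b that]) simp
  qed (use g h in auto)
qed

section \<open>The nonlinear flux through a Fourier truncation\<close>

lemma trig_poly_restrict:
  assumes L: "L > 0" and g: "trig_poly L K g"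
  shows "trig_poly L {k \<in> K. fcc L g k \<noteq> 0} g"
proof -
  have f: "finite K" using g by (auto simp: trig_poly_def)
  have "g = tp L K (fcc L g)" by (rule trig_poly_fcc(1)[OF L g])
  also have "\<dots> = tp L {k \<in> K. fcc L g k \<noteq> 0} (fcc L g)"
    unfolding tp_def fun_eq_iff using f by (intro allI sum.mono_neutral_right) auto
  finally show ?thesis using f by (auto simp: trig_poly_def)
qed

lemma trilinear_fcc:
  assumes chi: "LP_cutoff chi" and L: "L > 0" and r: "2 < r" "r < 3"
    and u: "in_L2 L u" and b: "lp_bounds chi L r b q u"
    and g: "trig_poly L G g" "\<And>k. fcc L g k \<noteq> 0 \<Longrightarrow> 2 ^ q \<le> norm (freq k)"
    and h: "trig_poly L H h" "\<And>k. fcc L h k \<noteq> 0 \<Longrightarrow> 2 ^ q \<le> norm (freq k)"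
  shows "norm (LINT x|torus L. coord u i x * (g x * h x)) \<le>
     trilinear_const r * b * (sqn L g + L ^ 3 * (\<Sum>k\<in>H. (norm (freq k) / L)\<^sup>2 * (norm (fcc L h k))\<^sup>2))"
proof -
  have "finite H" using h(1) by (auto simp: trig_poly_def)
  then have "(\<Sum>k\<in>{k \<in> H. fcc L h k \<noteq> 0}. (norm (freq k) / L)\<^sup>2 * (norm (fcc L h k))\<^sup>2)
     = (\<Sum>k\<in>H. (norm (freq k) / L)\<^sup>2 * (norm (fcc L h k))\<^sup>2)"
    by (intro sum.mono_neutral_left) auto
  then show ?thesis
    using trilinear_trig_poly[OF chi L r u b trig_poly_restrict[OF L g(1)] _ trig_poly_restrict[OF L h(1)], of i] g(2) h(2)
    by simp
qed

lemma fcc_trunc: "L > 0 \<Longrightarrow> fcc L (trunc L N g) k = (if k \<in> freq_box N then fcc L g k else 0)"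
  by (simp add: fcc_tp)

lemma in_L2_mult_trig_poly:
  assumes "in_L2 L f" "trig_poly L' K h"
  shows "in_L2 L (\<lambda>x. f x * h x)"
proof -
  obtain B where B: "\<And>x. norm (h x) \<le> B" using trig_poly_bounded[OF assms(2)] by blast
  have "in_L2 L (\<lambda>x. h x * f x)"
    by (rule in_L2_mult_bounded[OF assms(1) trig_poly_measurable[OF assms(2)] B])
  then show ?thesis by (simp add: mult.commute)
qed

lemma LIMSEQ_norm_le:
  fixes X :: "nat \<Rightarrow> complex"
  assumes "X \<longlonglongrightarrow> x" "\<And>n. norm (X n) \<le> a" shows "norm x \<le> a"
  using LIMSEQ_le_const2[OF tendsto_norm[OF assms(1)]] assms(2) by blast

text \<open>As \<open>u\<close> is merely in L^2, one factor must be bounded: \<open>u\<close> times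
  the polynomial \<open>h\<close> is in L^2, and the truncations of \<open>g\<close> pass to the
  limit. In the flux, \<open>g\<close> is a derivative of \<open>w\<close> and \<open>h\<close> a
  component of its truncation.\<close>

lemma trilinear_left:
  assumes chi: "LP_cutoff chi" and L: "L > 0" and r: "2 < r" "r < 3"
    and u: "in_L2 L u" and b: "lp_bounds chi L r b q u"
    and g: "in_L2 L g" "\<And>k. fcc L g k \<noteq> 0 \<Longrightarrow> 2 ^ q \<le> norm (freq k)"
    and h: "trig_poly L H h" "\<And>k. fcc L h k \<noteq> 0 \<Longrightarrow> 2 ^ q \<le> norm (freq k)"
  shows "norm (LINT x|torus L. coord u i x * (g x * h x)) \<le>
     trilinear_const r * b * (sqn L g + L ^ 3 * (\<Sum>k\<in>H. (norm (freq k) / L)\<^sup>2 * (norm (fcc L h k))\<^sup>2))"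
proof -
  have cb: "trilinear_const r * b \<ge> 0" using trilinear_const_pos[OF r] lp_bounds_pos[OF b] by simp
  have "(\<lambda>N. LINT x|torus L. (coord u i x * h x) * trunc L N g x) \<longlonglongrightarrow> (LINT x|torus L. (coord u i x * h x) * g x)"
    by (intro integral_mult_trunc_tendsto L g(1) in_L2_mult_trig_poly[OF in_L2_coord[OF u] h(1)])
  then have lim: "(\<lambda>N. LINT x|torus L. coord u i x * (trunc L N g x * h x)) \<longlonglongrightarrow> (LINT x|torus L. coord u i x * (g x * h x))"
    by (simp add: mult_ac)
  show ?thesis
  proof (rule LIMSEQ_norm_le[OF lim])
    fix N
    have "norm (LINT x|torus L. coord u i x * (trunc L N g x * h x)) \<le>
      trilinear_const r * b * (sqn L (trunc L N g) + L ^ 3 * (\<Sum>k\<in>H. (norm (freq k) / L)\<^sup>2 * (norm (fcc L h k))\<^sup>2))"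
      by (rule trilinear_fcc[OF chi L r u b trig_poly_tp[OF finite_freq_box] _ h])
         (simp add: fcc_trunc[OF L] g(2) split: if_splits)
    also have "\<dots> \<le> trilinear_const r * b * (sqn L g + L ^ 3 * (\<Sum>k\<in>H. (norm (freq k) / L)\<^sup>2 * (norm (fcc L h k))\<^sup>2))"
      using sqn_trunc_le[OF L g(1) finite_freq_box, of N] cb
      by (intro mult_left_mono add_right_mono) (simp_all add: sqn_tp[OF L])
    finally show "norm (LINT x|torus L. coord u i x * (trunc L N g x * h x)) \<le> \<dots>" .
  qed
qed

text \<open>The mirror case, for the part integrated by parts: \<open>g\<close> is a derivative of
  the truncation and \<open>h\<close> a component of \<open>w\<close>. Since \<open>h\<close> may
  have infinitely many modes, its weighted sum is replaced by a bound \<open>D\<close> common to all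
  truncations.\<close>

lemma trilinear_right:
  assumes chi: "LP_cutoff chi" and L: "L > 0" and r: "2 < r" "r < 3"
    and u: "in_L2 L u" and b: "lp_bounds chi L r b q u"
    and g: "trig_poly L G g" "\<And>k. fcc L g k \<noteq> 0 \<Longrightarrow> 2 ^ q \<le> norm (freq k)"
    and h: "in_L2 L h" "\<And>k. fcc L h k \<noteq> 0 \<Longrightarrow> 2 ^ q \<le> norm (freq k)"
    and D: "\<And>N. L ^ 3 * (\<Sum>k\<in>freq_box N. (norm (freq k) / L)\<^sup>2 * (norm (fcc L h k))\<^sup>2) \<le> D"
  shows "norm (LINT x|torus L. coord u i x * (g x * h x)) \<le> trilinear_const r * b * (sqn L g + D)"
proof -
  have cb: "trilinear_const r * b \<ge> 0" using trilinear_const_pos[OF r] lp_bounds_pos[OF b] by simp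
  have "(\<lambda>N. LINT x|torus L. (coord u i x * g x) * trunc L N h x) \<longlonglongrightarrow> (LINT x|torus L. (coord u i x * g x) * h x)"
    by (intro integral_mult_trunc_tendsto L h(1) in_L2_mult_trig_poly[OF in_L2_coord[OF u] g(1)])
  then have lim: "(\<lambda>N. LINT x|torus L. coord u i x * (g x * trunc L N h x)) \<longlonglongrightarrow> (LINT x|torus L. coord u i x * (g x * h x))"
    by (simp add: mult.assoc)
  show ?thesis
  proof (rule LIMSEQ_norm_le[OF lim])
    fix N
    have "norm (LINT x|torus L. coord u i x * (g x * trunc L N h x)) \<le>
      trilinear_const r * b * (sqn L g + L ^ 3 * (\<Sum>k\<in>freq_box N. (norm (freq k) / L)\<^sup>2 * (norm (fcc L (trunc L N h) k))\<^sup>2))"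
      by (rule trilinear_fcc[OF chi L r u b g trig_poly_tp[OF finite_freq_box]])
         (use h(2) in \<open>auto simp: fcc_trunc[OF L] split: if_splits\<close>)
    also have "(\<Sum>k\<in>freq_box N. (norm (freq k) / L)\<^sup>2 * (norm (fcc L (trunc L N h) k))\<^sup>2)
        = (\<Sum>k\<in>freq_box N. (norm (freq k) / L)\<^sup>2 * (norm (fcc L h k))\<^sup>2)"
      by (simp add: fcc_trunc[OF L])
    also have "trilinear_const r * b * (sqn L g + L ^ 3 * \<dots>) \<le> trilinear_const r * b * (sqn L g + D)"
      using D cb by (intro mult_left_mono add_left_mono)
    finally show "norm (LINT x|torus L. coord u i x * (g x * trunc L N h x)) \<le> trilinear_const r * b * (sqn L g + D)" .
  qed
qed

lemma fcc_mult_ek: "fcc L (\<lambda>x. g x * ek L k x) m = fcc L g (m - k)"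
  by (simp add: fcc_def mult.assoc ek_mult)

text \<open>
  Since \<open>v\<close> times a trigonometric polynomial lies in \<open>H\<^sup>1\<close> only, the divergence condition on \<open>w\<close> is not
  applied to a smooth test function; it is used mode by mode through Parseval's identity.
\<close>

lemma div_free_ibp_ek:
  fixes G w :: "3 \<Rightarrow> real^3 \<Rightarrow> complex"
  assumes L: "L > 0" and v: "in_L2 L v" and G: "\<And>j. in_L2 L (G j)" and w: "\<And>j. in_L2 L (w j)"
    and grad: "\<And>j m. fcc L (G j) m = \<i> * of_real (2 * pi / L * of_int (m $ j)) * fcc L v m"
    and div: "\<And>m. (\<Sum>j\<in>UNIV. of_int (m $ j) * fcc L (w j) m) = 0"
  shows "(\<Sum>j\<in>UNIV. LINT x|torus L. G j x * (w j x * ek L k x))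
     = - (\<Sum>j\<in>UNIV. \<i> * of_real (2 * pi / L * of_int (k $ j)) * (LINT x|torus L. v x * (w j x * ek L k x)))"
proof -
  let ?I = "\<lambda>m j. \<i> * of_real (2 * pi / L * of_int (m $ j))"
  have we: "in_L2 L (\<lambda>x. w j x * ek L k x)" for j
    by (rule in_L2_mult_trig_poly[OF w trig_poly_ek[of "{k}"]]) auto
  have "(\<lambda>N. (\<Sum>j\<in>UNIV. of_real (L ^ 3) * (\<Sum>m\<in>freq_box N. fcc L (G j) m * fcc L (\<lambda>x. w j x * ek L k x) (- m)))
       + (\<Sum>j\<in>UNIV. ?I k j * (of_real (L ^ 3) * (\<Sum>m\<in>freq_box N. fcc L v m * fcc L (\<lambda>x. w j x * ek L k x) (- m)))))
     \<longlonglongrightarrow> (\<Sum>j\<in>UNIV. LINT x|torus L. G j x * (w j x * ek L k x))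
       + (\<Sum>j\<in>UNIV. ?I k j * (LINT x|torus L. v x * (w j x * ek L k x)))"
    by (intro tendsto_add tendsto_sum tendsto_mult tendsto_const parseval_bilinear L v G we)
  moreover have "(\<Sum>j\<in>UNIV. of_real (L ^ 3) * (\<Sum>m\<in>freq_box N. fcc L (G j) m * fcc L (\<lambda>x. w j x * ek L k x) (- m)))
       + (\<Sum>j\<in>UNIV. ?I k j * (of_real (L ^ 3) * (\<Sum>m\<in>freq_box N. fcc L v m * fcc L (\<lambda>x. w j x * ek L k x) (- m)))) = 0" for N
  proof -
    \<comment> \<open>The derivatives on \<open>v\<close> and on the exponential add up to the
      frequency \<open>m + k\<close>, the negative of the frequency \<open>- m - k\<close> at which
      \<open>w\<close> is met and is orthogonal to it.\<close>
    have z: "(\<Sum>j\<in>UNIV. (?I m j + ?I k j) * fcc L (w j) (- m - k)) = 0" for m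
    proof -
      have "(\<Sum>j\<in>UNIV. (?I m j + ?I k j) * fcc L (w j) (- m - k))
         = (\<Sum>j\<in>UNIV. - \<i> * of_real (2 * pi / L) * (of_int ((- m - k) $ j) * fcc L (w j) (- m - k)))"
        by (intro sum.cong) (simp_all add: algebra_simps)
      also have "\<dots> = - \<i> * of_real (2 * pi / L) * (\<Sum>j\<in>UNIV. of_int ((- m - k) $ j) * fcc L (w j) (- m - k))"
        by (simp only: sum_distrib_left)
      finally show ?thesis by (simp only: div mult_zero_right)
    qed
    have "(\<Sum>j\<in>UNIV. of_real (L ^ 3) * (\<Sum>m\<in>freq_box N. fcc L (G j) m * fcc L (\<lambda>x. w j x * ek L k x) (- m)))
       + (\<Sum>j\<in>UNIV. ?I k j * (of_real (L ^ 3) * (\<Sum>m\<in>freq_box N. fcc L v m * fcc L (\<lambda>x. w j x * ek L k x) (- m))))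
     = (\<Sum>j\<in>UNIV. \<Sum>m\<in>freq_box N. of_real (L ^ 3) * fcc L v m * ((?I m j + ?I k j) * fcc L (w j) (- m - k)))"
      unfolding grad fcc_mult_ek sum.distrib[symmetric]
      by (simp add: sum_distrib_left sum.distrib algebra_simps)
    also have "\<dots> = (\<Sum>m\<in>freq_box N. of_real (L ^ 3) * fcc L v m * (\<Sum>j\<in>UNIV. (?I m j + ?I k j) * fcc L (w j) (- m - k)))"
      by (subst sum.swap) (simp only: sum_distrib_left)
    also have "\<dots> = 0" by (simp only: z mult_zero_right sum.neutral_const)
    finally show ?thesis .
  qed
  ultimately have "(\<Sum>j\<in>UNIV. LINT x|torus L. G j x * (w j x * ek L k x))
       + (\<Sum>j\<in>UNIV. ?I k j * (LINT x|torus L. v x * (w j x * ek L k x))) = 0"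
    by (simp add: LIMSEQ_const_iff)
  then show ?thesis by (simp add: add_eq_0_iff2)
qed

lemma integral_mult_tp_expand:
  assumes "in_L2 L f" "in_L2 L g" "finite K"
  shows "(LINT x|torus L. f x * (g x * tp L K c x)) = (\<Sum>k\<in>K. c k * (LINT x|torus L. f x * (g x * ek L k x)))"
proof -
  have i: "integrable (torus L) (\<lambda>x. f x * (g x * ek L k x))" for k
    by (rule in_L2_integrable_mult[OF assms(1) in_L2_mult_trig_poly[OF assms(2) trig_poly_ek[of "{k}"]]]) auto
  have "(LINT x|torus L. f x * (g x * tp L K c x)) = (LINT x|torus L. (\<Sum>k\<in>K. c k * (f x * (g x * ek L k x))))"
    by (simp add: tp_def sum_distrib_left mult_ac)
  also have "\<dots> = (\<Sum>k\<in>K. c k * (LINT x|torus L. f x * (g x * ek L k x)))"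
    by (subst Bochner_Integration.integral_sum) (auto intro!: integrable_mult_right i)
  finally show ?thesis .
qed

text \<open>The partial derivative of \<open>tp L K c\<close> in direction \<open>j\<close>, written
  on the Fourier side.\<close>

abbreviation dtp :: "real \<Rightarrow> (int^3) set \<Rightarrow> 3 \<Rightarrow> (int^3 \<Rightarrow> complex) \<Rightarrow> real^3 \<Rightarrow> complex" where
  "dtp L K j c \<equiv> tp L K (\<lambda>k. \<i> * of_real (2 * pi / L * of_int (k $ j)) * c k)"

lemma div_free_ibp:
  fixes G w :: "3 \<Rightarrow> real^3 \<Rightarrow> complex"
  assumes L: "L > 0" and v: "in_L2 L v" and G: "\<And>j. in_L2 L (G j)" and w: "\<And>j. in_L2 L (w j)"
    and grad: "\<And>j m. fcc L (G j) m = \<i> * of_real (2 * pi / L * of_int (m $ j)) * fcc L v m"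
    and div: "\<And>m. (\<Sum>j\<in>UNIV. of_int (m $ j) * fcc L (w j) m) = 0"
    and K: "finite K"
  shows "(\<Sum>j\<in>UNIV. LINT x|torus L. G j x * (w j x * tp L K c x)) = - (\<Sum>j\<in>UNIV. LINT x|torus L. v x * (w j x * dtp L K j c x))"
proof -
  let ?I = "\<lambda>m j. \<i> * of_real (2 * pi / L * of_int (m $ j))"
  have "(\<Sum>j\<in>UNIV. LINT x|torus L. G j x * (w j x * tp L K c x)) = (\<Sum>k\<in>K. c k * (\<Sum>j\<in>UNIV. LINT x|torus L. G j x * (w j x * ek L k x)))"
    unfolding integral_mult_tp_expand[OF G w K] by (subst sum.swap) (simp only: sum_distrib_left)
  also have "\<dots> = (\<Sum>k\<in>K. c k * - (\<Sum>j\<in>UNIV. ?I k j * (LINT x|torus L. v x * (w j x * ek L k x))))"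
    by (simp only: div_free_ibp_ek[OF L v G w grad div])
  also have "\<dots> = - (\<Sum>j\<in>UNIV. \<Sum>k\<in>K. ?I k j * c k * (LINT x|torus L. v x * (w j x * ek L k x)))"
    by (subst sum.swap) (simp add: sum_negf sum_distrib_left mult_ac)
  also have "\<dots> = - (\<Sum>j\<in>UNIV. LINT x|torus L. v x * (w j x * dtp L K j c x))"
    by (simp only: integral_mult_tp_expand[OF v w K])
  finally show ?thesis .
qed

text \<open>The two solutions frozen at one time. The gradients are parameters, so nothing here
  depends on how \<open>weak_grad\<close> selects a representative.\<close>

locale two_fields =
  fixes L :: real and u v :: "real^3 \<Rightarrow> real^3" and Gu Gv :: "real^3 \<Rightarrow> real^3^3"
  assumes L: "L > 0" and u: "in_L2 L u" and v: "in_L2 L v"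
    and Gu: "has_weak_grad L u Gu" and Gv: "has_weak_grad L v Gv"
    and du: "weakly_div_free L u" and dv: "weakly_div_free L v"
begin

abbreviation w :: "real^3 \<Rightarrow> real^3" where "w \<equiv> \<lambda>x. u x - v x"
abbreviation Gw :: "real^3 \<Rightarrow> real^3^3" where "Gw \<equiv> \<lambda>x. Gu x - Gv x"

lemma L2_Gu: "in_L2 L Gu" and L2_Gv: "in_L2 L Gv"
  using Gu Gv by (auto simp: has_weak_grad_def)

lemma L2_w: "in_L2 L w" and L2_Gw: "in_L2 L Gw"
  by (intro in_L2_diff u v L2_Gu L2_Gv)+

lemma fcc_w: "fcc L (coord w i) k = fcc L (coord u i) k - fcc L (coord v i) k"
  using fcc_diff[OF in_L2_coord[OF u, of i] in_L2_coord[OF v, of i]] by simp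

lemma fcc_Gw: "fcc L (mcoord Gw i j) k = \<i> * of_real (2 * pi / L * of_int (k $ j)) * fcc L (coord w i) k"
proof -
  have "fcc L (mcoord Gw i j) k = fcc L (mcoord Gu i j) k - fcc L (mcoord Gv i j) k"
    using fcc_diff[OF in_L2_mcoord[OF L2_Gu, of i j] in_L2_mcoord[OF L2_Gv, of i j]] by simp
  then show ?thesis unfolding fcc_weak_grad[OF L u Gu] fcc_weak_grad[OF L v Gv] fcc_w by (simp only: right_diff_distrib)
qed

lemma div_w: "(\<Sum>j\<in>UNIV. of_int (k $ j) * fcc L (coord w j) k) = 0"
  using fcc_div_free[OF L u du, of k] fcc_div_free[OF L v dv, of k]
  unfolding fcc_w by (simp only: right_diff_distrib sum_subtractf diff_self)

lemma sum_freq_sq: "(\<Sum>j\<in>UNIV. (of_int (k $ j))\<^sup>2) = (norm (freq k))\<^sup>2"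
  unfolding norm_vec_def L2_set_def by (subst real_sqrt_pow2) (auto intro: sum_nonneg simp: freq_def)

lemma norm_fcc_Gw: "(norm (fcc L (mcoord Gw i j) k))\<^sup>2 = (2 * pi / L)\<^sup>2 * (of_int (k $ j))\<^sup>2 * (norm (fcc L (coord w i) k))\<^sup>2"
  unfolding fcc_Gw norm_mult power_mult_distrib norm_of_real power2_abs by simp

lemma sum_norm_fcc_Gw: "(\<Sum>j\<in>UNIV. (norm (fcc L (mcoord Gw i j) k))\<^sup>2) = (2 * pi / L)\<^sup>2 * (norm (freq k))\<^sup>2 * (norm (fcc L (coord w i) k))\<^sup>2"
  unfolding norm_fcc_Gw sum_freq_sq[symmetric] by (simp only: sum_distrib_left sum_distrib_right)

text \<open>The weights of the trilinear estimate lack the factor \<open>2 * pi\<close> of a true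
  derivative; since this factor is at least 1, the gradient dominates them.\<close>

lemma dissipation_bound:
  "L ^ 3 * (\<Sum>k\<in>freq_box N. (norm (freq k) / L)\<^sup>2 * (norm (fcc L (coord w i) k))\<^sup>2) \<le> (\<Sum>j\<in>UNIV. sqn L (mcoord Gw i j))"
proof -
  have "(norm (freq k) / L)\<^sup>2 * (norm (fcc L (coord w i) k))\<^sup>2 \<le> (\<Sum>j\<in>UNIV. (norm (fcc L (mcoord Gw i j) k))\<^sup>2)" for k
  proof -
    have "(norm (freq k) / L)\<^sup>2 \<le> (2 * pi * (norm (freq k) / L))\<^sup>2"
    proof (rule power_mono)
      have "1 * (norm (freq k) / L) \<le> 2 * pi * (norm (freq k) / L)"
        using L pi_gt3 by (intro mult_right_mono) auto
      then show "norm (freq k) / L \<le> 2 * pi * (norm (freq k) / L)" by simp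
    qed (use L in simp)
    also have "\<dots> = (2 * pi / L)\<^sup>2 * (norm (freq k))\<^sup>2" by (simp add: power_mult_distrib power_divide)
    finally show ?thesis unfolding sum_norm_fcc_Gw by (rule mult_right_mono) simp
  qed
  then have "L ^ 3 * (\<Sum>k\<in>freq_box N. (norm (freq k) / L)\<^sup>2 * (norm (fcc L (coord w i) k))\<^sup>2)
     \<le> L ^ 3 * (\<Sum>k\<in>freq_box N. \<Sum>j\<in>UNIV. (norm (fcc L (mcoord Gw i j) k))\<^sup>2)"
    using L by (intro mult_left_mono sum_mono) auto
  also have "\<dots> = (\<Sum>j\<in>UNIV. L ^ 3 * (\<Sum>k\<in>freq_box N. (norm (fcc L (mcoord Gw i j) k))\<^sup>2))"
    by (subst sum.swap) (simp only: sum_distrib_left)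
  also have "\<dots> \<le> (\<Sum>j\<in>UNIV. sqn L (mcoord Gw i j))"
    by (intro sum_mono sqn_trunc_le L in_L2_mcoord L2_Gw finite_freq_box)
  finally show ?thesis .
qed

text \<open>The integral of \<open>((u . grad) u - (v . grad) v) . S_N w\<close>, left in the form
  in which it arises from subtracting the two equations.\<close>

definition flux :: "nat \<Rightarrow> complex" where
  "flux N = (\<Sum>i\<in>UNIV. \<Sum>j\<in>UNIV. LINT x|torus L.
     (mcoord Gu i j x * coord u j x - mcoord Gv i j x * coord v j x) * trunc L N (coord w i) x)"

text \<open>The integrand is regrouped as \<open>(u . grad) w + (w . grad) v\<close>. In the second
  part the derivative has to leave \<open>v\<close>: the wavenumber controls \<open>v\<close>
  itself, and afterwards the two other factors both come from \<open>w\<close>, hence have no low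
  modes.\<close>

lemma flux_eq:
  "flux N = (\<Sum>i\<in>UNIV. \<Sum>j\<in>UNIV. LINT x|torus L. coord u j x * (mcoord Gw i j x * trunc L N (coord w i) x))
     - (\<Sum>i\<in>UNIV. \<Sum>j\<in>UNIV. LINT x|torus L. coord v i x * (dtp L (freq_box N) j (fcc L (coord w i)) x * coord w j x))"
proof -
  let ?S = "\<lambda>i. trunc L N (coord w i)"
  have t: "trig_poly L (freq_box N) (?S i)" for i by (rule trig_poly_tp[OF finite_freq_box])
  have "(LINT x|torus L. (mcoord Gu i j x * coord u j x - mcoord Gv i j x * coord v j x) * ?S i x)
     = (LINT x|torus L. coord u j x * (mcoord Gw i j x * ?S i x)) + (LINT x|torus L. mcoord Gv i j x * (coord w j x * ?S i x))" for i j
  proof -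
    have "(LINT x|torus L. (mcoord Gu i j x * coord u j x - mcoord Gv i j x * coord v j x) * ?S i x)
      = (LINT x|torus L. coord u j x * (mcoord Gw i j x * ?S i x) + mcoord Gv i j x * (coord w j x * ?S i x))"
      by (intro Bochner_Integration.integral_cong refl) (simp add: algebra_simps)
    also have "\<dots> = (LINT x|torus L. coord u j x * (mcoord Gw i j x * ?S i x)) + (LINT x|torus L. mcoord Gv i j x * (coord w j x * ?S i x))"
      by (intro Bochner_Integration.integral_add in_L2_integrable_mult in_L2_mult_trig_poly[OF _ t] in_L2_coord[OF u] in_L2_coord[OF L2_w]
            in_L2_mcoord[OF L2_Gw] in_L2_mcoord[OF L2_Gv])
    finally show ?thesis .
  qed
  then have A: "flux N = (\<Sum>i\<in>UNIV. \<Sum>j\<in>UNIV. LINT x|torus L. coord u j x * (mcoord Gw i j x * ?S i x))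
     + (\<Sum>i\<in>UNIV. \<Sum>j\<in>UNIV. LINT x|torus L. mcoord Gv i j x * (coord w j x * ?S i x))"
    unfolding flux_def by (simp only: sum.distrib)
  have B: "(\<Sum>j\<in>UNIV. LINT x|torus L. mcoord Gv i j x * (coord w j x * ?S i x))
     = - (\<Sum>j\<in>UNIV. LINT x|torus L. coord v i x * (coord w j x * dtp L (freq_box N) j (fcc L (coord w i)) x))" for i
    by (rule div_free_ibp[OF L in_L2_coord[OF v] in_L2_mcoord[OF L2_Gv] in_L2_coord[OF L2_w] fcc_weak_grad[OF L v Gv] div_w finite_freq_box])
  have C: "(\<Sum>j\<in>UNIV. LINT x|torus L. coord v i x * (coord w j x * dtp L (freq_box N) j (fcc L (coord w i)) x))
     = (\<Sum>j\<in>UNIV. LINT x|torus L. coord v i x * (dtp L (freq_box N) j (fcc L (coord w i)) x * coord w j x))" for i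
    by (intro sum.cong Bochner_Integration.integral_cong arg_cong2[of _ _ _ _ times] refl mult.commute)
  show ?thesis unfolding A B C sum_negf by (simp only: add_uminus_conv_diff)
qed

text \<open>The two wavenumber conditions may hold at different levels \<open>qu\<close> and
  \<open>qv\<close>; the spectral gap of \<open>w\<close> at the larger level \<open>q\<close> is a
  gap at both.\<close>

lemma flux_bound:
  assumes chi: "LP_cutoff chi" and r: "2 < r" "r < 3"
    and bu: "lp_bounds chi L r b qu u" "qu \<le> q" and bv: "lp_bounds chi L r b qv v" "qv \<le> q"
    and supp: "\<And>i k. fcc L (coord w i) k \<noteq> 0 \<Longrightarrow> 2 ^ q \<le> norm (freq k)"
  shows "norm (flux N) \<le> 8 * trilinear_const r * b * sqn L Gw"
proof -
  let ?c = "trilinear_const r * b"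
  let ?S = "\<lambda>i. trunc L N (coord w i)"
  let ?dS = "\<lambda>i j. dtp L (freq_box N) j (fcc L (coord w i))"
  let ?D = "\<lambda>i. \<Sum>j\<in>UNIV. sqn L (mcoord Gw i j)"
  have c0: "?c \<ge> 0" using trilinear_const_pos[OF r] lp_bounds_pos[OF bu(1)] by simp
  have su: "2 ^ qu \<le> norm (freq k)" "2 ^ qv \<le> norm (freq k)" if "fcc L (coord w i) k \<noteq> 0" for i k
    by (rule order_trans[OF power_increasing[OF bu(2)] supp[OF that]], simp,
        rule order_trans[OF power_increasing[OF bv(2)] supp[OF that]], simp)
  have D: "sqn L Gw = (\<Sum>i\<in>UNIV. ?D i)" by (rule sqn_mcoord[OF L2_Gw])
  \<comment> \<open>Each double sum counts every entry once directly and three times through the sum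
    over \<open>l\<close>; two such sums make the factor 8.\<close>
  have total: "(\<Sum>i\<in>UNIV. \<Sum>j\<in>UNIV. c * (A i j + (\<Sum>l\<in>UNIV. A i l))) + (\<Sum>i\<in>UNIV. \<Sum>j\<in>UNIV. c * (A i j + (\<Sum>l\<in>UNIV. A j l)))
     = c * (8 * (\<Sum>i\<in>UNIV. \<Sum>j\<in>UNIV. A i j))" for A :: "3 \<Rightarrow> 3 \<Rightarrow> real" and c
    by (simp add: sum_3 algebra_simps)
  have 1: "norm (LINT x|torus L. coord u j x * (mcoord Gw i j x * ?S i x)) \<le> ?c * (sqn L (mcoord Gw i j) + ?D i)" for i j
  proof -
    have "norm (LINT x|torus L. coord u j x * (mcoord Gw i j x * ?S i x))
       \<le> ?c * (sqn L (mcoord Gw i j) + L ^ 3 * (\<Sum>k\<in>freq_box N. (norm (freq k) / L)\<^sup>2 * (norm (fcc L (?S i) k))\<^sup>2))"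
    proof (rule trilinear_left[OF chi L r u bu(1) in_L2_mcoord[OF L2_Gw] _ trig_poly_tp[OF finite_freq_box]])
      show "2 ^ qu \<le> norm (freq k)" if "fcc L (mcoord Gw i j) k \<noteq> 0" for k
        using that su(1)[of i k] unfolding fcc_Gw by auto
      show "2 ^ qu \<le> norm (freq k)" if "fcc L (?S i) k \<noteq> 0" for k
        using that su(1)[of i k] unfolding fcc_trunc[OF L] by (auto split: if_splits)
    qed
    also have "(\<Sum>k\<in>freq_box N. (norm (freq k) / L)\<^sup>2 * (norm (fcc L (?S i) k))\<^sup>2)
       = (\<Sum>k\<in>freq_box N. (norm (freq k) / L)\<^sup>2 * (norm (fcc L (coord w i) k))\<^sup>2)"
      by (intro sum.cong refl) (simp only: fcc_trunc[OF L] if_True)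
    also have "?c * (sqn L (mcoord Gw i j) + L ^ 3 * \<dots>) \<le> ?c * (sqn L (mcoord Gw i j) + ?D i)"
      by (intro mult_left_mono[OF _ c0] add_left_mono dissipation_bound)
    finally show ?thesis .
  qed
  have 2: "norm (LINT x|torus L. coord v i x * (?dS i j x * coord w j x)) \<le> ?c * (sqn L (mcoord Gw i j) + ?D j)" for i j
  proof -
    have "norm (LINT x|torus L. coord v i x * (?dS i j x * coord w j x)) \<le> ?c * (sqn L (?dS i j) + ?D j)"
    proof (rule trilinear_right[OF chi L r v bv(1) trig_poly_tp[OF finite_freq_box] _ in_L2_coord[OF L2_w]])
      show "2 ^ qv \<le> norm (freq k)" if "fcc L (?dS i j) k \<noteq> 0" for k
        using that su(2)[of i k] unfolding fcc_tp[OF L finite_freq_box] by (auto split: if_splits)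
      show "2 ^ qv \<le> norm (freq k)" if "fcc L (coord w j) k \<noteq> 0" for k
        using su(2)[OF that] .
    qed (rule dissipation_bound)
    also have "sqn L (?dS i j) \<le> sqn L (mcoord Gw i j)"
      unfolding sqn_tp[OF L finite_freq_box] fcc_Gw[symmetric]
      by (rule sqn_trunc_le[OF L in_L2_mcoord[OF L2_Gw] finite_freq_box])
    finally show ?thesis using c0 by (simp add: mult_left_mono add_right_mono)
  qed
  have "norm (flux N) \<le> (\<Sum>i\<in>UNIV. \<Sum>j\<in>UNIV. ?c * (sqn L (mcoord Gw i j) + ?D i)) + (\<Sum>i\<in>UNIV. \<Sum>j\<in>UNIV. ?c * (sqn L (mcoord Gw i j) + ?D j))"
    unfolding flux_eq
    by (rule order_trans[OF norm_triangle_ineq4], rule add_mono; intro order_trans[OF norm_sum] sum_mono 1 2)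
  also have "\<dots> = ?c * (8 * sqn L Gw)"
    unfolding D by (rule total)
  finally show ?thesis by (simp add: mult_ac)
qed

end

section \<open>Squares of absolutely continuous functions\<close>

lemma continuous_borel_measurable_lebesgue_on:
  fixes c :: "real \<Rightarrow> 'b::euclidean_space"
  shows "continuous_on {a..b} c \<Longrightarrow> c \<in> borel_measurable (lebesgue_on {a..b})"
  by (rule continuous_imp_measurable_on_sets_lebesgue) auto

lemma integrable_continuous_mult:
  fixes c h :: "real \<Rightarrow> real"
  assumes c: "continuous_on {a..b} c" and h: "integrable (lebesgue_on {a..b}) h"
  shows "integrable (lebesgue_on {a..b}) (\<lambda>x. c x * h x)"
proof -
  have "bounded (c ` {a..b})"
    by (intro compact_imp_bounded compact_continuous_image c compact_Icc)
  then obtain B where B: "\<And>x. x \<in> {a..b} \<Longrightarrow> \<bar>c x\<bar> \<le> B"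
    unfolding bounded_iff real_norm_def by blast
  have i: "integrable (lebesgue_on {a..b}) (\<lambda>x. B * \<bar>h x\<bar>)" using h by simp
  show ?thesis
  proof (rule Bochner_Integration.integrable_bound[OF i])
    show "(\<lambda>x. c x * h x) \<in> borel_measurable (lebesgue_on {a..b})"
      using continuous_borel_measurable_lebesgue_on[OF c] h by auto
    have "norm (c x * h x) \<le> norm (B * \<bar>h x\<bar>)" if "x \<in> {a..b}" for x
    proof -
      have "\<bar>c x\<bar> * \<bar>h x\<bar> \<le> \<bar>B\<bar> * \<bar>h x\<bar>" using B[OF that] by (intro mult_right_mono) auto
      then show ?thesis by (simp add: abs_mult)
    qed
    then show "AE x in lebesgue_on {a..b}. norm (c x * h x) \<le> norm (B * \<bar>h x\<bar>)"
      by (intro AE_I2) simp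
  qed
qed

text \<open>The chain rule for the square of an indefinite Lebesgue integral, where \<open>h\<close>
  is merely integrable. The defect of the identity is additive over intervals and quadratically
  small on short ones, hence zero.\<close>

lemma square_increment:
  fixes c h :: "real \<Rightarrow> real"
  assumes h: "integrable (lebesgue_on {0..T}) h"
    and c: "\<And>t. t \<in> {0..T} \<Longrightarrow> c t = c 0 - (LINT x|lebesgue_on {0..t}. h x)"
    and st: "0 \<le> s" "s \<le> t" "t \<le> T"
  shows "(c t)\<^sup>2 - (c s)\<^sup>2 = - 2 * (LINT x|lebesgue_on {s..t}. c x * h x)"
    and "continuous_on {0..T} c"
proof -
  have "continuous_on {0..T} (\<lambda>t. c 0 - (LINT x|lebesgue_on {0..t}. h x))"
    by (intro continuous_intros indefinite_integral_continuous_real h)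
  then show cont: "continuous_on {0..T} c"
    by (rule continuous_on_eq) (simp add: c[symmetric])
  have ch: "integrable (lebesgue_on {0..T}) (\<lambda>x. c x * h x)" by (rule integrable_continuous_mult[OF cont h])
  have ah: "integrable (lebesgue_on {0..T}) (\<lambda>x. \<bar>h x\<bar>)" using h by simp
  define I where "I f a b = (LINT x|lebesgue_on {a..b}. f x)" for f :: "real \<Rightarrow> real" and a b
  have comb: "I f a d = I f a b + I f b d" if "integrable (lebesgue_on {0..T}) f" "0 \<le> a" "a \<le> b" "b \<le> d" "d \<le> T" for f a b d
    unfolding I_def using that
    by (intro Equivalence_Measurable_On_Borel.integral_combine integrable_subinterval[OF that(1)]) auto
  have sub: "integrable (lebesgue_on {a..b}) f" if "integrable (lebesgue_on {0..T}) f" "0 \<le> a" "b \<le> T" for f :: "real \<Rightarrow> real" and a b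
    using that by (intro integrable_subinterval[OF that(1)]) auto
  define K where "K a b = I (\<lambda>x. \<bar>h x\<bar>) a b" for a b
  have K0: "K a b \<ge> 0" for a b unfolding K_def I_def by (rule integral_nonneg_AE) simp
  have cd: "c b - c a = - I h a b" if "0 \<le> a" "a \<le> b" "b \<le> T" for a b
    using c[of a] c[of b] comb[OF h, of 0 a b] that unfolding I_def by simp
  have cK: "\<bar>c b - c a\<bar> \<le> K a b" if "0 \<le> a" "a \<le> b" "b \<le> T" for a b
    unfolding cd[OF that] K_def I_def abs_minus_cancel by (rule integral_abs_bound)
  \<comment> \<open>On the interval from \<open>a\<close> to \<open>b\<close> the mean of
    \<open>c a\<close> and \<open>c b\<close> differs from \<open>c x\<close> by at most
    \<open>K a b\<close>, which makes the error quadratic in \<open>K\<close>.\<close>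
  have quad: "\<bar>(c b)\<^sup>2 - (c a)\<^sup>2 + 2 * I (\<lambda>x. c x * h x) a b\<bar> \<le> 2 * (K a b)\<^sup>2" if ab: "0 \<le> a" "a \<le> b" "b \<le> T" for a b
  proof -
    have "(c b)\<^sup>2 - (c a)\<^sup>2 = (c b + c a) * (c b - c a)" by (simp add: power2_eq_square algebra_simps)
    then have "(c b)\<^sup>2 - (c a)\<^sup>2 + 2 * I (\<lambda>x. c x * h x) a b = I (\<lambda>x. 2 * (c x * h x) - (c b + c a) * h x) a b"
      unfolding cd[OF ab] I_def using sub[OF h ab(1,3)] sub[OF ch ab(1,3)] by simp
    also have "\<bar>\<dots>\<bar> \<le> I (\<lambda>x. \<bar>2 * (c x * h x) - (c b + c a) * h x\<bar>) a b"
      unfolding I_def by (rule integral_abs_bound)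
    also have "\<dots> \<le> I (\<lambda>x. 2 * K a b * \<bar>h x\<bar>) a b"
      unfolding I_def
    proof (rule integral_mono)
      fix x assume "x \<in> space (lebesgue_on {a..b})"
      then have x: "a \<le> x" "x \<le> b" by auto
      have "K a x \<le> K a b" "K x b \<le> K a b"
        using comb[OF ah, of a x b] x ab K0[of a x] K0[of x b] unfolding K_def by auto
      then have "\<bar>2 * c x - (c b + c a)\<bar> \<le> 2 * K a b"
        using cK[of a x] cK[of x b] x ab by linarith
      then have "\<bar>2 * c x - (c b + c a)\<bar> * \<bar>h x\<bar> \<le> 2 * K a b * \<bar>h x\<bar>" by (rule mult_right_mono) simp
      then show "\<bar>2 * (c x * h x) - (c b + c a) * h x\<bar> \<le> 2 * K a b * \<bar>h x\<bar>"
        by (simp add: abs_mult[symmetric] algebra_simps)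
    qed (use sub[OF h ab(1,3)] sub[OF ch ab(1,3)] sub[OF ah ab(1,3)] in auto)
    also have "\<dots> = 2 * K a b * K a b" by (simp add: I_def K_def)
    finally show ?thesis by (simp add: power2_eq_square)
  qed
  define R where "R a b = (c b)\<^sup>2 - (c a)\<^sup>2 + 2 * I (\<lambda>x. c x * h x) a b" for a b
  \<comment> \<open>\<open>R\<close> and \<open>K\<close> are additive over adjacent intervals, so
    by bisection it suffices to prove the bound on short intervals around each point.\<close>
  have "\<bar>R s t\<bar> \<le> e * K s t" if e: "e > 0" for e
  proof -
    have "0 \<le> s \<longrightarrow> t \<le> T \<longrightarrow> s \<le> t \<longrightarrow> \<bar>R s t\<bar> \<le> e * K s t"
    proof (induction rule: Bolzano[OF st(2)])
      case (1 a b d)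
      show ?case
      proof (intro impI)
        assume A: "0 \<le> a" "d \<le> T" "a \<le> d"
        have "R a d = R a b + R b d" "K a d = K a b + K b d"
          unfolding R_def K_def using comb[OF ch, of a b d] comb[OF ah, of a b d] A 1 by auto
        moreover have "\<bar>R a b\<bar> \<le> e * K a b" "\<bar>R b d\<bar> \<le> e * K b d" using 1 A by auto
        ultimately show "\<bar>R a d\<bar> \<le> e * K a d" using abs_triangle_ineq[of "R a b" "R b d"] by (simp add: distrib_left)
      qed
    next
      case (2 x)
      have Kc: "continuous_on {0..T} (\<lambda>y. K 0 y)"
        unfolding K_def I_def by (rule indefinite_integral_continuous_real[OF ah])
      \<comment> \<open>A variation below \<open>e / 4\<close> on each side of \<open>x\<close>
        gives \<open>K a b \<le> e / 2\<close>, and then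
        \<open>2 * (K a b)\<^sup>2 \<le> e * K a b\<close>.\<close>
      have "x \<in> {0..T}" "e / 4 > 0" using 2 st e by auto
      from Kc[unfolded continuous_on_iff, rule_format, OF this]
      obtain d where d: "d > 0" "\<And>y. y \<in> {0..T} \<Longrightarrow> dist y x < d \<Longrightarrow> dist (K 0 y) (K 0 x) < e / 4"
        by blast
      show ?case
      proof (intro exI[of _ d] conjI d(1) allI impI)
        fix a b assume A: "a \<le> x \<and> x \<le> b \<and> b - a < d" "0 \<le> a" "b \<le> T" "a \<le> b"
        have "dist (K 0 a) (K 0 x) < e / 4"
          by (rule d(2)) (use A in \<open>auto simp: dist_real_def\<close>)
        moreover have "dist (K 0 b) (K 0 x) < e / 4"
          by (rule d(2)) (use A in \<open>auto simp: dist_real_def\<close>)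
        moreover have "K 0 b = K 0 a + K a b" unfolding K_def using comb[OF ah, of 0 a b] A by auto
        ultimately have k: "K a b \<le> e / 2" unfolding dist_real_def by linarith
        have "\<bar>R a b\<bar> \<le> 2 * (K a b)\<^sup>2" unfolding R_def using A by (intro quad) auto
        also have "\<dots> = 2 * K a b * K a b" by (simp add: power2_eq_square)
        also have "\<dots> \<le> e * K a b" using k K0[of a b] by (intro mult_right_mono) auto
        finally show "\<bar>R a b\<bar> \<le> e * K a b" .
      qed
    qed
    then show ?thesis using st by simp
  qed
  then have lim: "\<bar>R s t\<bar> \<le> inverse (real (Suc n)) * K s t" for n by simp
  have "(\<lambda>n. inverse (real (Suc n)) * K s t) \<longlonglongrightarrow> 0 * K s t"
    by (intro tendsto_mult tendsto_const LIMSEQ_inverse_real_of_nat)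
  then have "\<bar>R s t\<bar> \<le> 0" using lim by (intro LIMSEQ_le_const[where X="\<lambda>n. inverse (real (Suc n)) * K s t"]) auto
  then show "(c t)\<^sup>2 - (c s)\<^sup>2 = - 2 * (LINT x|lebesgue_on {s..t}. c x * h x)"
    by (simp add: R_def I_def)
qed

lemma norm_square_increment:
  fixes z y :: "real \<Rightarrow> complex"
  assumes y: "integrable (lebesgue_on {0..T}) y"
    and z: "\<And>t. t \<in> {0..T} \<Longrightarrow> z t = z 0 - (LINT x|lebesgue_on {0..t}. y x)"
    and st: "0 \<le> s" "s \<le> t" "t \<le> T"
  shows "(norm (z t))\<^sup>2 - (norm (z s))\<^sup>2 = - 2 * (LINT x|lebesgue_on {s..t}. Re (cnj (z x) * y x))"
    and "integrable (lebesgue_on {s..t}) (\<lambda>x. Re (cnj (z x) * y x))"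
proof -
  have sub: "integrable (lebesgue_on {0..t}) y" if "t \<in> {0..T}" for t
    using that by (intro integrable_subinterval[OF y]) auto
  have re: "integrable (lebesgue_on {0..T}) (\<lambda>x. Re (y x))" and im: "integrable (lebesgue_on {0..T}) (\<lambda>x. Im (y x))"
    using y by auto
  have re': "Re (z t) = Re (z 0) - (LINT x|lebesgue_on {0..t}. Re (y x))" if "t \<in> {0..T}" for t
    using arg_cong[OF z[OF that], of Re] integral_Re[OF sub[OF that]] by simp
  have im': "Im (z t) = Im (z 0) - (LINT x|lebesgue_on {0..t}. Im (y x))" if "t \<in> {0..T}" for t
    using arg_cong[OF z[OF that], of Im] integral_Im[OF sub[OF that]] by simp
  note R = square_increment[where c="\<lambda>t. Re (z t)", OF re re' st] and I = square_increment[where c="\<lambda>t. Im (z t)", OF im im' st]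
  have iR: "integrable (lebesgue_on {s..t}) (\<lambda>x. Re (z x) * Re (y x))"
    using st by (intro integrable_subinterval[OF integrable_continuous_mult[OF R(2) re(1)]]) auto
  have iI: "integrable (lebesgue_on {s..t}) (\<lambda>x. Im (z x) * Im (y x))"
    using st by (intro integrable_subinterval[OF integrable_continuous_mult[OF I(2) im(1)]]) auto
  have e: "Re (cnj (z x) * y x) = Re (z x) * Re (y x) + Im (z x) * Im (y x)" for x by simp
  show "integrable (lebesgue_on {s..t}) (\<lambda>x. Re (cnj (z x) * y x))"
    unfolding e using iR iI by simp
  have "(norm (z t))\<^sup>2 - (norm (z s))\<^sup>2 = ((Re (z t))\<^sup>2 - (Re (z s))\<^sup>2) + ((Im (z t))\<^sup>2 - (Im (z s))\<^sup>2)"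
    by (simp add: cmod_power2)
  also have "\<dots> = - 2 * (LINT x|lebesgue_on {s..t}. Re (cnj (z x) * y x))"
    using R(1) I(1) iR iI unfolding e by simp
  finally show "(norm (z t))\<^sup>2 - (norm (z s))\<^sup>2 = - 2 * (LINT x|lebesgue_on {s..t}. Re (cnj (z x) * y x))" .
qed

section \<open>The flux at a time when the low modes agree\<close>

text \<open>The levels are discrete: an infimum of at most \<open>lam L (int q)\<close> lies
  strictly below \<open>lam L (int (q + 1))\<close>, and strictness supplies an admissible level,
  which then cannot exceed \<open>q\<close>.\<close>

lemma det_wavenumber_lp_bounds:
  assumes L: "L > 0" and le: "det_wavenumber chi L \<nu> c r g \<le> ereal (lam L (int q))"
  shows "\<exists>q'\<le>q. lp_bounds chi L r (c * \<nu>) q' g"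
proof -
  have "lam L (int q) < lam L (int (q + 1))"
    unfolding lam_nat using L by (intro divide_strict_right_mono) auto
  then have "det_wavenumber chi L \<nu> c r g < ereal (lam L (int (q + 1)))"
    using le by (simp only: order.strict_trans1 less_ereal.simps(1))
  then obtain q' :: nat where q': "lp_bounds chi L r (c * \<nu>) q' g" "ereal (lam L (int q')) < ereal (lam L (int (q + 1)))"
    unfolding det_wavenumber_def Inf_less_iff lp_bounds_def by blast
  then have "(2::real) ^ q' < 2 ^ (q + 1)" using L unfolding lam_nat by (simp add: divide_less_cancel)
  then have "q' < q + 1" by (rule power_less_imp_less_exp[rotated]) simp
  then show ?thesis using q'(1) by (intro exI[of _ q']) simp
qed

lemma fcc_cong_AE:
  assumes "g \<in> borel_measurable (torus L)" "h \<in> borel_measurable (torus L)" "AE x in torus L. g x = h x"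
  shows "fcc L g k = fcc L h k"
proof -
  have "(LINT x|torus L. g x * ek L (- k) x) = (LINT x|torus L. h x * ek L (- k) x)"
    by (rule integral_cong_AE) (use assms measurable_ek[of L "- k"] in auto)
  then show ?thesis by (simp add: fcc_def)
qed

context two_fields
begin

text \<open>Below \<open>2 ^ q\<close> the low-frequency multiplier equals 1, so agreement of the
  smooth low parts is agreement of the Fourier coefficients themselves.\<close>

lemma fcc_w_support:
  assumes chi: "LP_cutoff chi" and eq: "AE x in torus L. LP_low chi L (enat q) u x = LP_low chi L (enat q) v x"
    and nz: "fcc L (coord w i) k \<noteq> 0"
  shows "2 ^ q \<le> norm (freq k)"
proof (rule ccontr)
  assume "\<not> 2 ^ q \<le> norm (freq k)"
  then have k: "norm (freq k) < 2 ^ q" by simp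
  have "(2::real) ^ q \<le> 2 ^ (q + 1)" by simp
  then have kb: "k \<in> freq_box (2 ^ (q + 1))" using k by (intro ball_subset_freq_box) linarith
  have chi1: "chi (freq k /\<^sub>R 2 ^ (q + 1)) = 1"
  proof (rule chi_values(1)[OF chi])
    have "(0::real) < 2 ^ q" by simp
    then show "norm (freq k) \<le> 3 / 4 * 2 ^ (q + 1)" using k unfolding power_add power_one_right by linarith
  qed
  have lf: "fcc L (\<lambda>x. LP_low chi L (enat q) g x $ i) k = fcc L (coord g i) k" for g
    unfolding LP_low_nth[OF chi] fcc_tp[OF L finite_freq_box] using kb chi1 by simp
  have "fcc L (\<lambda>x. LP_low chi L (enat q) u x $ i) k = fcc L (\<lambda>x. LP_low chi L (enat q) v x $ i) k"
  proof (rule fcc_cong_AE)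
    show "AE x in torus L. LP_low chi L (enat q) u x $ i = LP_low chi L (enat q) v x $ i"
      by (rule eventually_mono[OF eq]) simp
  qed (unfold LP_low_nth[OF chi], rule measurable_tp, rule measurable_tp)
  then show False using nz unfolding lf fcc_w by simp
qed

lemma flux_bound_det:
  assumes chi: "LP_cutoff chi" and r: "2 < r" "r < 3" and c: "c > 0" "\<nu> > 0"
    and Q: "max (det_wavenumber chi L \<nu> c r u) (det_wavenumber chi L \<nu> c r v) = lam_ext L Q"
    and eq: "AE x in torus L. LP_low chi L Q u x = LP_low chi L Q v x"
  shows "norm (flux N) \<le> 8 * trilinear_const r * (c * \<nu>) * sqn L Gw"
proof (cases Q)
  case (enat q)
  have "lam_ext L Q = ereal (lam L (int q))" unfolding enat lam_ext_def enat.case ..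
  with Q have "max (det_wavenumber chi L \<nu> c r u) (det_wavenumber chi L \<nu> c r v) \<le> ereal (lam L (int q))"
    by (simp only: order_refl)
  then have d: "det_wavenumber chi L \<nu> c r u \<le> ereal (lam L (int q))" "det_wavenumber chi L \<nu> c r v \<le> ereal (lam L (int q))"
    by (simp_all only: max.bounded_iff)
  obtain qu where qu: "qu \<le> q \<and> lp_bounds chi L r (c * \<nu>) qu u"
    using det_wavenumber_lp_bounds[OF L d(1)] ..
  obtain qv where qv: "qv \<le> q \<and> lp_bounds chi L r (c * \<nu>) qv v"
    using det_wavenumber_lp_bounds[OF L d(2)] ..
  show ?thesis
    by (rule flux_bound[OF chi r conjunct2[OF qu] conjunct1[OF qu] conjunct2[OF qv] conjunct1[OF qv]
          fcc_w_support[OF chi eq[unfolded enat]]])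
next
  \<comment> \<open>Here \<open>LP_low\<close> is the field itself, so \<open>w\<close> vanishes
    almost everywhere and the flux is zero.\<close>
  case infinity
  have z: "fcc L (coord w i) k = 0" for i k
  proof -
    have "coord u i x = coord v i x" if "LP_low chi L Q u x = LP_low chi L Q v x" for x
      using arg_cong[OF that, of "\<lambda>z. z $ i"] unfolding infinity by (simp add: LP_low_def)
    then have "AE x in torus L. coord u i x = coord v i x"
      by (rule eventually_mono[OF eq])
    then have "fcc L (coord u i) k = fcc L (coord v i) k"
      by (intro fcc_cong_AE in_L2_measurable in_L2_coord u v)
    then show ?thesis unfolding fcc_w by simp
  qed
  have t0: "trunc L N (coord w i) x = 0" for i x
    unfolding tp_def by (simp only: z mult_zero_left sum.neutral_const)
  have "flux N = 0" unfolding flux_def t0 by simp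
  moreover have "0 \<le> 8 * trilinear_const r * (c * \<nu>) * sqn L Gw"
    using trilinear_const_pos[OF r] c by (intro mult_nonneg_nonneg sqn_nonneg) auto
  ultimately show ?thesis by (simp only: norm_zero)
qed

end

section \<open>The Fourier coefficients of a weak solution\<close>

lemma divergence_trig: "divergence (trig L k a b) x = 2 * pi / L * (freq k \<bullet> trig L k b (- a) x)"
  unfolding divergence_def jacobian_def trig_derivative trace_def matrix_def
  by (simp add: phase_axis inner_vec_def freq_def sum_distrib_left mult_ac)

lemma test_field_trig:
  assumes L: "L > 0" and a: "freq k \<bullet> a = 0" and b: "freq k \<bullet> b = 0"
  shows "test_field L T (\<lambda>s. trig L k a b)"
proof -
  have l: "bounded_linear (\<lambda>z::real \<times> (real^3). phase L k (snd z))"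
    by (rule bounded_linear_compose[OF bounded_linear_phase bounded_linear_snd])
  have "smooth_on ({0..T} \<times> UNIV) (\<lambda>(s::real, x). trig L k a b x)"
  proof -
    have "(\<lambda>(s::real, x). trig L k a b x) = (\<lambda>z. cos (phase L k (snd z)) *\<^sub>R a + sin (phase L k (snd z)) *\<^sub>R b)"
      by (auto simp: trig_def)
    then show ?thesis using Ck_on_trig[OF l, of _ _ a b] by (simp only: smooth_on_def) blast
  qed
  moreover have "divergence (trig L k a b) x = 0" for x
    using a b by (simp add: divergence_trig trig_def inner_add_right inner_diff_right)
  ultimately show ?thesis using periodic_trig[OF L, of k a b] by (simp add: test_field_def)
qed

lemma L2_inner_trig:
  assumes L: "L > 0" and g: "\<And>i. integrable (torus L) (\<lambda>x. g x $ i)"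
  shows "L2_inner L g (trig L k e 0) = L ^ 3 * Re (\<Sum>i\<in>UNIV. of_real (e $ i) * fcc L (coord g i) k)"
    and "L2_inner L g (trig L k 0 e) = - (L ^ 3 * Im (\<Sum>i\<in>UNIV. of_real (e $ i) * fcc L (coord g i) k))"
proof -
  have ic: "integrable (torus L) (\<lambda>x. g x $ i * cos (phase L k x))" and si: "integrable (torus L) (\<lambda>x. g x $ i * sin (phase L k x))" for i
    by (rule Bochner_Integration.integrable_bound[OF g[of i]],
        use g continuous_measurable_torus[OF linear_continuous_on[OF bounded_linear_phase, of UNIV L k], of L] in
          \<open>auto simp: abs_mult mult_left_le intro!: borel_measurable_times borel_measurable_continuous_on[of cos] borel_measurable_continuous_on[of sin] continuous_intros\<close>)+
  have f: "Re (fcc L (coord g i) k) = (LINT x|torus L. g x $ i * cos (phase L k x)) / L ^ 3"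
          "Im (fcc L (coord g i) k) = - (LINT x|torus L. g x $ i * sin (phase L k x)) / L ^ 3" for i
    using fcc_trig[OF L g, of i k] L by (auto simp: complex_eq_iff field_simps)
  have "L2_inner L g (trig L k e 0) = (LINT x|torus L. (\<Sum>i\<in>UNIV. e $ i * (g x $ i * cos (phase L k x))))"
    by (simp add: L2_inner_def inner_vec_def trig_def mult_ac)
  also have "\<dots> = (\<Sum>i\<in>UNIV. e $ i * (LINT x|torus L. g x $ i * cos (phase L k x)))"
    using ic by (subst Bochner_Integration.integral_sum) auto
  finally show "L2_inner L g (trig L k e 0) = L ^ 3 * Re (\<Sum>i\<in>UNIV. of_real (e $ i) * fcc L (coord g i) k)"
    using L by (simp add: f sum_distrib_left)
  have "L2_inner L g (trig L k 0 e) = (LINT x|torus L. (\<Sum>i\<in>UNIV. e $ i * (g x $ i * sin (phase L k x))))"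
    by (simp add: L2_inner_def inner_vec_def trig_def mult_ac)
  also have "\<dots> = (\<Sum>i\<in>UNIV. e $ i * (LINT x|torus L. g x $ i * sin (phase L k x)))"
    using si by (subst Bochner_Integration.integral_sum) auto
  finally show "L2_inner L g (trig L k 0 e) = - (L ^ 3 * Im (\<Sum>i\<in>UNIV. of_real (e $ i) * fcc L (coord g i) k))"
    using L by (simp add: f sum_distrib_left sum_negf)
qed

text \<open>A single mode is an eigenfunction of minus the Laplacian with eigenvalue
  \<open>\<mu>\<close>. The derivative is moved onto it through
  \<open>fcc_weak_grad\<close>.\<close>

lemma L2_inner_jacobian_trig:
  fixes k :: "int^3"
  assumes L: "L > 0" and u: "in_L2 L u" and G: "has_weak_grad L u G"
  defines "\<mu> \<equiv> (2 * pi / L)\<^sup>2 * (norm (freq k))\<^sup>2"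
  shows "L2_inner L G (\<lambda>x. jacobian (trig L k e 0) (at x)) = \<mu> * L2_inner L u (trig L k e 0)"
    and "L2_inner L G (\<lambda>x. jacobian (trig L k 0 e) (at x)) = \<mu> * L2_inner L u (trig L k 0 e)"
proof -
  let ?K = "\<lambda>j. 2 * pi / L * of_int (k $ j)"
  \<comment> \<open>The column \<open>j\<close> of \<open>G\<close> is the vector field of the
    derivatives in direction \<open>j\<close>, so that \<open>L2_inner_trig\<close> applies to
    it.\<close>
  define col where "col j x = (\<chi> i. G x $ i $ j)" for j x
  have G2: "in_L2 L G" using G by (simp add: has_weak_grad_def)
  have coli: "integrable (torus L) (\<lambda>x. col j x $ i)" for i j
    unfolding col_def using in_L2_mcoord_integrable[OF G2] by simp
  have ui: "integrable (torus L) (\<lambda>x. u x $ i)" for i by (rule in_L2_coord_integrable[OF u])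
  have colf: "fcc L (coord (col j) i) k = \<i> * of_real (?K j) * fcc L (coord u i) k" for i j
    unfolding col_def using fcc_weak_grad[OF L u G] by simp
  have tint: "integrable (torus L) (\<lambda>x. col j x \<bullet> trig L k a b x)" for j a b
  proof -
    have "integrable (torus L) (\<lambda>x. col j x $ i * trig L k a b x $ i)" for i
    proof (rule Bochner_Integration.integrable_bound)
      show "integrable (torus L) (\<lambda>x. (\<bar>a $ i\<bar> + \<bar>b $ i\<bar>) * col j x $ i)" using coli by simp
      have "continuous_on UNIV (\<lambda>x. trig L k a b x $ i)"
        unfolding trig_def by (intro continuous_intros linear_continuous_on bounded_linear_phase)
      then show "(\<lambda>x. col j x $ i * trig L k a b x $ i) \<in> borel_measurable (torus L)"
        by (rule borel_measurable_times[OF borel_measurable_integrable[OF coli] continuous_measurable_torus])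
      have "\<bar>trig L k a b x $ i\<bar> \<le> \<bar>a $ i\<bar> + \<bar>b $ i\<bar>" for x
      proof -
        have "\<bar>trig L k a b x $ i\<bar> \<le> \<bar>cos (phase L k x)\<bar> * \<bar>a $ i\<bar> + \<bar>sin (phase L k x)\<bar> * \<bar>b $ i\<bar>"
          by (simp add: trig_def abs_mult[symmetric] abs_triangle_ineq)
        also have "\<dots> \<le> 1 * \<bar>a $ i\<bar> + 1 * \<bar>b $ i\<bar>"
          by (intro add_mono mult_right_mono) auto
        finally show ?thesis by simp
      qed
      then show "AE x in torus L. norm (col j x $ i * trig L k a b x $ i) \<le> norm ((\<bar>a $ i\<bar> + \<bar>b $ i\<bar>) * col j x $ i)"
        by (intro AE_I2) (simp add: abs_mult mult.commute mult_left_mono)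
    qed
    then show ?thesis unfolding inner_vec_def by simp
  qed
  have main: "L2_inner L G (\<lambda>x. jacobian (trig L k a b) (at x)) = (\<Sum>j\<in>UNIV. ?K j * L2_inner L (col j) (trig L k b (- a)))" for a b
  proof -
    have "G x \<bullet> jacobian (trig L k a b) (at x) = (\<Sum>j\<in>UNIV. ?K j * (col j x \<bullet> trig L k b (- a) x))" for x
      unfolding jacobian_def trig_derivative matrix_def inner_vec_def col_def
      by (subst sum.swap) (simp add: phase_axis sum_distrib_left mult_ac)
    then show ?thesis using tint unfolding L2_inner_def
      by (simp add: Bochner_Integration.integral_sum)
  qed
  have muK: "(\<Sum>j\<in>UNIV. (?K j)\<^sup>2) = \<mu>"
    unfolding \<mu>_def norm_vec_def L2_set_def power_mult_distrib
    by (subst real_sqrt_pow2) (auto intro: sum_nonneg simp: freq_def sum_distrib_left)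
  let ?z = "\<Sum>i\<in>UNIV. of_real (e $ i) * fcc L (coord u i) k"
  have colz: "(\<Sum>i\<in>UNIV. of_real (e' $ i) * fcc L (coord (col j) i) k) = \<i> * of_real (?K j) * (\<Sum>i\<in>UNIV. of_real (e' $ i) * fcc L (coord u i) k)" for j and e' :: "real^3"
    unfolding colf by (simp add: sum_distrib_left mult_ac)
  have "L2_inner L G (\<lambda>x. jacobian (trig L k e 0) (at x)) = (\<Sum>j\<in>UNIV. (?K j)\<^sup>2 * (L ^ 3 * Re ?z))"
    unfolding main L2_inner_trig(2)[OF L coli] colz
    by (intro sum.cong refl) (simp add: sum_negf power2_eq_square)
  then show "L2_inner L G (\<lambda>x. jacobian (trig L k e 0) (at x)) = \<mu> * L2_inner L u (trig L k e 0)"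
    unfolding L2_inner_trig(1)[OF L ui] muK[symmetric] by (simp only: sum_distrib_right)
  have "L2_inner L G (\<lambda>x. jacobian (trig L k 0 e) (at x)) = (\<Sum>j\<in>UNIV. (?K j)\<^sup>2 * - (L ^ 3 * Im ?z))"
    unfolding main minus_zero L2_inner_trig(1)[OF L coli] colz
    by (intro sum.cong refl) (simp add: power2_eq_square)
  then show "L2_inner L G (\<lambda>x. jacobian (trig L k 0 e) (at x)) = \<mu> * L2_inner L u (trig L k 0 e)"
    unfolding L2_inner_trig(2)[OF L ui] muK[symmetric] by (simp only: sum_distrib_right)
qed

text \<open>Lebesgue measure is complete. This matters because \<open>weak_grad\<close> is chosen
  separately at each time: measurability in time of expressions containing it comes from agreement
  almost everywhere with a function known to be measurable.\<close>

lemma borel_measurable_lebesgue_on_AE: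
  fixes f g :: "real \<Rightarrow> 'b::euclidean_space"
  assumes f: "f \<in> borel_measurable (lebesgue_on {a..b})" and ae: "AE x in lebesgue_on {a..b}. f x = g x"
  shows "g \<in> borel_measurable (lebesgue_on {a..b})"
proof -
  have "(\<lambda>x. if x \<in> {a..b} then f x else 0) \<in> borel_measurable lebesgue"
    using f by (subst borel_measurable_if) auto
  moreover have "AE x in lebesgue. (if x \<in> {a..b} then f x else 0) = (if x \<in> {a..b} then g x else 0)"
    using ae by (subst (asm) AE_restrict_space_iff) (auto elim: eventually_mono)
  ultimately have "(\<lambda>x. if x \<in> {a..b} then g x else 0) \<in> borel_measurable lebesgue"
    by (rule borel_measurable_AE)
  then show ?thesis by (subst (asm) borel_measurable_if) auto
qed

lemma AE_lebesgue_on_subset: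
  assumes "AE x in lebesgue_on {a..b::real}. P x" "{c..d} \<subseteq> {a..b}"
  shows "AE x in lebesgue_on {c..d}. P x"
proof -
  have "AE x in lebesgue. x \<in> {a..b} \<longrightarrow> P x"
    using assms(1) by (subst (asm) AE_restrict_space_iff) auto
  then have "AE x in lebesgue. x \<in> {c..d} \<longrightarrow> P x"
    by (rule eventually_mono) (use assms(2) in auto)
  then show ?thesis by (subst AE_restrict_space_iff) auto
qed

lemma continuous_fcc_coord:
  assumes L: "L > 0" and u: "weakly_continuous_L2 L T u"
  shows "continuous_on {0..T} (\<lambda>t. fcc L (coord (u t) i) k)"
proof -
  have tr: "in_L2 L (trig L k a b)" for a b :: "real^3"
  proof (rule in_L2_bounded[where B="norm a + norm b"])
    have "continuous_on UNIV (trig L k a b)"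
      unfolding trig_def[abs_def] by (intro continuous_intros linear_continuous_on bounded_linear_phase)
    then show "trig L k a b \<in> borel_measurable (torus L)" by (rule continuous_measurable_torus)
    fix x
    have "norm (trig L k a b x) \<le> \<bar>cos (phase L k x)\<bar> * norm a + \<bar>sin (phase L k x)\<bar> * norm b"
      unfolding trig_def by (rule order_trans[OF norm_triangle_ineq]) simp
    also have "\<dots> \<le> 1 * norm a + 1 * norm b" by (intro add_mono mult_right_mono) auto
    finally show "norm (trig L k a b x) \<le> norm a + norm b" by simp
  qed
  have e: "fcc L (coord (u t) i) k = Complex (L2_inner L (u t) (trig L k (axis i 1) 0) / L ^ 3) (- (L2_inner L (u t) (trig L k 0 (axis i 1)) / L ^ 3))"
    if "t \<in> {0..T}" for t
  proof -
    have "in_L2 L (u t)" using u that by (simp add: weakly_continuous_L2_def)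
    note i = L2_inner_trig[OF L in_L2_coord_integrable[OF this], of k "axis i 1"]
    have "(\<Sum>j\<in>UNIV. of_real (axis i 1 $ j) * fcc L (coord (u t) j) k) = (\<Sum>j\<in>UNIV. if j = i then fcc L (coord (u t) j) k else 0)"
      by (intro sum.cong) (auto simp: axis_def)
    then have "(\<Sum>j\<in>UNIV. of_real (axis i 1 $ j) * fcc L (coord (u t) j) k) = fcc L (coord (u t) i) k" by simp
    then show ?thesis using i L by (simp add: complex_eq_iff)
  qed
  have "continuous_on {0..T} (\<lambda>t. L2_inner L (u t) (trig L k a b))" for a b
    using u tr by (simp add: weakly_continuous_L2_def)
  then have "continuous_on {0..T} (\<lambda>t. Complex (L2_inner L (u t) (trig L k (axis i 1) 0) / L ^ 3) (- (L2_inner L (u t) (trig L k 0 (axis i 1)) / L ^ 3)))"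
    using L unfolding Complex_eq by (intro continuous_intros) auto
  then show ?thesis by (rule continuous_on_eq) (simp add: e)
qed

definition nonlin :: "real \<Rightarrow> (real^3 \<Rightarrow> real^3) \<Rightarrow> 3 \<Rightarrow> 3 \<Rightarrow> int^3 \<Rightarrow> complex" where
  "nonlin L u i j k = fcc L (\<lambda>x. mcoord (weak_grad L u) i j x * coord u j x) k"

lemma H1_norm_sq: "(H1_norm L g)\<^sup>2 = sqn L g + sqn L (weak_grad L g)"
  unfolding H1_norm_def Lp_norm_2 by simp

lemma sqn_coord_le: "in_L2 L g \<Longrightarrow> sqn L (coord g i) \<le> sqn L g"
  unfolding sqn_coord by (rule member_le_sum) auto

lemma sqn_mcoord_le: assumes "in_L2 L G" shows "sqn L (mcoord G i j) \<le> sqn L G"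
proof -
  have "sqn L (mcoord G i j) \<le> (\<Sum>j\<in>UNIV. sqn L (mcoord G i j))" by (rule member_le_sum) auto
  also have "\<dots> \<le> sqn L G" unfolding sqn_mcoord[OF assms] by (rule member_le_sum) (auto intro: sum_nonneg)
  finally show ?thesis .
qed

lemma norm_nonlin_le:
  assumes L: "L > 0" and u: "in_L2 L u" and G: "in_L2 L (weak_grad L u)"
  shows "norm (nonlin L u i j k) \<le> (H1_norm L u)\<^sup>2 / L ^ 3"
proof -
  have uek: "in_L2 L (\<lambda>x. coord u j x * ek L (- k) x)" "sqn L (\<lambda>x. coord u j x * ek L (- k) x) = sqn L (coord u j)"
    using in_L2_mult_trig_poly[OF in_L2_coord[OF u] trig_poly_ek[of "{- k}" "- k" L]] by (auto simp: sqn_def norm_mult)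
  have "norm (LINT x|torus L. mcoord (weak_grad L u) i j x * (coord u j x * ek L (- k) x))
     \<le> (1 * sqn L (mcoord (weak_grad L u) i j) + sqn L (\<lambda>x. coord u j x * ek L (- k) x) / 1) / 2"
    by (rule L2_CS_weighted[OF in_L2_mcoord[OF G] uek(1)]) simp
  also have "\<dots> \<le> (H1_norm L u)\<^sup>2"
  proof -
    have "(A + B) / 2 \<le> a + b" if "A \<le> b" "B \<le> a" "0 \<le> a" "0 \<le> b" for A B a b :: real
      using that by (simp add: field_simps)
    from this[OF sqn_mcoord_le[OF G] sqn_coord_le[OF u] sqn_nonneg sqn_nonneg] show ?thesis
      unfolding uek(2) H1_norm_sq mult_1 div_by_1 .
  qed
  finally show ?thesis using L
    by (simp add: nonlin_def fcc_def norm_divide norm_power mult.assoc divide_right_mono)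
qed

text \<open>The convolution formula. Its partial sums are continuous in time for weakly continuous
  \<open>u\<close>, and this provides the measurability in \<open>integrable_nonlin\<close>.\<close>

lemma nonlin_tendsto:
  assumes L: "L > 0" and u: "in_L2 L u" and G: "has_weak_grad L u (weak_grad L u)"
  shows "(\<lambda>N. \<Sum>m\<in>freq_box N. \<i> * of_real (2 * pi / L * of_int (m $ j)) * fcc L (coord u i) m * fcc L (coord u j) (k - m))
     \<longlonglongrightarrow> nonlin L u i j k"
proof -
  have G2: "in_L2 L (weak_grad L u)" using G by (simp add: has_weak_grad_def)
  have uek: "in_L2 L (\<lambda>x. coord u j x * ek L (- k) x)"
    by (rule in_L2_mult_trig_poly[OF in_L2_coord[OF u] trig_poly_ek[of "{- k}"]]) auto
  have "(\<lambda>N. inverse (of_real (L ^ 3)) * (of_real (L ^ 3) * (\<Sum>m\<in>freq_box N. fcc L (mcoord (weak_grad L u) i j) m * fcc L (\<lambda>x. coord u j x * ek L (- k) x) (- m))))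
     \<longlonglongrightarrow> inverse (of_real (L ^ 3)) * (LINT x|torus L. mcoord (weak_grad L u) i j x * (coord u j x * ek L (- k) x))"
    by (intro tendsto_mult tendsto_const parseval_bilinear L in_L2_mcoord[OF G2] uek)
  moreover have "inverse (of_real (L ^ 3)) * (LINT x|torus L. mcoord (weak_grad L u) i j x * (coord u j x * ek L (- k) x)) = nonlin L u i j k"
    by (simp add: nonlin_def fcc_def mult.assoc divide_inverse mult.commute[of "inverse _"])
  ultimately show ?thesis
    using L unfolding fcc_weak_grad[OF L u G] fcc_mult_ek by (simp add: mult.assoc[symmetric])
qed

lemma integrable_nonlin:
  assumes L: "L > 0" and T: "T > 0" and w: "weakly_continuous_L2 L T u" and h: "L2_H1 L T u"
  shows "integrable (lebesgue_on {0..T}) (\<lambda>s. nonlin L (u s) i j k)"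
proof -
  have H: "AE s in lebesgue_on {0..T}. in_H1 L (u s)" using h by (simp add: L2_H1_def)
  let ?h = "\<lambda>N s. \<Sum>m\<in>freq_box N. \<i> * of_real (2 * pi / L * of_int (m $ j)) * fcc L (coord (u s) i) m * fcc L (coord (u s) j) (k - m)"
  have "continuous_on {0..T} (?h N)" for N
    by (intro continuous_intros continuous_fcc_coord[OF L w])
  then have hm: "?h N \<in> borel_measurable (lebesgue_on {0..T})" for N
    by (rule continuous_borel_measurable_lebesgue_on)
  have "(\<lambda>s. lim (\<lambda>N. ?h N s)) \<in> borel_measurable (lebesgue_on {0..T})"
    by (rule borel_measurable_lim_metric[OF hm])
  moreover have "AE s in lebesgue_on {0..T}. lim (\<lambda>N. ?h N s) = nonlin L (u s) i j k"
    using H by eventually_elim (intro limI nonlin_tendsto L has_weak_grad_weak_grad; simp add: in_H1_def)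
  ultimately have m: "(\<lambda>s. nonlin L (u s) i j k) \<in> borel_measurable (lebesgue_on {0..T})"
    by (rule borel_measurable_lebesgue_on_AE)
  show ?thesis
  proof (rule Bochner_Integration.integrable_bound[OF _ m])
    show "integrable (lebesgue_on {0..T}) (\<lambda>s. (H1_norm L (u s))\<^sup>2 / L ^ 3)" using h by (simp add: L2_H1_def)
    show "AE s in lebesgue_on {0..T}. norm (nonlin L (u s) i j k) \<le> norm ((H1_norm L (u s))\<^sup>2 / L ^ 3)"
      using H
    proof eventually_elim
      case (elim s)
      have "in_L2 L (u s)" "in_L2 L (weak_grad L (u s))"
        using elim has_weak_grad_weak_grad[OF elim] by (auto simp: in_H1_def has_weak_grad_def)
      from norm_nonlin_le[OF L this] show ?case using L by simp
    qed
  qed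
qed

text \<open>Testing with \<open>trig L k e 0\<close> and \<open>trig L k 0 e\<close> gives the real
  part and minus the imaginary part of one integral equation for the coefficient along
  \<open>e\<close>. Orthogonality of \<open>e\<close> to the frequency makes these test fields
  divergence free.\<close>

lemma weak_solution_fourier:
  assumes L: "L > 0" and T: "T > 0" and ws: "weak_solution_upto L \<nu> f T u" and e: "freq k \<bullet> e = 0"
  defines "z \<equiv> \<lambda>t. \<Sum>i\<in>UNIV. of_real (e $ i) * fcc L (coord (u t) i) k"
  defines "y \<equiv> \<lambda>s. of_real (\<nu> * ((2 * pi / L)\<^sup>2 * (norm (freq k))\<^sup>2)) * z s
      + (\<Sum>i\<in>UNIV. \<Sum>j\<in>UNIV. of_real (e $ i) * nonlin L (u s) i j k)
      - Complex (f (trig L k e 0)) (- f (trig L k 0 e)) / of_real (L ^ 3)"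
  shows "integrable (lebesgue_on {0..T}) y"
    and "t \<in> {0..T} \<Longrightarrow> z t = z 0 - (LINT s|lebesgue_on {0..t}. y s)"
proof -
  have wc: "weakly_continuous_L2 L T u" and h1: "L2_H1 L T u" using ws by (auto simp: weak_solution_upto_def)
  have H: "AE s in lebesgue_on {0..T}. in_H1 L (u s)" using h1 by (simp add: L2_H1_def)
  have u2: "in_L2 L (u s)" if "s \<in> {0..T}" for s using wc that by (simp add: weakly_continuous_L2_def)
  interpret fm: finite_measure "lebesgue_on {0..T}" by (rule finite_measure_lebesgue_on) simp
  have zc: "continuous_on {0..T} z" unfolding z_def by (intro continuous_intros continuous_fcc_coord[OF L wc])
  have "bounded (z ` {0..T})"
    by (intro compact_imp_bounded compact_continuous_image zc compact_Icc)
  then obtain B where B: "\<And>s. s \<in> {0..T} \<Longrightarrow> norm (z s) \<le> B"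
    unfolding bounded_iff by blast
  have zi: "integrable (lebesgue_on {0..T}) z"
    by (rule fm.integrable_const_bound[of _ B]) (use B continuous_borel_measurable_lebesgue_on[OF zc] in \<open>auto intro!: AE_I2\<close>)
  show yi: "integrable (lebesgue_on {0..T}) y"
    unfolding y_def
    by (intro Bochner_Integration.integrable_diff Bochner_Integration.integrable_add Bochner_Integration.integrable_sum
        integrable_mult_right zi integrable_nonlin[OF L T wc h1]) auto
  let ?\<mu> = "(2 * pi / L)\<^sup>2 * (norm (freq k))\<^sup>2"
  define F where "F = Complex (f (trig L k e 0)) (- f (trig L k 0 e)) / of_real (L ^ 3)"
  let ?ig = "\<lambda>a b s. - L2_inner L (u s) (\<lambda>x. vector_derivative (\<lambda>\<tau>. trig L k a b x) (at s within {0..T}))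
           + \<nu> * L2_inner L (weak_grad L (u s)) (\<lambda>x. jacobian (trig L k a b) (at x))
           + L2_inner L (\<lambda>x. weak_grad L (u s) x *v u s x) (trig L k a b) - f (trig L k a b)"
  have zL: "L2_inner L (u s) (trig L k e 0) = L ^ 3 * Re (z s)" "L2_inner L (u s) (trig L k 0 e) = - (L ^ 3 * Im (z s))"
    if "s \<in> {0..T}" for s
    unfolding z_def by (rule L2_inner_trig[OF L in_L2_coord_integrable[OF u2[OF that]]])+
  \<comment> \<open>The test fields do not depend on time, so the term with their time derivative
    drops out; \<open>T > 0\<close> makes the derivative within the interval unique at its
    ends.\<close>
  have vd0: "vector_derivative (\<lambda>\<tau>. c) (at s within {0..T}) = 0" if "s \<in> {0..T}" for s and c :: "real^3"
    using T that by (intro vector_derivative_within_closed_interval) auto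
  have pt: "?ig e 0 s = L ^ 3 * Re (y s) \<and> ?ig 0 e s = - (L ^ 3 * Im (y s))" if s: "s \<in> {0..T}" and hs: "in_H1 L (u s)" for s
  proof -
    let ?V = "\<lambda>x. weak_grad L (u s) x *v u s x"
    note G = has_weak_grad_weak_grad[OF hs]
    have G2: "in_L2 L (weak_grad L (u s))" using G by (simp add: has_weak_grad_def)
    have Vc: "coord ?V i x = (\<Sum>j\<in>UNIV. mcoord (weak_grad L (u s)) i j x * coord (u s) j x)" for i x
      by (simp add: matrix_vector_mult_def)
    have prodi: "integrable (torus L) (\<lambda>x. mcoord (weak_grad L (u s)) i j x * coord (u s) j x)" for i j
      by (intro in_L2_integrable_mult in_L2_mcoord in_L2_coord G2 u2 s)
    have "integrable (torus L) (\<lambda>x. \<Sum>j\<in>UNIV. mcoord (weak_grad L (u s)) i j x * coord (u s) j x)" for i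
      using prodi by simp
    then have "integrable (torus L) (coord ?V i)" for i unfolding Vc .
    from integrable_Re[OF this] have Vi: "integrable (torus L) (\<lambda>x. ?V x $ i)" for i by simp
    have fV: "fcc L (coord ?V i) k = (\<Sum>j\<in>UNIV. nonlin L (u s) i j k)" for i
    proof -
      have "integrable (torus L) (\<lambda>x. mcoord (weak_grad L (u s)) i j x * (coord (u s) j x * ek L (- k) x))" for j
        by (rule in_L2_integrable_mult[OF in_L2_mcoord[OF G2] in_L2_mult_trig_poly[OF in_L2_coord[OF u2[OF s]] trig_poly_ek[of "{- k}"]]]) auto
      then show ?thesis unfolding Vc nonlin_def fcc_def
        by (simp add: sum_distrib_right sum_divide_distrib mult.assoc)
    qed
    have V: "L2_inner L ?V (trig L k e 0) = L ^ 3 * Re (\<Sum>i\<in>UNIV. \<Sum>j\<in>UNIV. of_real (e $ i) * nonlin L (u s) i j k)"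
      "L2_inner L ?V (trig L k 0 e) = - (L ^ 3 * Im (\<Sum>i\<in>UNIV. \<Sum>j\<in>UNIV. of_real (e $ i) * nonlin L (u s) i j k))"
      using L2_inner_trig[OF L Vi, of k e] unfolding fV sum_distrib_left by auto
    have f: "f (trig L k e 0) = L ^ 3 * Re F" "f (trig L k 0 e) = - (L ^ 3 * Im F)"
      using L unfolding F_def Re_divide_of_real Im_divide_of_real by simp_all
    have zero: "L2_inner L (u s) (\<lambda>x. vector_derivative (\<lambda>\<tau>. trig L k a b x) (at s within {0..T})) = 0" for a b
      unfolding vd0[OF s] by (simp add: L2_inner_def)
    have yr: "Re (y s) = \<nu> * ?\<mu> * Re (z s) + Re (\<Sum>i\<in>UNIV. \<Sum>j\<in>UNIV. of_real (e $ i) * nonlin L (u s) i j k)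
         - Re F"
      "Im (y s) = \<nu> * ?\<mu> * Im (z s) + Im (\<Sum>i\<in>UNIV. \<Sum>j\<in>UNIV. of_real (e $ i) * nonlin L (u s) i j k)
         - Im F"
      unfolding y_def F_def[symmetric] by (simp_all only: minus_complex.sel plus_complex.sel Re_complex_of_real Im_complex_of_real times_complex.sel mult_zero_left diff_0_right add_0_right)
    show ?thesis
      unfolding zero V L2_inner_jacobian_trig[OF L u2[OF s] G] zL[OF s] yr
      unfolding f by (simp add: algebra_simps)
  qed
  show "z t = z 0 - (LINT s|lebesgue_on {0..t}. y s)" if t: "t \<in> {0..T}" for t
  proof -
    have yt: "integrable (lebesgue_on {0..t}) y" using t by (intro integrable_subinterval[OF yi]) auto
    have ae: "AE s in lebesgue_on {0..t}. in_H1 L (u s)" using t by (intro AE_lebesgue_on_subset[OF H]) auto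
    have ae': "AE s in lebesgue_on {0..t}. L ^ 3 * Re (y s) = ?ig e 0 s" "AE s in lebesgue_on {0..t}. - (L ^ 3 * Im (y s)) = ?ig 0 e s"
      using ae AE_space[of "lebesgue_on {0..t}"] by (eventually_elim; use pt t in auto)+
    have m: "(\<lambda>s. L ^ 3 * Re (y s)) \<in> borel_measurable (lebesgue_on {0..t})" "(\<lambda>s. - (L ^ 3 * Im (y s))) \<in> borel_measurable (lebesgue_on {0..t})"
      using yt by auto
    have int1: "(LINT s|lebesgue_on {0..t}. ?ig e 0 s) = L ^ 3 * Re (LINT s|lebesgue_on {0..t}. y s)"
    proof -
      have "(LINT s|lebesgue_on {0..t}. ?ig e 0 s) = (LINT s|lebesgue_on {0..t}. L ^ 3 * Re (y s))"
        by (rule integral_cong_AE[symmetric, OF m(1) borel_measurable_lebesgue_on_AE[OF m(1) ae'(1)] ae'(1)])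
      then show ?thesis using integral_Re[OF yt] by simp
    qed
    have int2: "(LINT s|lebesgue_on {0..t}. ?ig 0 e s) = - (L ^ 3 * Im (LINT s|lebesgue_on {0..t}. y s))"
    proof -
      have "(LINT s|lebesgue_on {0..t}. ?ig 0 e s) = (LINT s|lebesgue_on {0..t}. - (L ^ 3 * Im (y s)))"
        by (rule integral_cong_AE[symmetric, OF m(2) borel_measurable_lebesgue_on_AE[OF m(2) ae'(2)] ae'(2)])
      then show ?thesis using integral_Im[OF yt] by simp
    qed
    have weq: "L2_inner L (u t) (trig L k a b) + (LINT s|lebesgue_on {0..t}. ?ig a b s) = L2_inner L (u 0) (trig L k a b)"
      if "freq k \<bullet> a = 0" "freq k \<bullet> b = 0" for a b
      by (rule conjunct2[OF conjunct2[OF conjunct2[OF ws[unfolded weak_solution_upto_def]]], rule_format,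
            OF t test_field_trig[OF L that]])
    have 0: "0 \<in> {0..T}" using T by simp
    have "L ^ 3 * (Re (z t) + Re (LINT s|lebesgue_on {0..t}. y s)) = L ^ 3 * Re (z 0)"
      using weq[of e 0] e unfolding zL[OF t] zL[OF 0] int1 by (simp add: distrib_left)
    moreover have "L ^ 3 * (Im (z t) + Im (LINT s|lebesgue_on {0..t}. y s)) = L ^ 3 * Im (z 0)"
      using weq[of 0 e] e unfolding zL[OF t] zL[OF 0] int2 by (simp add: distrib_left)
    ultimately have "Re (z t) + Re (LINT s|lebesgue_on {0..t}. y s) = Re (z 0)" "Im (z t) + Im (LINT s|lebesgue_on {0..t}. y s) = Im (z 0)"
      using L by simp_all
    then show ?thesis by (simp add: complex_eq_iff algebra_simps)
  qed
qed

lemma fcc_zero_mean: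
  assumes "in_L2 L g" "zero_mean L g"
  shows "fcc L (coord g i) 0 = 0"
proof -
  interpret finite_measure "torus L" by (rule finite_measure_torus)
  have b: "norm x \<le> 1 + (norm x)\<^sup>2" for x :: "real^3"
  proof -
    have "2 * norm x \<le> 1 + (norm x)\<^sup>2" using sum_squares_bound[of 1 "norm x"] by simp
    then show ?thesis using norm_ge_zero[of x] by linarith
  qed
  have "integrable (torus L) (\<lambda>x. 1 + (norm (g x))\<^sup>2)"
    using in_L2_sq_integrable[OF assms(1)] by simp
  then have "integrable (torus L) g"
  proof (rule Bochner_Integration.integrable_bound)
    show "g \<in> borel_measurable (torus L)" by (rule in_L2_measurable[OF assms(1)])
    have "norm (g x) \<le> norm (1 + (norm (g x))\<^sup>2)" for x
      using b[of "g x"] by (rule order_trans) simp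
    then show "AE x in torus L. norm (g x) \<le> norm (1 + (norm (g x))\<^sup>2)" by (rule AE_I2)
  qed
  then have "(LINT x|torus L. coord g i x) = of_real ((LINT x|torus L. g x) $ i)"
    by (rule integral_bounded_linear[OF bounded_linear_of_real_nth])
  then show ?thesis using assms(2) by (simp add: fcc_def zero_mean_def)
qed

section \<open>The energy inequality for the difference of two solutions\<close>

text \<open>Connects the flux as it is estimated, an integral in space, with the sum over modes that
  the energy balance produces. The sign of \<open>k\<close> is changed using the symmetry of the box
  and the fact that \<open>w\<close> is real.\<close>

lemma flux_fourier:
  assumes "two_fields L u v (weak_grad L u) (weak_grad L v)"
  shows "two_fields.flux L u v (weak_grad L u) (weak_grad L v) N =
    of_real (L ^ 3) * (\<Sum>k\<in>freq_box N. \<Sum>i\<in>UNIV. \<Sum>j\<in>UNIV.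
       cnj (fcc L (coord (\<lambda>x. u x - v x) i) k) * (nonlin L u i j k - nonlin L v i j k))"
proof -
  interpret two_fields L u v "weak_grad L u" "weak_grad L v" by (rule assms)
  have tm: "(LINT x|torus L. (mcoord (weak_grad L u) i j x * coord u j x - mcoord (weak_grad L v) i j x * coord v j x) * trunc L N (coord w i) x)
     = of_real (L ^ 3) * (\<Sum>k\<in>freq_box N. cnj (fcc L (coord w i) k) * (nonlin L u i j k - nonlin L v i j k))" for i j
  proof -
    let ?t = "trunc L N (coord w i)"
    have t: "trig_poly L (freq_box N) ?t" by (rule trig_poly_tp[OF finite_freq_box])
    have ig: "integrable (torus L) (\<lambda>x. mcoord G i j x * (coord g j x * ?t x))" if "in_L2 L G" "in_L2 L g" for G g
      by (rule in_L2_integrable_mult[OF in_L2_mcoord[OF that(1)] in_L2_mult_trig_poly[OF in_L2_coord[OF that(2)] t]])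
    have nl: "(LINT x|torus L. mcoord (weak_grad L g) i j x * (coord g j x * ek L k x)) = of_real (L ^ 3) * nonlin L g i j (- k)" for g k
      using L by (simp add: nonlin_def fcc_def mult.assoc)
    have "(LINT x|torus L. (mcoord (weak_grad L u) i j x * coord u j x - mcoord (weak_grad L v) i j x * coord v j x) * ?t x)
       = (LINT x|torus L. mcoord (weak_grad L u) i j x * (coord u j x * ?t x) - mcoord (weak_grad L v) i j x * (coord v j x * ?t x))"
      by (simp only: left_diff_distrib mult.assoc)
    also have "\<dots> = (LINT x|torus L. mcoord (weak_grad L u) i j x * (coord u j x * ?t x)) - (LINT x|torus L. mcoord (weak_grad L v) i j x * (coord v j x * ?t x))"
      by (intro Bochner_Integration.integral_diff ig L2_Gu L2_Gv u v)
    also have "\<dots> = (\<Sum>k\<in>freq_box N. fcc L (coord w i) k * (of_real (L ^ 3) * nonlin L u i j (- k))) - (\<Sum>k\<in>freq_box N. fcc L (coord w i) k * (of_real (L ^ 3) * nonlin L v i j (- k)))"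
      unfolding integral_mult_tp_expand[OF in_L2_mcoord[OF L2_Gu] in_L2_coord[OF u] finite_freq_box]
        integral_mult_tp_expand[OF in_L2_mcoord[OF L2_Gv] in_L2_coord[OF v] finite_freq_box] nl ..
    also have "\<dots> = of_real (L ^ 3) * (\<Sum>k\<in>freq_box N. fcc L (coord w i) k * (nonlin L u i j (- k) - nonlin L v i j (- k)))"
      by (simp add: sum_subtractf[symmetric] sum_distrib_left algebra_simps)
    also have "(\<Sum>k\<in>freq_box N. fcc L (coord w i) k * (nonlin L u i j (- k) - nonlin L v i j (- k)))
       = (\<Sum>k\<in>freq_box N. fcc L (coord w i) (- k) * (nonlin L u i j k - nonlin L v i j k))"
      by (rule sum.reindex_bij_witness[of _ uminus uminus]) (auto simp: freq_box_uminus)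
    also have "\<dots> = (\<Sum>k\<in>freq_box N. cnj (fcc L (coord w i) k) * (nonlin L u i j k - nonlin L v i j k))"
      by (intro sum.cong refl) (simp only: fcc_real)
    finally show ?thesis .
  qed
  have "flux N = of_real (L ^ 3) * (\<Sum>i\<in>UNIV. \<Sum>j\<in>UNIV. \<Sum>k\<in>freq_box N. cnj (fcc L (coord w i) k) * (nonlin L u i j k - nonlin L v i j k))"
    unfolding flux_def tm by (simp only: sum_distrib_left)
  also have "(\<Sum>i\<in>UNIV. \<Sum>j\<in>UNIV. \<Sum>k\<in>freq_box N. cnj (fcc L (coord w i) k) * (nonlin L u i j k - nonlin L v i j k))
    = (\<Sum>k\<in>freq_box N. \<Sum>i\<in>UNIV. \<Sum>j\<in>UNIV. cnj (fcc L (coord w i) k) * (nonlin L u i j k - nonlin L v i j k))"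
    by (simp only: sum.swap[of _ UNIV "freq_box N"])
  finally show ?thesis .
qed

locale two_solutions =
  fixes L \<nu> :: real and f :: "(real^3 \<Rightarrow> real^3) \<Rightarrow> real" and u v :: "real \<Rightarrow> real^3 \<Rightarrow> real^3"
  assumes L: "L > 0" and nu: "\<nu> > 0"
    and su: "weak_solution L \<nu> f u" and sv: "weak_solution L \<nu> f v"
    and zu: "\<And>t. t \<ge> 0 \<Longrightarrow> zero_mean L (u t)" and zv: "\<And>t. t \<ge> 0 \<Longrightarrow> zero_mean L (v t)"
begin

definition wh :: "3 \<Rightarrow> int^3 \<Rightarrow> real \<Rightarrow> complex" where
  "wh i k t = fcc L (coord (\<lambda>x. u t x - v t x) i) k"

definition mu :: "int^3 \<Rightarrow> real" where
  "mu k = (2 * pi / L)\<^sup>2 * (norm (freq k))\<^sup>2"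

lemma in_L2_sol: "t \<ge> 0 \<Longrightarrow> in_L2 L (u t)" "t \<ge> 0 \<Longrightarrow> in_L2 L (v t)"
proof -
  assume t: "t \<ge> 0"
  have "weak_solution_upto L \<nu> f (t + 1) u" "weak_solution_upto L \<nu> f (t + 1) v"
    using su sv t by (auto simp: weak_solution_def)
  then show "in_L2 L (u t)" "in_L2 L (v t)"
    using t by (auto simp: weak_solution_upto_def weakly_continuous_L2_def)
qed

lemma wh_eq: "t \<ge> 0 \<Longrightarrow> wh i k t = fcc L (coord (u t) i) k - fcc L (coord (v t) i) k"
  unfolding wh_def using fcc_diff[OF in_L2_coord[OF in_L2_sol(1)] in_L2_coord[OF in_L2_sol(2)], of t t i i k] by simp

lemma div_wh:
  assumes t: "t \<ge> 0" shows "(\<Sum>i\<in>UNIV. of_int (k $ i) * wh i k t) = 0"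
proof -
  have "weak_solution_upto L \<nu> f (t + 1) u" "weak_solution_upto L \<nu> f (t + 1) v"
    using su sv t by (auto simp: weak_solution_def)
  then have "weakly_div_free L (u t)" "weakly_div_free L (v t)"
    using t by (auto simp: weak_solution_upto_def)
  from fcc_div_free[OF L in_L2_sol(1)[OF t] this(1), of k] fcc_div_free[OF L in_L2_sol(2)[OF t] this(2), of k]
  show ?thesis unfolding wh_eq[OF t] right_diff_distrib sum_subtractf by simp
qed

lemma wh_zero: "t \<ge> 0 \<Longrightarrow> wh i 0 t = 0"
  by (simp add: wh_eq fcc_zero_mean[OF in_L2_sol(1) zu] fcc_zero_mean[OF in_L2_sol(2) zv])

definition nl :: "3 \<Rightarrow> 3 \<Rightarrow> int^3 \<Rightarrow> real \<Rightarrow> complex" where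
  "nl i j k t = nonlin L (u t) i j k - nonlin L (v t) i j k"

text \<open>Half the rate at which the mode \<open>k\<close> of the difference loses energy: the
  viscous loss plus its share of the flux.\<close>

definition rate :: "int^3 \<Rightarrow> real \<Rightarrow> real" where
  "rate k t = \<nu> * mu k * (\<Sum>m\<in>UNIV. (norm (wh m k t))\<^sup>2) + Re (\<Sum>i\<in>UNIV. \<Sum>j\<in>UNIV. cnj (wh i k t) * nl i j k t)"

text \<open>
  For \<open>k \<noteq> 0\<close> the test vectors are the projections \<open>axis m 1 - (k\<^sub>m / |k|\<^sup>2) k\<close> of the unit vectors onto the
  complement of \<open>k\<close>. Since \<open>wh\<close> is orthogonal to \<open>k\<close>, testing against them returns its components.
\<close>

lemma mode_energy:
  assumes st: "0 \<le> s" "s \<le> t"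
  shows "(\<Sum>m\<in>UNIV. (norm (wh m k t))\<^sup>2) - (\<Sum>m\<in>UNIV. (norm (wh m k s))\<^sup>2) = - 2 * (LINT x|lebesgue_on {s..t}. rate k x)"
    and "integrable (lebesgue_on {s..t}) (rate k)"
proof -
  have goal: "(\<Sum>m\<in>UNIV. (norm (wh m k t))\<^sup>2) - (\<Sum>m\<in>UNIV. (norm (wh m k s))\<^sup>2) = - 2 * (LINT x|lebesgue_on {s..t}. rate k x)
     \<and> integrable (lebesgue_on {s..t}) (rate k)"
  proof (cases "k = 0")
    \<comment> \<open>Both means vanish, so the zeroth mode is zero at all times; the projections
      used in the other case divide by the square of the norm of the frequency.\<close>
    case True
    have w0: "wh m k x = 0" if "x \<ge> 0" for m x unfolding True using wh_zero[OF that] .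
    have r0: "rate k x = 0" if "x \<in> {s..t}" for x
      unfolding rate_def using that st w0[of x] by simp
    have "(LINT x|lebesgue_on {s..t}. rate k x) = (LINT x|lebesgue_on {s..t}. 0)"
      by (rule Bochner_Integration.integral_cong) (use r0 in auto)
    moreover have "integrable (lebesgue_on {s..t}) (rate k) \<longleftrightarrow> integrable (lebesgue_on {s..t}) (\<lambda>x. 0 :: real)"
      by (rule Bochner_Integration.integrable_cong) (use r0 in auto)
    ultimately show ?thesis using st w0 by simp
  next
    case False
    then obtain l where "k $ l \<noteq> 0" by (auto simp: vec_eq_iff)
    then have fk: "freq k \<noteq> 0" by (auto simp: freq_def vec_eq_iff)
    define n2 where "n2 = (norm (freq k))\<^sup>2"
    have n2: "n2 > 0" using fk by (simp add: n2_def)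
    define T where "T = t + 1"
    have T: "T > 0" "t \<le> T" using st by (auto simp: T_def)
    define e where "e m = axis m 1 - (of_int (k $ m) / n2) *\<^sub>R freq k" for m
    have ek0: "freq k \<bullet> e m = 0" for m
    proof -
      have "freq k \<bullet> axis m 1 = of_int (k $ m)" by (simp add: inner_axis freq_def)
      then show ?thesis using n2 by (simp add: e_def inner_diff_right n2_def dot_square_norm)
    qed
    have ei: "e m $ i = (if i = m then 1 else 0) - of_int (k $ m) * of_int (k $ i) / n2" for m i
      by (simp add: e_def axis_def freq_def)
    have ew: "(\<Sum>i\<in>UNIV. of_real (e m $ i) * wh i k x) = wh m k x" if "x \<ge> 0" for m x
    proof -
      have "(\<Sum>i\<in>UNIV. of_real (e m $ i) * wh i k x)
         = (\<Sum>i\<in>UNIV. (if i = m then wh i k x else 0) - of_real (of_int (k $ m) / n2) * (of_int (k $ i) * wh i k x))"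
        unfolding ei by (intro sum.cong refl) (simp add: left_diff_distrib)
      also have "\<dots> = wh m k x - of_real (of_int (k $ m) / n2) * (\<Sum>i\<in>UNIV. of_int (k $ i) * wh i k x)"
        unfolding sum_subtractf sum_distrib_left[symmetric] by simp
      finally show ?thesis unfolding div_wh[OF that] by simp
    qed
    \<comment> \<open>The projection matrix is symmetric: in the nonlinear term it is moved onto
      \<open>wh\<close>, where it acts as the identity.\<close>
    have esym: "e m $ i = e i $ m" for i m unfolding ei by (simp add: mult.commute)
    have wsu: "weak_solution_upto L \<nu> f T u" "weak_solution_upto L \<nu> f T v"
      using su sv T by (auto simp: weak_solution_def)
    note U = weak_solution_fourier[OF L T(1) wsu(1) ek0] and V = weak_solution_fourier[OF L T(1) wsu(2) ek0]
    define zc where "zc g m x = (\<Sum>i\<in>UNIV. of_real (e m $ i) * fcc L (coord (g x) i) k)" for g :: "real \<Rightarrow> real^3 \<Rightarrow> real^3" and m x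
    define F where "F m = Complex (f (trig L k (e m) 0)) (- f (trig L k 0 (e m))) / of_real (L ^ 3)" for m
    define yc where "yc g m x = of_real (\<nu> * mu k) * zc g m x + (\<Sum>i\<in>UNIV. \<Sum>j\<in>UNIV. of_real (e m $ i) * nonlin L (g x) i j k) - F m"
      for g :: "real \<Rightarrow> real^3 \<Rightarrow> real^3" and m x
    define Y where "Y m x = yc u m x - yc v m x" for m x
    have yi: "integrable (lebesgue_on {0..T}) (yc u m)" "integrable (lebesgue_on {0..T}) (yc v m)" for m
      using U(1)[of m] V(1)[of m] unfolding yc_def[abs_def] zc_def F_def mu_def by simp_all
    have zeq: "zc u m x = zc u m 0 - (LINT s|lebesgue_on {0..x}. yc u m s)" "zc v m x = zc v m 0 - (LINT s|lebesgue_on {0..x}. yc v m s)"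
      if "x \<in> {0..T}" for m x
      using U(2)[OF that, of m] V(2)[OF that, of m] unfolding yc_def[abs_def] zc_def F_def mu_def by simp_all
    have zw: "zc u m x - zc v m x = wh m k x" if "x \<ge> 0" for m x
      unfolding zc_def sum_subtractf[symmetric] right_diff_distrib[symmetric] wh_eq[OF that, symmetric] by (rule ew[OF that])
    have Yi: "integrable (lebesgue_on {0..T}) (Y m)" for m
      unfolding Y_def by (intro Bochner_Integration.integrable_diff yi)
    have weq: "wh m k x = wh m k 0 - (LINT s|lebesgue_on {0..x}. Y m s)" if x: "x \<in> {0..T}" for m x
    proof -
      have i: "integrable (lebesgue_on {0..x}) (yc u m)" "integrable (lebesgue_on {0..x}) (yc v m)"
        using x by (auto intro!: integrable_subinterval[OF yi(1)] integrable_subinterval[OF yi(2)])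
      have "wh m k x = zc u m x - zc v m x" using zw[of x m] x by simp
      also have "\<dots> = (zc u m 0 - zc v m 0) - ((LINT s|lebesgue_on {0..x}. yc u m s) - (LINT s|lebesgue_on {0..x}. yc v m s))"
        by (subst zeq(1)[OF x], subst zeq(2)[OF x]) (simp only: algebra_simps)
      also have "\<dots> = wh m k 0 - (LINT s|lebesgue_on {0..x}. Y m s)"
        unfolding Y_def Bochner_Integration.integral_diff[OF i] using zw[of 0 m] by simp
      finally show ?thesis .
    qed
    have E1: "(norm (wh m k t))\<^sup>2 - (norm (wh m k s))\<^sup>2 = - 2 * (LINT x|lebesgue_on {s..t}. Re (cnj (wh m k x) * Y m x))" for m
      by (rule norm_square_increment(1)[where z="wh m k" and y="Y m", OF Yi weq st T(2)])
    have E2: "integrable (lebesgue_on {s..t}) (\<lambda>x. Re (cnj (wh m k x) * Y m x))" for m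
      by (rule norm_square_increment(2)[where z="wh m k" and y="Y m", OF Yi weq st T(2)])
    have rate: "rate k x = (\<Sum>m\<in>UNIV. Re (cnj (wh m k x) * Y m x))" if x: "x \<ge> 0" for x
    proof -
      \<comment> \<open>The force contributes the same \<open>F m\<close> to both solutions and
        cancels in the difference.\<close>
      have Yx: "Y m x = of_real (\<nu> * mu k) * wh m k x + (\<Sum>i\<in>UNIV. \<Sum>j\<in>UNIV. of_real (e m $ i) * nl i j k x)" for m
        unfolding Y_def yc_def nl_def zw[OF x, symmetric]
        by (simp add: right_diff_distrib sum_subtractf)
      have "(\<Sum>m\<in>UNIV. cnj (wh m k x) * Y m x)
         = of_real (\<nu> * mu k) * (\<Sum>m\<in>UNIV. of_real ((norm (wh m k x))\<^sup>2))
         + (\<Sum>m\<in>UNIV. \<Sum>i\<in>UNIV. \<Sum>j\<in>UNIV. cnj (of_real (e i $ m) * wh m k x) * nl i j k x)"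
        unfolding Yx complex_norm_square distrib_left sum.distrib sum_distrib_left
        by (intro arg_cong2[of _ _ _ _ "(+)"] sum.cong refl) (simp_all add: esym mult_ac)
      also have "(\<Sum>m\<in>UNIV. \<Sum>i\<in>UNIV. \<Sum>j\<in>UNIV. cnj (of_real (e i $ m) * wh m k x) * nl i j k x)
         = (\<Sum>i\<in>UNIV. \<Sum>j\<in>UNIV. cnj (\<Sum>m\<in>UNIV. of_real (e i $ m) * wh m k x) * nl i j k x)"
        unfolding cnj_sum sum_distrib_right
        by (rule trans[OF sum.swap], rule sum.cong[OF refl], rule sum.swap)
      finally have c: "(\<Sum>m\<in>UNIV. cnj (wh m k x) * Y m x) = of_real (\<nu> * mu k * (\<Sum>m\<in>UNIV. (norm (wh m k x))\<^sup>2))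
         + (\<Sum>i\<in>UNIV. \<Sum>j\<in>UNIV. cnj (wh i k x) * nl i j k x)"
        unfolding ew[OF x] of_real_mult of_real_sum .
      show ?thesis
        unfolding Re_sum[symmetric] c rate_def plus_complex.sel Re_complex_of_real ..
    qed
    have "(\<Sum>m\<in>UNIV. (norm (wh m k t))\<^sup>2) - (\<Sum>m\<in>UNIV. (norm (wh m k s))\<^sup>2)
       = (\<Sum>m\<in>UNIV. (norm (wh m k t))\<^sup>2 - (norm (wh m k s))\<^sup>2)" by (simp only: sum_subtractf)
    also have "\<dots> = - 2 * (\<Sum>m\<in>UNIV. LINT x|lebesgue_on {s..t}. Re (cnj (wh m k x) * Y m x))"
      unfolding E1 by (simp only: sum_distrib_left)
    also have "(\<Sum>m\<in>UNIV. LINT x|lebesgue_on {s..t}. Re (cnj (wh m k x) * Y m x)) = (LINT x|lebesgue_on {s..t}. (\<Sum>m\<in>UNIV. Re (cnj (wh m k x) * Y m x)))"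
      by (rule Bochner_Integration.integral_sum[symmetric]) (rule E2)
    also have "\<dots> = (LINT x|lebesgue_on {s..t}. rate k x)"
      by (rule Bochner_Integration.integral_cong) (use rate st in auto)
    finally have 1: "(\<Sum>m\<in>UNIV. (norm (wh m k t))\<^sup>2) - (\<Sum>m\<in>UNIV. (norm (wh m k s))\<^sup>2) = - 2 * (LINT x|lebesgue_on {s..t}. rate k x)" .
    have "integrable (lebesgue_on {s..t}) (\<lambda>x. \<Sum>m\<in>UNIV. Re (cnj (wh m k x) * Y m x))"
      by (rule Bochner_Integration.integrable_sum) (rule E2)
    moreover have "integrable (lebesgue_on {s..t}) (rate k) \<longleftrightarrow> integrable (lebesgue_on {s..t}) (\<lambda>x. \<Sum>m\<in>UNIV. Re (cnj (wh m k x) * Y m x))"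
      by (rule Bochner_Integration.integrable_cong) (use rate st in auto)
    ultimately show ?thesis using 1 by blast
  qed
  show "(\<Sum>m\<in>UNIV. (norm (wh m k t))\<^sup>2) - (\<Sum>m\<in>UNIV. (norm (wh m k s))\<^sup>2) = - 2 * (LINT x|lebesgue_on {s..t}. rate k x)"
    and "integrable (lebesgue_on {s..t}) (rate k)" using goal by blast+
qed

end

section \<open>Energy and dissipation of the difference, truncated and full\<close>

context two_solutions
begin

definition energy :: "real \<Rightarrow> real" where
  "energy t = sqn L (\<lambda>x. u t x - v t x)"

definition diss :: "real \<Rightarrow> real" where
  "diss t = sqn L (\<lambda>x. weak_grad L (u t) x - weak_grad L (v t) x)"

definition energy_trunc :: "nat \<Rightarrow> real \<Rightarrow> real" where
  "energy_trunc N t = L ^ 3 * (\<Sum>k\<in>freq_box N. \<Sum>m\<in>UNIV. (norm (wh m k t))\<^sup>2)"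

definition diss_trunc :: "nat \<Rightarrow> real \<Rightarrow> real" where
  "diss_trunc N t = L ^ 3 * (\<Sum>k\<in>freq_box N. mu k * (\<Sum>m\<in>UNIV. (norm (wh m k t))\<^sup>2))"

lemma energy_trunc_tendsto: "t \<ge> 0 \<Longrightarrow> (\<lambda>N. energy_trunc N t) \<longlonglongrightarrow> energy t"
proof -
  assume t: "t \<ge> 0"
  have w: "in_L2 L (\<lambda>x. u t x - v t x)" by (intro in_L2_diff in_L2_sol t)
  have "(\<lambda>N. \<Sum>m\<in>UNIV. L ^ 3 * (\<Sum>k\<in>freq_box N. (norm (wh m k t))\<^sup>2)) \<longlonglongrightarrow> (\<Sum>m\<in>UNIV. sqn L (coord (\<lambda>x. u t x - v t x) m))"
    unfolding wh_def by (intro tendsto_sum parseval L in_L2_coord w)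
  moreover have "(\<Sum>m\<in>UNIV. L ^ 3 * (\<Sum>k\<in>freq_box N. (norm (wh m k t))\<^sup>2)) = energy_trunc N t" for N
    unfolding energy_trunc_def sum_distrib_left[symmetric] by (subst sum.swap) (rule refl)
  ultimately show "(\<lambda>N. energy_trunc N t) \<longlonglongrightarrow> energy t"
    unfolding energy_def sqn_coord[OF w] by simp
qed

text \<open>Almost every time qualifies (\<open>AE_regular_time\<close>). Time 0 is left out because
  the assumptions on the low modes concern positive times only.\<close>

definition regular_time :: "real \<Rightarrow> bool" where
  "regular_time t \<longleftrightarrow> t > 0 \<and> in_H1 L (u t) \<and> in_H1 L (v t)"

lemma two_fields_regular:
  assumes "regular_time t"
  shows "two_fields L (u t) (v t) (weak_grad L (u t)) (weak_grad L (v t))"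
proof -
  have t: "t \<ge> 0" using assms by (simp add: regular_time_def)
  have "weak_solution_upto L \<nu> f (t + 1) u" "weak_solution_upto L \<nu> f (t + 1) v"
    using su sv t by (auto simp: weak_solution_def)
  then have "weakly_div_free L (u t)" "weakly_div_free L (v t)"
    using t by (auto simp: weak_solution_upto_def)
  then show ?thesis using assms t
    by (simp add: two_fields_def L in_L2_sol has_weak_grad_weak_grad regular_time_def)
qed

lemma AE_regular_time:
  assumes "0 \<le> s" shows "AE x in lebesgue_on {s..t}. regular_time x"
proof (cases "s \<le> t")
  case True
  have T: "t + 1 > 0" using assms True by simp
  have "weak_solution_upto L \<nu> f (t + 1) u" "weak_solution_upto L \<nu> f (t + 1) v"
    using su sv T by (auto simp: weak_solution_def)
  then have "AE x in lebesgue_on {0..t + 1}. in_H1 L (u x)" "AE x in lebesgue_on {0..t + 1}. in_H1 L (v x)"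
    by (auto simp: weak_solution_upto_def L2_H1_def)
  then have "AE x in lebesgue_on {s..t}. in_H1 L (u x)" "AE x in lebesgue_on {s..t}. in_H1 L (v x)"
    using assms by (auto intro: AE_lebesgue_on_subset)
  moreover have "AE x in lebesgue_on {s..t}. x \<noteq> 0"
  proof -
    have "AE x in lebesgue. x \<noteq> (0::real)"
      by (rule AE_I'[of "{0}"]) (auto simp: null_sets_completionI)
    then show ?thesis by (subst AE_restrict_space_iff) (auto elim: eventually_mono)
  qed
  moreover have "AE x in lebesgue_on {s..t}. x \<ge> 0" using assms by (intro AE_I2) auto
  ultimately show ?thesis unfolding regular_time_def by eventually_elim auto
qed (auto intro: AE_I2)

lemma diss_trunc_eq:
  assumes "regular_time t"
  shows "diss_trunc N t = (\<Sum>i\<in>UNIV. \<Sum>j\<in>UNIV. L ^ 3 * (\<Sum>k\<in>freq_box N.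
     (norm (fcc L (mcoord (\<lambda>x. weak_grad L (u t) x - weak_grad L (v t) x) i j) k))\<^sup>2))"
proof -
  interpret TF: two_fields L "u t" "v t" "weak_grad L (u t)" "weak_grad L (v t)" by (rule two_fields_regular[OF assms])
  have "diss_trunc N t = L ^ 3 * (\<Sum>k\<in>freq_box N. \<Sum>i\<in>UNIV. \<Sum>j\<in>UNIV. (norm (fcc L (mcoord TF.Gw i j) k))\<^sup>2)"
    unfolding diss_trunc_def TF.sum_norm_fcc_Gw mu_def wh_def sum_distrib_left ..
  also have "\<dots> = L ^ 3 * (\<Sum>i\<in>UNIV. \<Sum>j\<in>UNIV. \<Sum>k\<in>freq_box N. (norm (fcc L (mcoord TF.Gw i j) k))\<^sup>2)"
    by (simp only: sum.swap[of _ "freq_box N" UNIV])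
  finally show ?thesis by (simp only: sum_distrib_left)
qed

lemma diss_trunc_le: "regular_time t \<Longrightarrow> diss_trunc N t \<le> diss t"
  and diss_trunc_tendsto: "regular_time t \<Longrightarrow> (\<lambda>N. diss_trunc N t) \<longlonglongrightarrow> diss t"
proof -
  assume t: "regular_time t"
  interpret TF: two_fields L "u t" "v t" "weak_grad L (u t)" "weak_grad L (v t)" by (rule two_fields_regular[OF t])
  show "diss_trunc N t \<le> diss t"
    unfolding diss_trunc_eq[OF t] diss_def sqn_mcoord[OF TF.L2_Gw]
    by (intro sum_mono sqn_trunc_le L in_L2_mcoord TF.L2_Gw finite_freq_box)
  show "(\<lambda>N. diss_trunc N t) \<longlonglongrightarrow> diss t"
    unfolding diss_trunc_eq[OF t] diss_def sqn_mcoord[OF TF.L2_Gw]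
    by (intro tendsto_sum parseval L in_L2_mcoord TF.L2_Gw)
qed

lemma mu_nonneg: "mu k \<ge> 0"
  by (simp add: mu_def)

lemma diss_trunc_nonneg: "diss_trunc N t \<ge> 0"
  unfolding diss_trunc_def using L by (intro mult_nonneg_nonneg sum_nonneg mu_nonneg) auto

lemma continuous_wh: "T > 0 \<Longrightarrow> continuous_on {0..T} (wh m k)"
proof -
  assume T: "T > 0"
  then have "weak_solution_upto L \<nu> f T u" "weak_solution_upto L \<nu> f T v"
    using su sv by (auto simp: weak_solution_def)
  then have "continuous_on {0..T} (\<lambda>t. fcc L (coord (u t) m) k - fcc L (coord (v t) m) k)"
    by (intro continuous_intros continuous_fcc_coord L) (auto simp: weak_solution_upto_def)
  then show ?thesis by (rule continuous_on_eq) (simp add: wh_eq)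
qed

lemma integrable_diss_trunc:
  assumes "0 \<le> s" shows "integrable (lebesgue_on {s..t}) (diss_trunc N)"
proof -
  interpret finite_measure "lebesgue_on {s..t}" by (rule finite_measure_lebesgue_on) simp
  have "continuous_on {0..max t 1} (diss_trunc N)"
    unfolding diss_trunc_def by (intro continuous_intros continuous_wh) auto
  then have c: "continuous_on {s..t} (diss_trunc N)" by (rule continuous_on_subset) (use assms in auto)
  then have "bounded (diss_trunc N ` {s..t})" by (intro compact_imp_bounded compact_continuous_image compact_Icc)
  then obtain B where "\<And>x. x \<in> {s..t} \<Longrightarrow> norm (diss_trunc N x) \<le> B" unfolding bounded_iff by blast
  then show ?thesis
    by (intro integrable_const_bound[of _ B] AE_I2 continuous_borel_measurable_lebesgue_on c) simp
qed

lemma integrable_diss: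
  assumes st: "0 \<le> s" "s \<le> t" shows "integrable (lebesgue_on {s..t}) diss"
proof -
  define T where "T = t + 1"
  have T: "T > 0" "t \<le> T" using st by (auto simp: T_def)
  have ws: "weak_solution_upto L \<nu> f T u" "weak_solution_upto L \<nu> f T v"
    using su sv T by (auto simp: weak_solution_def)
  have "integrable (lebesgue_on {0..T}) (\<lambda>x. 2 * (H1_norm L (u x))\<^sup>2 + 2 * (H1_norm L (v x))\<^sup>2)"
    using ws by (auto simp: weak_solution_upto_def L2_H1_def)
  then have i: "integrable (lebesgue_on {s..t}) (\<lambda>x. 2 * (H1_norm L (u x))\<^sup>2 + 2 * (H1_norm L (v x))\<^sup>2)"
    by (rule integrable_subinterval) (use st T in auto)
  have reg: "AE x in lebesgue_on {s..t}. regular_time x" by (rule AE_regular_time[OF st(1)])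
  \<comment> \<open>Measurability of \<open>diss\<close> is taken from the truncations, which are
    continuous in time and converge at almost every time.\<close>
  have "(\<lambda>x. lim (\<lambda>N. diss_trunc N x)) \<in> borel_measurable (lebesgue_on {s..t})"
    by (rule borel_measurable_lim_metric) (rule borel_measurable_integrable[OF integrable_diss_trunc[OF st(1)]])
  moreover have "AE x in lebesgue_on {s..t}. lim (\<lambda>N. diss_trunc N x) = diss x"
    using reg by eventually_elim (rule limI[OF diss_trunc_tendsto])
  ultimately have m: "diss \<in> borel_measurable (lebesgue_on {s..t})" by (rule borel_measurable_lebesgue_on_AE)
  show ?thesis
  proof (rule Bochner_Integration.integrable_bound[OF i m])
    show "AE x in lebesgue_on {s..t}. norm (diss x) \<le> norm (2 * (H1_norm L (u x))\<^sup>2 + 2 * (H1_norm L (v x))\<^sup>2)"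
      using reg
    proof eventually_elim
      case (elim x)
      interpret TF: two_fields L "u x" "v x" "weak_grad L (u x)" "weak_grad L (v x)" by (rule two_fields_regular[OF elim])
      have n: "in_L2 L (\<lambda>y. - weak_grad L (v x) y)" "sqn L (\<lambda>y. - weak_grad L (v x) y) = sqn L (weak_grad L (v x))"
        using in_L2_diff[OF in_L2_zero TF.L2_Gv] by (auto simp: sqn_def)
      have "diss x \<le> 2 * sqn L (weak_grad L (u x)) + 2 * sqn L (weak_grad L (v x))"
        unfolding diss_def using in_L2_add(2)[OF TF.L2_Gu n(1)] by (simp add: n(2))
      also have "\<dots> \<le> 2 * (H1_norm L (u x))\<^sup>2 + 2 * (H1_norm L (v x))\<^sup>2"
        unfolding H1_norm_sq by simp
      finally show ?case by (simp add: diss_def)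
    qed
  qed
qed

lemma rate_sum:
  assumes "regular_time t"
  shows "L ^ 3 * (\<Sum>k\<in>freq_box N. rate k t) = \<nu> * diss_trunc N t
     + Re (two_fields.flux L (u t) (v t) (weak_grad L (u t)) (weak_grad L (v t)) N)"
  unfolding flux_fourier[OF two_fields_regular[OF assms]] diss_trunc_def rate_def nl_def wh_def
  by (simp add: sum.distrib sum_distrib_left distrib_left mult_ac)

text \<open>The assumed flux bound contains \<open>diss\<close> and not \<open>diss_trunc N\<close>,
  so nothing is absorbed at fixed \<open>N\<close>. The truncated balance has
  \<open>- 2 * \<nu>\<close> times the integral of \<open>diss_trunc N\<close> and at most
  \<open>\<nu>\<close> times the integral of \<open>diss\<close>; dominated convergence combines the
  two.\<close>

lemma energy_inequality:
  assumes flux: "\<And>t N. regular_time t \<Longrightarrow>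
      norm (two_fields.flux L (u t) (v t) (weak_grad L (u t)) (weak_grad L (v t)) N) \<le> \<nu> / 2 * diss t"
    and st: "0 \<le> s" "s \<le> t"
  shows "energy t + \<nu> * (LINT x|lebesgue_on {s..t}. diss x) \<le> energy s"
proof -
  let ?M = "lebesgue_on {s..t}"
  have reg: "AE x in ?M. regular_time x" by (rule AE_regular_time[OF st(1)])
  have trunc: "energy_trunc N t - energy_trunc N s \<le> - 2 * \<nu> * (LINT x|?M. diss_trunc N x) + \<nu> * (LINT x|?M. diss x)" for N
  proof -
    have ri: "integrable ?M (rate k)" for k by (rule mode_energy(2)[OF st])
    have "energy_trunc N t - energy_trunc N s = L ^ 3 * (\<Sum>k\<in>freq_box N. (\<Sum>m\<in>UNIV. (norm (wh m k t))\<^sup>2) - (\<Sum>m\<in>UNIV. (norm (wh m k s))\<^sup>2))"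
      unfolding energy_trunc_def by (simp only: sum_subtractf right_diff_distrib)
    also have "\<dots> = - 2 * (L ^ 3 * (\<Sum>k\<in>freq_box N. LINT x|?M. rate k x))"
      unfolding mode_energy(1)[OF st] sum_distrib_left[symmetric] by simp
    also have "L ^ 3 * (\<Sum>k\<in>freq_box N. LINT x|?M. rate k x) = (LINT x|?M. L ^ 3 * (\<Sum>k\<in>freq_box N. rate k x))"
      using ri by (simp add: Bochner_Integration.integral_sum)
    also have "- 2 * \<dots> = (LINT x|?M. - 2 * (L ^ 3 * (\<Sum>k\<in>freq_box N. rate k x)))" by simp
    also have "\<dots> \<le> (LINT x|?M. - 2 * \<nu> * diss_trunc N x + \<nu> * diss x)"
    proof (rule integral_mono_AE)
      show "integrable ?M (\<lambda>x. - 2 * (L ^ 3 * (\<Sum>k\<in>freq_box N. rate k x)))" using ri by simp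
      show "integrable ?M (\<lambda>x. - 2 * \<nu> * diss_trunc N x + \<nu> * diss x)"
        using integrable_diss_trunc[OF st(1)] integrable_diss[OF st] by simp
      show "AE x in ?M. - 2 * (L ^ 3 * (\<Sum>k\<in>freq_box N. rate k x)) \<le> - 2 * \<nu> * diss_trunc N x + \<nu> * diss x"
        using reg
      proof eventually_elim
        case (elim x)
        let ?F = "two_fields.flux L (u x) (v x) (weak_grad L (u x)) (weak_grad L (v x)) N"
        have "\<bar>Re ?F\<bar> \<le> \<nu> / 2 * diss x" by (rule order_trans[OF abs_Re_le_cmod flux[OF elim]])
        then have "- 2 * Re ?F \<le> \<nu> * diss x" by simp
        then show ?case unfolding rate_sum[OF elim] by (simp add: algebra_simps)
      qed
    qed
    also have "\<dots> = - 2 * \<nu> * (LINT x|?M. diss_trunc N x) + \<nu> * (LINT x|?M. diss x)"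
      using integrable_diss_trunc[OF st(1)] integrable_diss[OF st] by simp
    finally show ?thesis .
  qed
  have "(\<lambda>N. LINT x|?M. diss_trunc N x) \<longlonglongrightarrow> (LINT x|?M. diss x)"
  proof (rule integral_dominated_convergence[OF _ _ integrable_diss[OF st]])
    show "diss \<in> borel_measurable ?M" using integrable_diss[OF st] by simp
    show "diss_trunc N \<in> borel_measurable ?M" for N using integrable_diss_trunc[OF st(1)] by simp
    show "AE x in ?M. (\<lambda>N. diss_trunc N x) \<longlonglongrightarrow> diss x"
      using reg by eventually_elim (rule diss_trunc_tendsto)
    show "AE x in ?M. norm (diss_trunc N x) \<le> diss x" for N
      using reg by eventually_elim (simp add: diss_trunc_nonneg diss_trunc_le)
  qed
  then have "(\<lambda>N. - 2 * \<nu> * (LINT x|?M. diss_trunc N x) + \<nu> * (LINT x|?M. diss x)) \<longlonglongrightarrow> - 2 * \<nu> * (LINT x|?M. diss x) + \<nu> * (LINT x|?M. diss x)"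
    by (intro tendsto_intros)
  then have "energy t - energy s \<le> - 2 * \<nu> * (LINT x|?M. diss x) + \<nu> * (LINT x|?M. diss x)"
  proof (rule LIMSEQ_le[rotated])
    show "(\<lambda>N. energy_trunc N t - energy_trunc N s) \<longlonglongrightarrow> energy t - energy s"
      using st by (intro tendsto_diff energy_trunc_tendsto) auto
  qed (use trunc in blast)
  then show ?thesis by (simp add: algebra_simps)
qed

text \<open>The zeroth mode vanishes by the zero mean, and every other integer frequency has norm at
  least 1.\<close>

lemma poincare:
  assumes "regular_time t" shows "(2 * pi / L)\<^sup>2 * energy t \<le> diss t"
proof -
  have t: "t \<ge> 0" using assms by (simp add: regular_time_def)
  have "(2 * pi / L)\<^sup>2 * energy_trunc N t \<le> diss_trunc N t" for N
  proof -
    have "(2 * pi / L)\<^sup>2 * (\<Sum>m\<in>UNIV. (norm (wh m k t))\<^sup>2) \<le> mu k * (\<Sum>m\<in>UNIV. (norm (wh m k t))\<^sup>2)" for k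
    proof (cases "k = 0")
      case True
      then show ?thesis by (simp add: wh_zero[OF t])
    next
      case False
      then obtain l where l: "k $ l \<noteq> 0" by (auto simp: vec_eq_iff)
      then have "1 \<le> \<bar>k $ l\<bar>" by linarith
      then have "1 \<le> real_of_int \<bar>k $ l\<bar>" by linarith
      also have "\<dots> \<le> norm (freq k)" using component_le_norm_cart[of "freq k" l] by (simp add: freq_def)
      finally have "1 \<le> (norm (freq k))\<^sup>2" by (simp add: one_le_power)
      then have "(2 * pi / L)\<^sup>2 * 1 \<le> mu k" unfolding mu_def by (intro mult_left_mono) auto
      then show ?thesis by (intro mult_right_mono sum_nonneg) auto
    qed
    then have "L ^ 3 * (\<Sum>k\<in>freq_box N. (2 * pi / L)\<^sup>2 * (\<Sum>m\<in>UNIV. (norm (wh m k t))\<^sup>2)) \<le> diss_trunc N t"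
      unfolding diss_trunc_def using L by (intro mult_left_mono sum_mono) auto
    then show ?thesis unfolding energy_trunc_def sum_distrib_left[symmetric] by (simp only: mult.left_commute)
  qed
  moreover have "(\<lambda>N. (2 * pi / L)\<^sup>2 * energy_trunc N t) \<longlonglongrightarrow> (2 * pi / L)\<^sup>2 * energy t"
    by (intro tendsto_intros energy_trunc_tendsto t)
  ultimately show ?thesis using LIMSEQ_le[OF _ diss_trunc_tendsto[OF assms]] by blast
qed

lemma energy_nonneg: "energy t \<ge> 0"
  by (simp add: energy_def)

text \<open>The energy is nonincreasing, so its value at \<open>t\<close> is at most every earlier
  one. Integrating Poincare's inequality and using the energy inequality from time 0 gives a decay
  like \<open>1 / t\<close>.\<close>

lemma energy_decay:
  assumes flux: "\<And>t N. regular_time t \<Longrightarrow>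
      norm (two_fields.flux L (u t) (v t) (weak_grad L (u t)) (weak_grad L (v t)) N) \<le> \<nu> / 2 * diss t"
    and t: "t \<ge> 0"
  shows "t * (\<nu> * (2 * pi / L)\<^sup>2 * energy t) \<le> energy 0"
proof -
  have mono: "energy t \<le> energy x" if "x \<in> {0..t}" for x
  proof -
    have "0 \<le> \<nu> * (LINT y|lebesgue_on {x..t}. diss y)"
      using nu by (intro mult_nonneg_nonneg integral_nonneg_AE) (auto simp: diss_def)
    then show ?thesis using energy_inequality[OF flux, of x t] that by simp
  qed
  interpret finite_measure "lebesgue_on {0..t}" by (rule finite_measure_lebesgue_on) simp
  have "t * ((2 * pi / L)\<^sup>2 * energy t) = (LINT x|lebesgue_on {0..t}. (2 * pi / L)\<^sup>2 * energy t)"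
    using t by (simp add: measure_restrict_space)
  also have "\<dots> \<le> (LINT x|lebesgue_on {0..t}. diss x)"
  proof (rule integral_mono_AE)
    show "integrable (lebesgue_on {0..t}) diss" using t by (intro integrable_diss) auto
    have "AE x in lebesgue_on {0..t}. regular_time x" by (rule AE_regular_time) simp
    moreover have "AE x in lebesgue_on {0..t}. x \<in> {0..t}" by (intro AE_I2) simp
    ultimately show "AE x in lebesgue_on {0..t}. (2 * pi / L)\<^sup>2 * energy t \<le> diss x"
    proof eventually_elim
      case (elim x)
      have "(2 * pi / L)\<^sup>2 * energy t \<le> (2 * pi / L)\<^sup>2 * energy x" by (intro mult_left_mono mono elim(2)) simp
      then show ?case using poincare[OF elim(1)] by linarith
    qed
  qed simp
  finally have "\<nu> * (t * ((2 * pi / L)\<^sup>2 * energy t)) \<le> \<nu> * (LINT x|lebesgue_on {0..t}. diss x)"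
    using nu by (intro mult_left_mono) auto
  also have "\<dots> \<le> energy 0" using energy_inequality[OF flux, of 0 t] t energy_nonneg[of t] by simp
  finally show ?thesis by (simp add: mult_ac)
qed

lemma energy_tendsto_0:
  assumes flux: "\<And>t N. regular_time t \<Longrightarrow>
      norm (two_fields.flux L (u t) (v t) (weak_grad L (u t)) (weak_grad L (v t)) N) \<le> \<nu> / 2 * diss t"
  shows "(energy \<longlongrightarrow> 0) at_top"
proof -
  define K where "K = \<nu> * (2 * pi / L)\<^sup>2"
  have K: "K > 0" using nu L by (simp add: K_def)
  have "((\<lambda>t. energy 0 / K / t) \<longlongrightarrow> 0) at_top"
    by (intro tendsto_divide_0[OF tendsto_const] filterlim_at_top_imp_at_infinity filterlim_ident)
  moreover have "\<forall>\<^sub>F t in at_top. norm (energy t) \<le> energy 0 / K / t"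
    using eventually_gt_at_top[of 0]
  proof eventually_elim
    case (elim t)
    have "t * (K * energy t) \<le> energy 0" using energy_decay[OF flux, of t] elim unfolding K_def by simp
    then show ?case using elim K energy_nonneg[of t] by (simp add: field_simps)
  qed
  ultimately show ?thesis by (rule Lim_null_comparison[rotated])
qed

end

theorem theorem1p1:
  fixes chi :: "real^3 \<Rightarrow> real" and r :: real
  assumes "LP_cutoff chi" and "2 < r" and "r < 3"
  shows "\<exists>c>0. \<forall>(L::real) (\<nu>::real) (f :: (real^3 \<Rightarrow> real^3) \<Rightarrow> real)
            (u :: real \<Rightarrow> real^3 \<Rightarrow> real^3) (v :: real \<Rightarrow> real^3 \<Rightarrow> real^3) (Q :: real \<Rightarrow> enat).
      L > 0 \<longrightarrow> \<nu> > 0 \<longrightarrow>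
      in_Hminus1 L f \<longrightarrow> zero_mean_force f \<longrightarrow>
      weak_solution L \<nu> f u \<longrightarrow> (\<forall>t\<ge>0. zero_mean L (u t)) \<longrightarrow>
      weak_solution L \<nu> f v \<longrightarrow> (\<forall>t\<ge>0. zero_mean L (v t)) \<longrightarrow>
      (\<forall>t>0. max (det_wavenumber chi L \<nu> c r (u t)) (det_wavenumber chi L \<nu> c r (v t))
               = lam_ext L (Q t)) \<longrightarrow>
      (\<forall>t>0. AE x in torus L. LP_low chi L (Q t) (u t) x = LP_low chi L (Q t) (v t) x) \<longrightarrow>
      ((\<lambda>t. Lp_norm L 2 (\<lambda>x. u t x - v t x)) \<longlongrightarrow> 0) at_top"
proof -
  \<comment> \<open>Makes the factor \<open>8 * trilinear_const r * (c * \<nu>)\<close> of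
    \<open>flux_bound_det\<close> equal to \<open>\<nu> / 2\<close>, so that half of the viscous
    term survives; this value depends on \<open>r\<close> alone.\<close>
  define c where "c = 1 / (16 * trilinear_const r)"
  have tc: "trilinear_const r > 0" by (rule trilinear_const_pos[OF assms(2,3)])
  have c: "c > 0" using tc by (simp add: c_def)
  have main: "((\<lambda>t. Lp_norm L 2 (\<lambda>x. u t x - v t x)) \<longlongrightarrow> 0) at_top"
    if H: "L > 0" "\<nu> > 0" "weak_solution L \<nu> f u" "\<forall>t\<ge>0. zero_mean L (u t)" "weak_solution L \<nu> f v" "\<forall>t\<ge>0. zero_mean L (v t)"
      "\<forall>t>0. max (det_wavenumber chi L \<nu> c r (u t)) (det_wavenumber chi L \<nu> c r (v t)) = lam_ext L (Q t)"
      "\<forall>t>0. AE x in torus L. LP_low chi L (Q t) (u t) x = LP_low chi L (Q t) (v t) x"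
    for L \<nu> :: real and f u v and Q :: "real \<Rightarrow> enat"
  proof -
    interpret two_solutions L \<nu> f u v by unfold_locales (use H in auto)
    have "norm (two_fields.flux L (u t) (v t) (weak_grad L (u t)) (weak_grad L (v t)) N) \<le> \<nu> / 2 * diss t"
      if t: "regular_time t" for t N
    proof -
      have "t > 0" using t by (simp add: regular_time_def)
      then have "norm (two_fields.flux L (u t) (v t) (weak_grad L (u t)) (weak_grad L (v t)) N)
         \<le> 8 * trilinear_const r * (c * \<nu>) * diss t"
        unfolding diss_def using H(7,8)
        by (intro two_fields.flux_bound_det[OF two_fields_regular[OF t] assms c H(2)]) auto
      also have "8 * trilinear_const r * (c * \<nu>) = \<nu> / 2" using tc by (simp add: c_def)
      finally show ?thesis .
    qed
    from tendsto_real_sqrt[OF energy_tendsto_0[OF this]]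
    show ?thesis by (simp add: Lp_norm_2 energy_def)
  qed
  show ?thesis
    by (intro exI[of _ c] conjI allI impI c, rule main) assumption+
qed

end
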